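(* \textsc{DC Editing (Matching Dist)}, \textsc{DC Deletion (Matching Dist)}, and \textsc{DC Completion (Matching Dist)} each admit a kernel with $O(k^2+d^2)$ vertices, and \textsc{DC Editing (Edge Dist)}, \textsc{DC Deletion (Edge Dist)}, and \textsc{DC Completion (Edge Dist)} each admit a kernel with $O(k^2+k\cdot d)$ vertices, where the parameter is $k+d$. All these kernels can be computed in $O(|V|^3)$ time, where $V$ is the vertex set of the input graph.
   Context: A cluster graph is a disjoint union of cliques. $A\oplus B$ denotes symmetric difference. Matching-based distance: for cluster graphs $G_1,G_2$ on vertex set $V$, build the complete bipartite graph between the clusters of $G_1$ and the clusters of $G_2$ with edge weight $|C\cap C'|$ between clusters $C,C'$; with $W$ the weight of a maximum-weight matching, $d_M(G_1,G_2)=|V|-W$. Edge-based distance: $d_E(G_1,G_2)=|E(G_1)\oplus E(G_2)|$. \textsc{DC Editing (X)} (with $\mathrm{dist}=d_M$ for X = Matching Dist and $d_E$ for X = Edge Dist): given a graph $G=(V,E)$ and a cluster graph $G_c$ on vertex set $V$ and nonnegative integers $k,d$, decide whether there is a cluster graph $G'$ on $V$ with $|E(G)\oplus E(G')|\le k$ and $\mathrm{dist}(G',G_c)\le d$. \textsc{DC Deletion (X)} additionally requires $E(G')\subseteq E(G)$; \textsc{DC Completion (X)} additionally requires $E(G)\subseteq E(G')$. A kernel (with respect to parameter $k+d$) is a polynomial-time algorithm mapping each instance $(G,G_c,k,d)$ to an equivalent instance $(G^*,G_c^*,k^*,d^* )$ of the same problem whose size (here: number of vertices) is bounded by the stated function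 of $k+d$. *)

theory Defs
  imports Complex_Main "HOL-Library.Disjoint_Sets"
begin

section \<open>Cluster graphs and distances\<close>

text \<open>Finite simple undirected graphs, given by a vertex set and a set of two-element edges.\<close>

definition graph :: "'a set \<Rightarrow> 'a set set \<Rightarrow> bool" where
  "graph V E \<longleftrightarrow> finite V \<and> (\<forall>e\<in>E. e \<subseteq> V \<and> card e = 2)"

definition disjoint_cliques :: "'a set \<Rightarrow> 'a set set \<Rightarrow> 'a set set \<Rightarrow> bool" where
  "disjoint_cliques V E P \<longleftrightarrow> partition_on V P \<and> E = {e. card e = 2 \<and> (\<exists>C\<in>P. e \<subseteq> C)}"

definition cluster_graph :: "'a set \<Rightarrow> 'a set set \<Rightarrow> bool" where
  "cluster_graph V E \<longleftrightarrow> finite V \<and> (\<exists>P. disjoint_cliques V E P)"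

definition clusters :: "'a set \<Rightarrow> 'a set set \<Rightarrow> 'a set set" where
  "clusters V E = (THE P. disjoint_cliques V E P)"

text \<open>A matching in the complete bipartite graph with sides \<open>A\<close> and \<open>B\<close>. Edges are ordered pairs,
  so the two sides are kept apart even if some cluster belongs to both of them.\<close>

definition bip_matching :: "'b set \<Rightarrow> 'c set \<Rightarrow> ('b \<times> 'c) set \<Rightarrow> bool" where
  "bip_matching A B M \<longleftrightarrow> M \<subseteq> A \<times> B \<and> inj_on fst M \<and> inj_on snd M"

definition matching_weight :: "('a set \<times> 'a set) set \<Rightarrow> nat" where
  "matching_weight M = (\<Sum>(C, C')\<in>M. card (C \<inter> C'))"

definition max_matching_weight :: "'a set \<Rightarrow> 'a set set \<Rightarrow> 'a set set \<Rightarrow> nat" where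
  "max_matching_weight V E1 E2 =
     Max {matching_weight M |M. bip_matching (clusters V E1) (clusters V E2) M}"

text \<open>The subtraction does not truncate; see \<open>max_matching_weight_le\<close> below.\<close>

definition matching_dist :: "'a set \<Rightarrow> 'a set set \<Rightarrow> 'a set set \<Rightarrow> nat" where
  "matching_dist V E1 E2 = card V - max_matching_weight V E1 E2"

definition edge_dist :: "'a set \<Rightarrow> 'a set set \<Rightarrow> 'a set set \<Rightarrow> nat" where
  "edge_dist V E1 E2 = card (sym_diff E1 E2)"


subsection \<open>Well-definedness\<close>

lemma disjoint_cliques_subset:
  assumes P: "disjoint_cliques V E P" and Q: "disjoint_cliques V E Q"
  shows "P \<subseteq> Q"
proof
  have same_class: "D \<subseteq> C"
    if R: "disjoint_cliques V E R" and S: "disjoint_cliques V E S"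
      and C: "C \<in> R" and D: "D \<in> S" and u: "u \<in> C" "u \<in> D" for R S C D u
  proof
    fix v assume v: "v \<in> D"
    show "v \<in> C"
    proof (cases "v = u")
      case False
      then have "card {u, v} = 2" by simp
      then have "{u, v} \<in> E" using S D u(2) v unfolding disjoint_cliques_def by blast
      then obtain C' where C': "C' \<in> R" "{u, v} \<subseteq> C'"
        using R unfolding disjoint_cliques_def by blast
      have "disjoint R" using R unfolding disjoint_cliques_def partition_on_def by blast
      then have "C' = C" using C' C u(1) unfolding disjoint_def by blast
      then show ?thesis using C' by simp
    qed (use u in simp)
  qed
  fix C assume C: "C \<in> P"
  then obtain u where u: "u \<in> C" "u \<in> V"
    using P unfolding disjoint_cliques_def partition_on_def by (metis Union_iff ex_in_conv)
  then obtain D where D: "D \<in> Q" "u \<in> D"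
    using Q unfolding disjoint_cliques_def partition_on_def by blast
  have "C = D"
    using same_class[OF P Q C D(1) u(1) D(2)] same_class[OF Q P D(1) C D(2) u(1)] by blast
  then show "C \<in> Q" using D by simp
qed

lemma clusters_eq:
  assumes "disjoint_cliques V E P"
  shows "clusters V E = P"
  unfolding clusters_def
  using assms disjoint_cliques_subset by (intro the_equality) blast+

lemma partition_on_clusters:
  assumes "cluster_graph V E"
  shows "partition_on V (clusters V E)"
  using assms clusters_eq unfolding cluster_graph_def disjoint_cliques_def by metis

lemma matching_weight_le:
  assumes "finite V" "partition_on V P" "partition_on V Q" and M: "bip_matching P Q M"
  shows "matching_weight M \<le> card V"
proof -
  have fin: "finite P" "finite Q"
    using assms(1-3) finite_elements by blast+
  have M_sub: "M \<subseteq> P \<times> Q" using M unfolding bip_matching_def by blast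
  then have "finite M" using fin finite_subset by blast
  moreover have sub: "fst x \<inter> snd x \<subseteq> V" if "x \<in> M" for x
    using that M_sub assms(2) unfolding partition_on_def by (cases x) auto
  moreover have "(fst x \<inter> snd x) \<inter> (fst y \<inter> snd y) = {}" if "x \<in> M" "y \<in> M" "x \<noteq> y" for x y
  proof -
    have "fst x \<noteq> fst y" using that M unfolding bip_matching_def inj_on_def by blast
    moreover have "fst x \<in> P" "fst y \<in> P" using that M_sub by auto
    ultimately show ?thesis
      using assms(2) unfolding partition_on_def disjoint_def by blast
  qed
  ultimately have "(\<Sum>x\<in>M. card (fst x \<inter> snd x)) = card (\<Union>x\<in>M. fst x \<inter> snd x)"
    by (subst card_UN_disjoint) (auto intro: finite_subset[OF _ assms(1)])
  also have "\<dots> \<le> card V"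
    using sub assms(1) by (intro card_mono) auto
  finally show ?thesis
    unfolding matching_weight_def by (simp add: case_prod_unfold)
qed

lemma max_matching_weight_le:
  assumes "cluster_graph V E1" "cluster_graph V E2"
  shows "finite {matching_weight M |M. bip_matching (clusters V E1) (clusters V E2) M}"
    and "max_matching_weight V E1 E2 \<le> card V"
proof -
  let ?W = "{matching_weight M |M. bip_matching (clusters V E1) (clusters V E2) M}"
  have le: "w \<le> card V" if "w \<in> ?W" for w
    using that assms matching_weight_le partition_on_clusters
    unfolding cluster_graph_def by blast
  then show fin: "finite ?W"
    by (meson finite_nat_set_iff_bounded_le)
  have "bip_matching (clusters V E1) (clusters V E2) {}"
    by (simp add: bip_matching_def)
  then have "?W \<noteq> {}" by blast
  then show "max_matching_weight V E1 E2 \<le> card V"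
    unfolding max_matching_weight_def using fin le by simp
qed


section \<open>The dynamic cluster problems\<close>

datatype variant = Editing | Deletion | Completion

datatype distance = Matching_Dist | Edge_Dist

fun dist_of :: "distance \<Rightarrow> 'a set \<Rightarrow> 'a set set \<Rightarrow> 'a set set \<Rightarrow> nat" where
  "dist_of Matching_Dist = matching_dist"
| "dist_of Edge_Dist = edge_dist"

fun admissible :: "variant \<Rightarrow> 'a set set \<Rightarrow> 'a set set \<Rightarrow> bool" where
  "admissible Editing E E' \<longleftrightarrow> True"
| "admissible Deletion E E' \<longleftrightarrow> E' \<subseteq> E"
| "admissible Completion E E' \<longleftrightarrow> E \<subseteq> E'"

definition DC_solvable ::
  "variant \<Rightarrow> distance \<Rightarrow> 'a set \<Rightarrow> 'a set set \<Rightarrow> 'a set set \<Rightarrow> nat \<Rightarrow> nat \<Rightarrow> bool" where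
  "DC_solvable X D V E Ec k d \<longleftrightarrow>
     (\<exists>E'. cluster_graph V E' \<and> admissible X E E' \<and>
           card (sym_diff E E') \<le> k \<and> dist_of D V E' Ec \<le> d)"

text \<open>As inputs of an algorithm, graphs have the vertex set \<open>{..<n}\<close>.\<close>

record dc_inst =
  num :: nat
  edges :: "nat set set"
  cedges :: "nat set set"
  budget :: nat
  bound :: nat

definition valid_inst :: "dc_inst \<Rightarrow> bool" where
  "valid_inst I \<longleftrightarrow> graph {..<num I} (edges I) \<and> cluster_graph {..<num I} (cedges I)"

definition yes_inst :: "variant \<Rightarrow> distance \<Rightarrow> dc_inst \<Rightarrow> bool" where
  "yes_inst X D I \<longleftrightarrow> DC_solvable X D {..<num I} (edges I) (cedges I) (budget I) (bound I)"


section \<open>Machine model\<close>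

text \<open>
  Structured programs for the unit-cost random access machine with addition and truncated
  subtraction, but without multiplication. A program mentions only finitely many registers and
  arrays, so the arrays can be interleaved in one memory with constant overhead. One operation
  lengthens the largest number in memory by at most one bit; hence a number of steps that is
  polynomial in the input length also gives polynomial time on Turing machines.
\<close>

datatype exp =
    Const nat
  | Reg string
  | Read string exp
  | Plus exp exp
  | Minus exp exp

datatype test = Less exp exp | Equal exp exp

datatype prog =
    Skip
  | Assign string exp
  | Store string exp exp
  | Seq prog prog
  | Cond test prog prog
  | While test prog

record store =
  reg :: "string \<Rightarrow> nat"
  arr :: "string \<Rightarrow> nat \<Rightarrow> nat"

primrec exp_val :: "exp \<Rightarrow> store \<Rightarrow> nat" where
  "exp_val (Const c) s = c"
| "exp_val (Reg x) s = reg s x"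
| "exp_val (Read a e) s = arr s a (exp_val e s)"
| "exp_val (Plus e f) s = exp_val e s + exp_val f s"
| "exp_val (Minus e f) s = exp_val e s - exp_val f s"

primrec exp_cost :: "exp \<Rightarrow> nat" where
  "exp_cost (Const c) = 1"
| "exp_cost (Reg x) = 1"
| "exp_cost (Read a e) = 1 + exp_cost e"
| "exp_cost (Plus e f) = 1 + exp_cost e + exp_cost f"
| "exp_cost (Minus e f) = 1 + exp_cost e + exp_cost f"

primrec test_val :: "test \<Rightarrow> store \<Rightarrow> bool" where
  "test_val (Less e f) s \<longleftrightarrow> exp_val e s < exp_val f s"
| "test_val (Equal e f) s \<longleftrightarrow> exp_val e s = exp_val f s"

primrec test_cost :: "test \<Rightarrow> nat" where
  "test_cost (Less e f) = 1 + exp_cost e + exp_cost f"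
| "test_cost (Equal e f) = 1 + exp_cost e + exp_cost f"

text \<open>\<open>exec p s t s'\<close>: program \<open>p\<close>, started in \<open>s\<close>, halts in \<open>s'\<close> after \<open>t\<close> steps.\<close>

inductive exec :: "prog \<Rightarrow> store \<Rightarrow> nat \<Rightarrow> store \<Rightarrow> bool" where
  Skip: "exec Skip s 1 s"
| Assign: "exec (Assign x e) s (1 + exp_cost e) (s\<lparr>reg := (reg s)(x := exp_val e s)\<rparr>)"
| Store: "exec (Store a e f) s (1 + exp_cost e + exp_cost f)
    (s\<lparr>arr := (arr s)(a := (arr s a)(exp_val e s := exp_val f s))\<rparr>)"
| Seq: "\<lbrakk>exec p s t s'; exec q s' u s''\<rbrakk> \<Longrightarrow> exec (Seq p q) s (t + u) s''"
| CondTrue: "\<lbrakk>test_val b s; exec p s t s'\<rbrakk> \<Longrightarrow> exec (Cond b p q) s (test_cost b + t) s'"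
| CondFalse: "\<lbrakk>\<not> test_val b s; exec q s t s'\<rbrakk> \<Longrightarrow> exec (Cond b p q) s (test_cost b + t) s'"
| WhileFalse: "\<not> test_val b s \<Longrightarrow> exec (While b p) s (test_cost b) s"
| WhileTrue: "\<lbrakk>test_val b s; exec p s t s'; exec (While b p) s' u s''\<rbrakk>
    \<Longrightarrow> exec (While b p) s (test_cost b + t + u) s''"

lemma exec_deterministic:
  "exec p s t s' \<Longrightarrow> exec p s u s'' \<Longrightarrow> t = u \<and> s' = s''"
proof (induction arbitrary: u s'' rule: exec.induct)
  case (Seq p s t s' q u' s2)
  from Seq.prems show ?case by cases (use Seq.IH in blast)
next
  case (WhileTrue b s p t s' u' s2)
  from WhileTrue.prems show ?case by cases (use WhileTrue.IH WhileTrue.hyps in blast)+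
qed (erule exec.cases; fastforce)+


section \<open>Kernels\<close>

text \<open>The two graphs are stored as row-major adjacency matrices.\<close>

definition adj_entry :: "nat \<Rightarrow> nat set set \<Rightarrow> nat \<Rightarrow> nat" where
  "adj_entry n E i = (if {i div n, i mod n} \<in> E then 1 else 0)"

definition represents :: "store \<Rightarrow> dc_inst \<Rightarrow> bool" where
  "represents s I \<longleftrightarrow>
     reg s ''n'' = num I \<and> reg s ''k'' = budget I \<and> reg s ''d'' = bound I \<and>
     (\<forall>i < num I * num I. arr s ''G'' i = adj_entry (num I) (edges I) i \<and>
                           arr s ''Gc'' i = adj_entry (num I) (cedges I) i)"

text \<open>All memory outside the input is initially zero.\<close>

definition input_store :: "dc_inst \<Rightarrow> store" where
  "input_store I =
     \<lparr>reg = (\<lambda>_. 0)(''n'' := num I, ''k'' := budget I, ''d'' := bound I),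
      arr = (\<lambda>_ _. 0)
        (''G'' := \<lambda>i. if i < num I * num I then adj_entry (num I) (edges I) i else 0,
         ''Gc'' := \<lambda>i. if i < num I * num I then adj_entry (num I) (cedges I) i else 0)\<rparr>"

text \<open>
  Program \<open>p\<close> is a kernelization for the problem \<open>(X, D)\<close> whose results have at most \<open>vs k d\<close>
  vertices and which runs for at most \<open>time n\<close> steps on \<open>n\<close>-vertex inputs.
\<close>

definition kernelization ::
  "prog \<Rightarrow> variant \<Rightarrow> distance \<Rightarrow> (nat \<Rightarrow> nat \<Rightarrow> nat) \<Rightarrow> (nat \<Rightarrow> nat) \<Rightarrow> bool" where
  "kernelization p X D vs time \<longleftrightarrow>
     (\<forall>I. valid_inst I \<longrightarrow>
        (\<exists>t s' I'. exec p (input_store I) t s' \<and> t \<le> time (num I) \<and>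
           represents s' I' \<and> valid_inst I' \<and>
           (yes_inst X D I' \<longleftrightarrow> yes_inst X D I) \<and>
           num I' \<le> vs (budget I) (bound I)))"

text \<open>
  The additive constants inside the O-terms are needed at the points where the bound is zero: for
  \<open>k = 0\<close> and \<open>f k d = k\<^sup>2 + k * d\<close> the problem has no-instances, but the instance without
  vertices is a yes-instance.
\<close>

definition has_cubic_time_kernel :: "variant \<Rightarrow> distance \<Rightarrow> (nat \<Rightarrow> nat \<Rightarrow> nat) \<Rightarrow> bool" where
  "has_cubic_time_kernel X D f \<longleftrightarrow>
     (\<exists>p a b. kernelization p X D (\<lambda>k d. a * (f k d + 1)) (\<lambda>n. b * (n ^ 3 + 1)))"

end

theory Submission
  imports Defs
begin

text \<open>
  A pair of vertices that lies in more than \<open>k\<close> conflict triples (induced paths on three vertices)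
  is edited by every solution, so all such pairs are flipped at once. Afterwards a yes-instance has
  at most \<open>4 * k\<^sup>2\<close> vertices in conflicts, and every other vertex lies in a clique component. A
  clique component that is also a cluster of the target graph is removed; every other one is touched
  by an edit or witnesses a difference to the target, so a yes-instance has at most \<open>2 * (k + d)\<close> of
  them. A clique component with more than \<open>k + 1\<close> vertices is a cluster of every solution. For the
  edge distance its contribution to the distance is therefore fixed, and only \<open>O(k)\<close> of its vertices
  are kept, while the differing pairs at the other vertices are paid for in advance. For the matching
  distance only \<open>O(k + d)\<close> vertices of its intersection with each target cluster are kept: more than
  \<open>d\<close> common vertices force the matching to pair the two clusters. If too many vertices are left, the
  answer is a constant no-instance.
\<close>

section \<open>Conflict triples and the matching-based distance\<close>

text \<open>A matching of clusters is awkward to restrict to fewer vertices. The matching distance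
  is therefore replaced by the least number of vertices outside a set on which both graphs have the
  same adjacency; such a set can be cut down to the kernel and filled up again. For this distance
  \<open>k + d + 2\<close> vertices per intersection serve two purposes: \<open>k + 2\<close> keep
  the component unsplittable, and more than \<open>d\<close> leave one that is matched. As a
  component may meet many target clusters, its remainder is bounded only in yes-instances, where at
  most \<open>d\<close> vertices of a large component lie outside one intersection. For the edge
  distance, \<open>k + 2\<close> vertices per component would be too many when \<open>k = 0\<close>:
  linearly many components in \<open>d\<close> may differ from the target, while the bound is
  constant. Hence \<open>3 * k\<close>, at least \<open>k + 2\<close> for positive \<open>k\<close>
  and 0 otherwise. All thresholds come from the original \<open>k\<close>, although the forced flips
  reduce the budget, so stability is stated for any \<open>k' \<le> k\<close>. The time bound is
  settled by loop nesting: conflict counts per pair take three loops, and nothing else needs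
  more.\<close>

definition adj :: "'a set set \<Rightarrow> 'a \<Rightarrow> 'a \<Rightarrow> bool" where
  "adj E u v \<longleftrightarrow> u = v \<or> {u, v} \<in> E"

text \<open>Symmetric in its three vertices and computable as a sum of three matrix entries. Because
  \<open>adj\<close> is reflexive, a triple with a repeated vertex has one or three adjacent pairs,
  so exactly two means an induced path on three distinct vertices.\<close>

definition conflict :: "'a set set \<Rightarrow> 'a \<Rightarrow> 'a \<Rightarrow> 'a \<Rightarrow> bool" where
  "conflict E u v w \<longleftrightarrow>
     of_bool (adj E u v) + of_bool (adj E u w) + of_bool (adj E v w) = (2::nat)"

text \<open>The closed neighbourhood. For a vertex in no conflict it is a clique component, and in a
  cluster graph it is the cluster of \<open>u\<close>.\<close>

definition cls :: "'a set \<Rightarrow> 'a set set \<Rightarrow> 'a \<Rightarrow> 'a set" where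
  "cls V E u = {v \<in> V. adj E u v}"

lemma adj_refl [simp]: "adj E u u"
  by (simp add: adj_def)

lemma adj_sym: "adj E u v \<longleftrightarrow> adj E v u"
  by (auto simp: adj_def insert_commute)

lemma not_conflict_trans:
  "\<lbrakk>\<not> conflict E u v w; adj E u v; adj E v w\<rbrakk> \<Longrightarrow> adj E u w"
  by (auto simp: conflict_def split: if_splits)

lemma not_conflict_adj_iff:
  "\<lbrakk>\<not> conflict E u v w; adj E u v\<rbrakk> \<Longrightarrow> adj E u w \<longleftrightarrow> adj E v w"
  by (cases "adj E u w"; cases "adj E v w") (auto simp: conflict_def)

lemma conflict_perm:
  "conflict E u v w \<longleftrightarrow> conflict E v u w" "conflict E u v w \<longleftrightarrow> conflict E u w v"
  by (simp_all add: conflict_def adj_sym[of E v u] adj_sym[of E w v] add_ac)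

lemma conflict_distinct:
  assumes "conflict E u v w" shows "u \<noteq> v" "u \<noteq> w" "v \<noteq> w"
  using assms by (auto simp: conflict_def adj_sym of_bool_def split: if_splits)

lemma conflict_cong:
  assumes "adj E u v = adj E' u v" "adj E u w = adj E' u w" "adj E v w = adj E' v w"
  shows "conflict E u v w \<longleftrightarrow> conflict E' u v w"
  using assms by (simp add: conflict_def)

lemma graph_edgeE:
  assumes "graph V E" "e \<in> E"
  obtains u v where "e = {u, v}" "u \<noteq> v" "u \<in> V" "v \<in> V"
proof -
  have "e \<subseteq> V" "card e = 2" using assms by (auto simp: graph_def)
  then show ?thesis using that by (auto simp: card_2_iff)
qed

lemma disjoint_cliques_cls:
  assumes "graph V E" and nc: "\<And>u v w. \<lbrakk>u \<in> V; v \<in> V; w \<in> V\<rbrakk> \<Longrightarrow> \<not> conflict E u v w"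
  shows "disjoint_cliques V E (cls V E ` V)"
  unfolding disjoint_cliques_def
proof
  have eq: "cls V E u = cls V E v" if "u \<in> V" "v \<in> V" "adj E u v" for u v
    using that not_conflict_adj_iff[OF nc[OF that(1,2)]] by (auto simp: cls_def)
  show "partition_on V (cls V E ` V)"
  proof (rule partition_onI)
    show "\<Union> (cls V E ` V) = V" by (auto simp: cls_def)
    show "disjnt p q" if "p \<in> cls V E ` V" "q \<in> cls V E ` V" "p \<noteq> q" for p q
    proof (rule ccontr)
      assume "\<not> disjnt p q"
      then obtain x where x: "x \<in> p" "x \<in> q" by (auto simp: disjnt_def)
      from that obtain u v where uv: "p = cls V E u" "q = cls V E v" "u \<in> V" "v \<in> V" by blast
      with x have "x \<in> V" "adj E u x" "adj E v x" by (auto simp: cls_def)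
      then show False using eq[of u x] eq[of v x] uv that(3) by simp
    qed
    show "{} \<notin> cls V E ` V" by (auto simp: cls_def)
  qed
  show "E = {e. card e = 2 \<and> (\<exists>C\<in>cls V E ` V. e \<subseteq> C)}"
  proof (intro set_eqI iffI)
    fix e assume "e \<in> E"
    then obtain u v where uv: "e = {u, v}" "u \<noteq> v" "u \<in> V" "v \<in> V"
      using graph_edgeE[OF assms(1)] by metis
    then have "e \<subseteq> cls V E u" using \<open>e \<in> E\<close> by (auto simp: cls_def adj_def)
    then show "e \<in> {e. card e = 2 \<and> (\<exists>C\<in>cls V E ` V. e \<subseteq> C)}" using uv by auto
  next
    fix e assume "e \<in> {e. card e = 2 \<and> (\<exists>C\<in>cls V E ` V. e \<subseteq> C)}"
    then obtain u v x where e: "e = {u, v}" "u \<noteq> v" "x \<in> V" "e \<subseteq> cls V E x"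
      by (auto simp: card_2_iff)
    then have "adj E x u" "adj E x v" "u \<in> V" "v \<in> V" by (auto simp: cls_def)
    then have "adj E u v" using not_conflict_adj_iff[OF nc[OF e(3)]] by blast
    then show "e \<in> E" using e by (auto simp: adj_def)
  qed
qed

text \<open>Without conflicts \<open>adj\<close> is an equivalence relation on \<open>V\<close>, and
  its classes are the clusters. The local form matters: a single triple is enough to force an
  edit.\<close>

lemma cluster_graph_iff:
  "cluster_graph V E \<longleftrightarrow> graph V E \<and> (\<forall>u\<in>V. \<forall>v\<in>V. \<forall>w\<in>V. \<not> conflict E u v w)"
proof
  assume "cluster_graph V E"
  then obtain P where fin: "finite V" and P: "partition_on V P"
    and E: "E = {e. card e = 2 \<and> (\<exists>C\<in>P. e \<subseteq> C)}"
    by (auto simp: cluster_graph_def disjoint_cliques_def)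
  have "graph V E" using fin P E by (auto simp: graph_def partition_on_def)
  moreover have "\<not> conflict E u v w" if V: "u \<in> V" "v \<in> V" "w \<in> V" for u v w
  proof -
    have adjE: "\<exists>C\<in>P. x \<in> C \<and> y \<in> C" if "adj E x y" "x \<in> V" for x y
      using that E P by (auto simp: adj_def partition_on_def)
    have adjI: "adj E x y" if "C \<in> P" "x \<in> C" "y \<in> C" for C x y
      using that E by (auto simp: adj_def card_2_iff)
    have same: "C = C'" if "C \<in> P" "C' \<in> P" "x \<in> C" "x \<in> C'" for C C' x
      using that P by (auto simp: partition_on_def disjoint_def)
    have trans: "adj E x z" if "adj E x y" "adj E y z" "x \<in> V" "y \<in> V" for x y z
      using that adjE adjI same by metis
    show ?thesis
      using trans[of u v w] trans[of v u w] trans[of u w v] V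
      by (auto simp: conflict_def adj_sym[of E v u] adj_sym[of E w v] split: if_splits)
  qed
  ultimately show "graph V E \<and> (\<forall>u\<in>V. \<forall>v\<in>V. \<forall>w\<in>V. \<not> conflict E u v w)" by blast
next
  assume "graph V E \<and> (\<forall>u\<in>V. \<forall>v\<in>V. \<forall>w\<in>V. \<not> conflict E u v w)"
  then show "cluster_graph V E"
    using disjoint_cliques_cls[of V E] unfolding cluster_graph_def by (auto simp: graph_def)
qed

lemma clusters_eq_cls:
  assumes "cluster_graph V E" shows "clusters V E = cls V E ` V"
  using assms disjoint_cliques_cls clusters_eq by (metis cluster_graph_iff)

lemma cluster_adj_trans:
  assumes "cluster_graph V E" "u \<in> V" "v \<in> V" "w \<in> V" "adj E u v" "adj E v w"
  shows "adj E u w"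
  using assms not_conflict_trans unfolding cluster_graph_iff by metis

lemma cluster_cls_eq_iff:
  assumes "cluster_graph V E" "u \<in> V" "v \<in> V"
  shows "cls V E u = cls V E v \<longleftrightarrow> adj E u v"
proof
  assume eq: "cls V E u = cls V E v"
  have "v \<in> cls V E v" using assms(3) by (simp add: cls_def)
  then show "adj E u v" unfolding eq[symmetric] by (simp add: cls_def)
next
  assume "adj E u v"
  then show "cls V E u = cls V E v"
    using cluster_adj_trans[OF assms] cluster_adj_trans[OF assms(1,3,2)] adj_sym[of E u v]
    unfolding cls_def by blast
qed

section \<open>The matching distance without matchings\<close>

lemma matching_weight_eq_card:
  assumes cl: "cluster_graph V E1" "cluster_graph V E2"
    and M: "bip_matching (clusters V E1) (clusters V E2) M"
  shows "matching_weight M = card {v \<in> V. (cls V E1 v, cls V E2 v) \<in> M}"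
proof -
  have fin: "finite V" using cl by (simp add: cluster_graph_def)
  have M_sub: "M \<subseteq> cls V E1 ` V \<times> cls V E2 ` V"
    using M cl by (simp add: bip_matching_def clusters_eq_cls)
  then have "finite M" by (rule finite_subset) (use fin in simp)
  \<comment> \<open>A vertex lies in the intersection of exactly one pair of clusters, its own two,
    so the intersections that make up the weight are disjoint.\<close>
  have mem: "v \<in> fst x \<inter> snd x \<longleftrightarrow> v \<in> V \<and> (cls V E1 v, cls V E2 v) = x" if "x \<in> M" for x v
  proof -
    obtain a b where x: "x = (cls V E1 a, cls V E2 b)" "a \<in> V" "b \<in> V" using M_sub \<open>x \<in> M\<close> by blast
    have "v \<in> cls V E1 a \<longleftrightarrow> v \<in> V \<and> cls V E1 v = cls V E1 a"
      using cluster_cls_eq_iff[OF cl(1) x(2), of v] by (auto simp: cls_def)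
    moreover have "v \<in> cls V E2 b \<longleftrightarrow> v \<in> V \<and> cls V E2 v = cls V E2 b"
      using cluster_cls_eq_iff[OF cl(2) x(3), of v] by (auto simp: cls_def)
    ultimately show ?thesis using x by auto
  qed
  have "matching_weight M = (\<Sum>x\<in>M. card (fst x \<inter> snd x))"
    by (simp add: matching_weight_def case_prod_unfold)
  also have "\<dots> = card (\<Union>x\<in>M. fst x \<inter> snd x)"
  proof (subst card_UN_disjoint)
    show "\<forall>x\<in>M. finite (fst x \<inter> snd x)"
      using mem fin by (metis finite_subset subsetI)
    show "\<forall>x\<in>M. \<forall>y\<in>M. x \<noteq> y \<longrightarrow> fst x \<inter> snd x \<inter> (fst y \<inter> snd y) = {}"
      using mem by (metis (no_types, lifting) IntE Int_emptyI)
  qed (use \<open>finite M\<close> in auto)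
  also have "(\<Union>x\<in>M. fst x \<inter> snd x) = {v \<in> V. (cls V E1 v, cls V E2 v) \<in> M}"
    by (intro set_eqI) (metis (no_types, lifting) UN_iff mem mem_Collect_eq)
  finally show ?thesis .
qed

text \<open>\<open>U\<close> is the set of vertices whose two clusters are matched with each other.\<close>

lemma matching_dist_le_iff:
  assumes cl: "cluster_graph V E1" "cluster_graph V E2"
  shows "matching_dist V E1 E2 \<le> d \<longleftrightarrow>
    (\<exists>U\<subseteq>V. card (V - U) \<le> d \<and> (\<forall>u\<in>U. \<forall>v\<in>U. adj E1 u v \<longleftrightarrow> adj E2 u v))"
proof
  have fin: "finite V" using cl by (simp add: cluster_graph_def)
  let ?W = "{matching_weight M |M. bip_matching (clusters V E1) (clusters V E2) M}"
  have finW: "finite ?W" using max_matching_weight_le(1)[OF cl] .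
  {
    assume le: "matching_dist V E1 E2 \<le> d"
    have "bip_matching (clusters V E1) (clusters V E2) {}" by (simp add: bip_matching_def)
    then have "?W \<noteq> {}" by blast
    then have "max_matching_weight V E1 E2 \<in> ?W"
      unfolding max_matching_weight_def using finW Max_in by blast
    then obtain M where M: "bip_matching (clusters V E1) (clusters V E2) M"
      and w: "max_matching_weight V E1 E2 = matching_weight M" by auto
    define U where "U = {v \<in> V. (cls V E1 v, cls V E2 v) \<in> M}"
    have "card (V - U) = card V - card U"
      using fin by (intro card_Diff_subset) (auto simp: U_def)
    also have "\<dots> \<le> d"
      using le w matching_weight_eq_card[OF cl M] by (simp add: matching_dist_def U_def)
    finally have small: "card (V - U) \<le> d" .
    have agree: "adj E1 u v \<longleftrightarrow> adj E2 u v" if "u \<in> U" "v \<in> U" for u v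
    proof -
      have V: "u \<in> V" "v \<in> V" using that by (auto simp: U_def)
      have "cls V E1 u = cls V E1 v \<longleftrightarrow> cls V E2 u = cls V E2 v"
      proof -
        have inj: "inj_on fst M" "inj_on snd M" using M by (simp_all add: bip_matching_def)
        have "(cls V E1 u, cls V E2 u) \<in> M" "(cls V E1 v, cls V E2 v) \<in> M"
          using that by (auto simp: U_def)
        then show ?thesis
          using inj_onD[OF inj(1), of "(cls V E1 u, cls V E2 u)" "(cls V E1 v, cls V E2 v)"]
            inj_onD[OF inj(2), of "(cls V E1 u, cls V E2 u)" "(cls V E1 v, cls V E2 v)"]
          unfolding fst_conv snd_conv prod.inject by argo
      qed
      then show ?thesis
        using cluster_cls_eq_iff[OF cl(1) V] cluster_cls_eq_iff[OF cl(2) V] by simp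
    qed
    show "\<exists>U\<subseteq>V. card (V - U) \<le> d \<and> (\<forall>u\<in>U. \<forall>v\<in>U. adj E1 u v \<longleftrightarrow> adj E2 u v)"
    proof (intro exI conjI ballI)
      show "U \<subseteq> V" by (auto simp: U_def)
    qed (use small agree in auto)
  }
  assume "\<exists>U\<subseteq>V. card (V - U) \<le> d \<and> (\<forall>u\<in>U. \<forall>v\<in>U. adj E1 u v \<longleftrightarrow> adj E2 u v)"
  then obtain U where U: "U \<subseteq> V" "card (V - U) \<le> d"
    and ag: "\<And>u v. u \<in> U \<Longrightarrow> v \<in> U \<Longrightarrow> adj E1 u v \<longleftrightarrow> adj E2 u v" by blast
  \<comment> \<open>Agreement on \<open>U\<close> says that two vertices of \<open>U\<close> share a
    cluster of one graph iff they share one of the other; this is injectivity of both projections.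
    The weight may exceed \<open>card U\<close>, as further vertices may lie in matched
    pairs.\<close>
  define M where "M = (\<lambda>u. (cls V E1 u, cls V E2 u)) ` U"
  have same: "cls V E1 u = cls V E1 v \<longleftrightarrow> cls V E2 u = cls V E2 v" if "u \<in> U" "v \<in> U" for u v
  proof -
    have "u \<in> V" "v \<in> V" using that U(1) by auto
    then show ?thesis
      using ag[OF that] cluster_cls_eq_iff[OF cl(1)] cluster_cls_eq_iff[OF cl(2)] by simp
  qed
  have "bip_matching (cls V E1 ` V) (cls V E2 ` V) M"
    unfolding bip_matching_def
  proof (intro conjI)
    show "M \<subseteq> cls V E1 ` V \<times> cls V E2 ` V" using U(1) by (auto simp: M_def)
    show "inj_on fst M" unfolding M_def inj_on_def by (simp add: same)
    show "inj_on snd M" unfolding M_def inj_on_def by (simp add: same[symmetric])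
  qed
  then have M: "bip_matching (clusters V E1) (clusters V E2) M"
    using cl by (simp add: clusters_eq_cls)
  have "card U \<le> card {v \<in> V. (cls V E1 v, cls V E2 v) \<in> M}"
    using U(1) fin by (intro card_mono) (auto simp: M_def)
  also have "\<dots> \<le> max_matching_weight V E1 E2"
    unfolding max_matching_weight_def matching_weight_eq_card[OF cl M, symmetric]
    by (rule Max_ge[OF finW]) (use M in blast)
  finally show "matching_dist V E1 E2 \<le> d"
    using U(2) card_Diff_subset[OF finite_subset[OF U(1) fin] U(1)]
    unfolding matching_dist_def by linarith
qed

section \<open>Forced edits\<close>

lemma adj_differ_iff:
  "adj E u v \<noteq> adj E' u v \<longleftrightarrow> u \<noteq> v \<and> {u, v} \<in> sym_diff E E'"
  by (auto simp: adj_def)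

lemma graph_finite_edges: "graph V E \<Longrightarrow> finite E"
  unfolding graph_def by (metis PowI finite_Pow_iff finite_subset subsetI)

lemma graph_edge_subset: "graph V E \<Longrightarrow> e \<in> E \<Longrightarrow> e \<subseteq> V"
  by (auto simp: graph_def)

lemma cluster_graph_graph: "cluster_graph V E \<Longrightarrow> graph V E"
  by (simp add: cluster_graph_iff)

lemma cluster_graphI:
  assumes "graph V E"
    and "\<And>u v w. \<lbrakk>u \<in> V; v \<in> V; w \<in> V; adj E u v; adj E v w\<rbrakk> \<Longrightarrow> adj E u w"
  shows "cluster_graph V E"
  unfolding cluster_graph_iff
proof (intro conjI ballI)
  fix u v w assume V: "u \<in> V" "v \<in> V" "w \<in> V"
  have "adj E u v \<Longrightarrow> adj E v w \<Longrightarrow> adj E u w" "adj E u v \<Longrightarrow> adj E u w \<Longrightarrow> adj E v w"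
    "adj E u w \<Longrightarrow> adj E v w \<Longrightarrow> adj E u v"
    using assms(2)[OF V] assms(2)[OF V(2,1,3)] assms(2)[OF V(1,3,2)]
    unfolding adj_sym[of E v u] adj_sym[of E w v] by blast+
  then show "\<not> conflict E u v w"
    by (cases "adj E u v"; cases "adj E u w"; cases "adj E v w") (simp_all add: conflict_def)
qed (rule assms(1))

lemma cluster_adj_cong:
  assumes "cluster_graph V E" "u \<in> V" "v \<in> V" "w \<in> V" "adj E u v"
  shows "adj E u w \<longleftrightarrow> adj E v w"
  using not_conflict_adj_iff[of E u v w] assms unfolding cluster_graph_iff by blast

text \<open>Turns \<open>admissible\<close> into a condition on each edited pair separately, so that
  all three variants share one proof.\<close>

fun flippable :: "variant \<Rightarrow> 'a set set \<Rightarrow> 'a set \<Rightarrow> bool" where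
  "flippable Editing E e \<longleftrightarrow> True"
| "flippable Deletion E e \<longleftrightarrow> e \<in> E"
| "flippable Completion E e \<longleftrightarrow> e \<notin> E"

lemma admissible_iff: "admissible X E E' \<longleftrightarrow> (\<forall>e\<in>sym_diff E E'. flippable X E e)"
  by (cases X) auto

lemma flippable_cong: "(e \<in> E \<longleftrightarrow> e \<in> E') \<Longrightarrow> flippable X E e \<longleftrightarrow> flippable X E' e"
  by (cases X) auto

text \<open>The restriction to pairs that the variant may change keeps the simultaneous flip
  admissible. An admissible solution edits only such pairs, so each pair it edits outside this set
  is in at most \<open>k\<close> conflicts.\<close>

definition heavy :: "variant \<Rightarrow> 'a set \<Rightarrow> 'a set set \<Rightarrow> nat \<Rightarrow> 'a set set" where
  "heavy X V E k = {{u, v} |u v. u \<in> V \<and> v \<in> V \<and> u \<noteq> v \<and> flippable X E {u, v} \<and>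
                                 k < card {w \<in> V. conflict E u v w}}"

definition conflicted :: "'a set \<Rightarrow> 'a set set \<Rightarrow> 'a set" where
  "conflicted V E = {u \<in> V. \<exists>v\<in>V. \<exists>w\<in>V. conflict E u v w}"

text \<open>Charges each \<open>z\<close> to one of the pairs joining it to \<open>x\<close> or
  \<open>y\<close>; distinct \<open>z\<close> get distinct pairs, and none of them is
  \<open>{x, y}\<close>. Serves for forced edits, for conflicts created by flips, and for the
  stability of large cliques.\<close>

lemma card_third_vertices_le:
  assumes "finite F" and Z: "\<And>z. z \<in> Z \<Longrightarrow> z \<noteq> x \<and> z \<noteq> y \<and> ({x, z} \<in> F \<or> {y, z} \<in> F)"
  shows "card Z \<le> card (F - {{x, y}})"
proof -
  define f where "f z = (if {x, z} \<in> F then {x, z} else {y, z})" for z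
  have "inj_on f Z" using Z by (auto simp: inj_on_def f_def doubleton_eq_iff split: if_splits)
  moreover have "f ` Z \<subseteq> F - {{x, y}}"
    using Z by (auto simp: f_def doubleton_eq_iff)
  ultimately show ?thesis using assms(1) by (metis card_inj_on_le finite_Diff)
qed

text \<open>If the pair were left alone, each of its conflicts would have to be destroyed at a pair
  containing the third vertex, and different third vertices need different edits.\<close>

lemma heavy_subset_edits:
  assumes E': "cluster_graph V E'" and E: "graph V E"
    and adm: "admissible X E E'" and k: "card (sym_diff E E') \<le> k"
  shows "heavy X V E k \<subseteq> sym_diff E E'"
proof
  fix e assume "e \<in> heavy X V E k"
  then obtain u v where e: "e = {u, v}" "u \<in> V" "v \<in> V" "u \<noteq> v"
    and card: "k < card {w \<in> V. conflict E u v w}" by (auto simp: heavy_def)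
  have fin: "finite (sym_diff E E')"
    using E cluster_graph_graph[OF E'] graph_finite_edges by blast
  show "e \<in> sym_diff E E'"
  proof (rule ccontr)
    assume not: "e \<notin> sym_diff E E'"
    have "card {w \<in> V. conflict E u v w} \<le> card (sym_diff E E' - {{u, v}})"
    proof (rule card_third_vertices_le[OF fin])
      fix z assume z: "z \<in> {w \<in> V. conflict E u v w}"
      then have "\<not> conflict E' u v z" using E' e unfolding cluster_graph_iff by blast
      moreover have "adj E u v = adj E' u v" using not e adj_differ_iff[of E u v E'] by blast
      ultimately have "adj E u z \<noteq> adj E' u z \<or> adj E v z \<noteq> adj E' v z"
        using z conflict_cong[of E u v E' z] by blast
      then have "{u, z} \<in> sym_diff E E' \<or> {v, z} \<in> sym_diff E E'"
        unfolding adj_differ_iff by blast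
      moreover have "z \<noteq> u \<and> z \<noteq> v" using conflict_distinct[of E u v z] z by blast
      ultimately show "z \<noteq> u \<and> z \<noteq> v \<and> ({u, z} \<in> sym_diff E E' \<or> {v, z} \<in> sym_diff E E')"
        by blast
    qed
    also have "\<dots> \<le> card (sym_diff E E')" by (rule card_mono[OF fin]) auto
    finally show False using k card by linarith
  qed
qed

lemma graph_sym_diff_heavy:
  assumes "graph V E" shows "graph V (sym_diff E (heavy X V E k))"
  using assms by (auto simp: graph_def heavy_def)

text \<open>All of \<open>F\<close> is determined by the original graph and lies in the edit set of
  every solution, so the same \<open>E'\<close> serves both sides and its edit set shrinks by
  exactly \<open>F\<close>. Conversely, the flips are admissible because heavy pairs are
  flippable.\<close>

theorem DC_solvable_flip_heavy:
  fixes X :: variant and k :: nat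
  assumes E: "graph V E"
  defines "F \<equiv> heavy X V E k"
  shows "DC_solvable X D V E Ec k d \<longleftrightarrow>
    card F \<le> k \<and> DC_solvable X D V (sym_diff E F) Ec (k - card F) d"
proof
  assume "DC_solvable X D V E Ec k d"
  then obtain E' where E': "cluster_graph V E'" "admissible X E E'"
    "card (sym_diff E E') \<le> k" "dist_of D V E' Ec \<le> d" by (auto simp: DC_solvable_def)
  have sub: "F \<subseteq> sym_diff E E'"
    unfolding F_def using heavy_subset_edits[OF E'(1) E E'(2,3)] .
  have fin: "finite (sym_diff E E')"
    using E cluster_graph_graph[OF E'(1)] graph_finite_edges by blast
  have eq: "sym_diff (sym_diff E F) E' = sym_diff E E' - F" using sub by blast
  have "card F \<le> k" using card_mono[OF fin sub] E'(3) by linarith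
  moreover have "card (sym_diff (sym_diff E F) E') \<le> k - card F"
    unfolding eq using card_Diff_subset[OF finite_subset[OF sub fin] sub] E'(3) by linarith
  moreover have "admissible X (sym_diff E F) E'"
    unfolding admissible_iff eq
  proof
    fix e assume "e \<in> sym_diff E E' - F"
    then show "flippable X (sym_diff E F) e"
      using E'(2) flippable_cong[of e E "sym_diff E F" X] unfolding admissible_iff by blast
  qed
  ultimately show "card F \<le> k \<and> DC_solvable X D V (sym_diff E F) Ec (k - card F) d"
    unfolding DC_solvable_def using E'(1,4) by blast
next
  assume *: "card F \<le> k \<and> DC_solvable X D V (sym_diff E F) Ec (k - card F) d"
  then obtain E' where E': "cluster_graph V E'" "admissible X (sym_diff E F) E'"
    "card (sym_diff (sym_diff E F) E') \<le> k - card F" "dist_of D V E' Ec \<le> d"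
    by (auto simp: DC_solvable_def)
  have finF: "finite F"
    using graph_finite_edges[OF graph_sym_diff_heavy[OF E, of X k]] graph_finite_edges[OF E]
    unfolding F_def by (metis finite_Diff2 finite_Un Un_Diff_cancel2)
  have fin: "finite (sym_diff (sym_diff E F) E')"
    using finF graph_finite_edges[OF E] graph_finite_edges[OF cluster_graph_graph[OF E'(1)]] by blast
  have "card (sym_diff E E') \<le> card (sym_diff (sym_diff E F) E' \<union> F)"
    by (rule card_mono) (use fin finF in auto)
  also have "\<dots> \<le> k" using card_Un_le[of "sym_diff (sym_diff E F) E'" F] E'(3) * by linarith
  finally have "card (sym_diff E E') \<le> k" .
  moreover have "admissible X E E'"
    unfolding admissible_iff
  proof
    fix e assume e: "e \<in> sym_diff E E'"
    show "flippable X E e"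
    proof (cases "e \<in> F")
      case False
      then have "e \<in> sym_diff (sym_diff E F) E'" using e by blast
      then show ?thesis
        using E'(2) False flippable_cong[of e E "sym_diff E F" X] unfolding admissible_iff by blast
    qed (auto simp: F_def heavy_def)
  qed
  ultimately show "DC_solvable X D V E Ec k d"
    unfolding DC_solvable_def using E'(1,4) by blast
qed

text \<open>Every conflict that survives the forced flips is hit by an edit of a pair outside
  \<open>heavy X V E k\<close>; such a pair was in at most \<open>k\<close> conflicts before the flips, and every flip adds
  at most one.\<close>

lemma card_conflicted_le:
  assumes E: "graph V E"
    and E': "cluster_graph V E'" "admissible X E E'" "card (sym_diff E E') \<le> k"
  shows "card (conflicted V (sym_diff E (heavy X V E k))) \<le> 4 * k * k"
proof -
  define F where "F = heavy X V E k"
  define E1 where "E1 = sym_diff E F"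
  define S where "S = sym_diff E E' - F"
  have fV: "finite V" using E by (simp add: graph_def)
  have sub: "F \<subseteq> sym_diff E E'" unfolding F_def using heavy_subset_edits[OF E'(1) E E'(2,3)] .
  have fin: "finite (sym_diff E E')"
    using E cluster_graph_graph[OF E'(1)] graph_finite_edges by blast
  have finF: "finite F" using finite_subset[OF sub fin] .
  have finS: "finite S" using fin by (simp add: S_def)
  have cardS: "card S + card F \<le> k"
    using card_Diff_subset[OF finF sub] card_mono[OF fin sub] E'(3) unfolding S_def by linarith
  have S_eq: "sym_diff E1 E' = S" using sub by (auto simp: E1_def S_def)
  \<comment> \<open>A remaining edit \<open>e\<close> accounts for its two ends and for the third
    vertices of conflicts at \<open>e\<close>: at most \<open>k\<close> old ones, as
    \<open>e\<close> is not heavy, and at most \<open>card F \<le> k\<close> that the flips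
    created.\<close>
  define N where "N e = e \<union> {z \<in> V. \<exists>x y. e = {x, y} \<and> conflict E1 x y z}" for e
  have cardN: "card (N e) \<le> 2 + 2 * k" if e: "e \<in> S" for e
  proof -
    have "e \<in> E \<or> e \<in> E'" using e by (auto simp: S_def)
    then obtain x y where xy: "e = {x, y}" "x \<noteq> y" "x \<in> V" "y \<in> V"
      using graph_edgeE[OF E] graph_edgeE[OF cluster_graph_graph[OF E'(1)]] by metis
    have "flippable X E e" using E'(2) e unfolding admissible_iff S_def by blast
    then have light: "card {w \<in> V. conflict E x y w} \<le> k"
      using e xy by (fastforce simp: S_def F_def heavy_def)
    let ?Z = "{z \<in> V. conflict E1 x y z \<and> \<not> conflict E x y z}"
    have "card ?Z \<le> card (F - {{x, y}})"
    proof (rule card_third_vertices_le[OF finF])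
      fix z assume z: "z \<in> ?Z"
      have "adj E x y = adj E1 x y" using e xy by (auto simp: adj_def S_def E1_def)
      then have "adj E x z \<noteq> adj E1 x z \<or> adj E y z \<noteq> adj E1 y z"
        using z conflict_cong[of E x y E1 z] by blast
      then have "{x, z} \<in> F \<or> {y, z} \<in> F" by (auto simp: adj_def E1_def)
      then show "z \<noteq> x \<and> z \<noteq> y \<and> ({x, z} \<in> F \<or> {y, z} \<in> F)"
        using z conflict_distinct[of E1 x y z] by blast
    qed
    also have "\<dots> \<le> card F" by (rule card_mono[OF finF]) auto
    finally have new: "card ?Z \<le> card F" .
    have sym: "conflict E1 x' y' z \<longleftrightarrow> conflict E1 x y z" if "e = {x', y'}" for x' y' z
      using that xy conflict_perm(1)[of E1 x y z] by (auto simp: doubleton_eq_iff)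
    have "N e \<subseteq> {x, y} \<union> ({w \<in> V. conflict E x y w} \<union> ?Z)"
      unfolding N_def using sym xy(1) by blast
    then have "card (N e) \<le> card ({x, y} \<union> ({w \<in> V. conflict E x y w} \<union> ?Z))"
      by (rule card_mono[rotated]) (use fV in auto)
    also have "\<dots> \<le> card {x, y} + (card {w \<in> V. conflict E x y w} + card ?Z)"
      by (meson add_left_mono card_Un_le order_trans)
    also have "\<dots> \<le> 2 + 2 * k" using xy(2) light new cardS by simp
    finally show ?thesis .
  qed
  have "conflicted V E1 \<subseteq> (\<Union>e\<in>S. N e)"
  proof
    fix u assume "u \<in> conflicted V E1"
    then obtain v w where uvw: "u \<in> V" "v \<in> V" "w \<in> V" "conflict E1 u v w"
      by (auto simp: conflicted_def)
    then have "\<not> conflict E' u v w" using E'(1) unfolding cluster_graph_iff by blast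
    then consider "adj E1 u v \<noteq> adj E' u v" | "adj E1 u w \<noteq> adj E' u w" | "adj E1 v w \<noteq> adj E' v w"
      using uvw(4) conflict_cong[of E1 u v E' w] by blast
    then show "u \<in> (\<Union>e\<in>S. N e)"
    proof cases
      case 1
      then have "{u, v} \<in> S" using adj_differ_iff S_eq by metis
      then show ?thesis by (auto simp: N_def)
    next
      case 2
      then have "{u, w} \<in> S" using adj_differ_iff S_eq by metis
      then show ?thesis by (auto simp: N_def)
    next
      case 3
      then have "{v, w} \<in> S" using adj_differ_iff S_eq by metis
      moreover have "conflict E1 v w u" using uvw(4) conflict_perm by metis
      ultimately show ?thesis using uvw(1) by (auto simp: N_def)
    qed
  qed
  moreover have "finite (N e)" if "e \<in> S" for e
  proof -
    have "e \<subseteq> V" using that graph_edge_subset[OF E] graph_edge_subset[OF cluster_graph_graph[OF E'(1)]]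
      by (auto simp: S_def)
    then show ?thesis using fV finite_subset unfolding N_def by auto
  qed
  ultimately have "card (conflicted V E1) \<le> card (\<Union>e\<in>S. N e)"
    using finS by (intro card_mono) auto
  also have "\<dots> \<le> (\<Sum>e\<in>S. card (N e))" by (rule card_UN_le[OF finS])
  also have "\<dots> \<le> card S * (2 + 2 * k)" using sum_bounded_above[of S "\<lambda>e. card (N e)", OF cardN] by simp
  also have "\<dots> \<le> k * (2 + 2 * k)" using cardS by (intro mult_right_mono) auto
  \<comment> \<open>The summand \<open>2 * k\<close> is at most \<open>2 * k * k\<close> for
    positive \<open>k\<close>; at \<open>k = 0\<close> both sides vanish.\<close>
  also have "\<dots> \<le> 4 * k * k" by (cases k) (auto simp: algebra_simps)
  finally show ?thesis unfolding E1_def F_def .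
qed

text \<open>A vertex in no conflict and its neighbours are twins with the same closed neighbourhood,
  so any conflict at \<open>z\<close> would reappear at \<open>v\<close>.\<close>

lemma cls_unconflicted:
  assumes v: "v \<in> V" "v \<notin> conflicted V E" and z: "z \<in> cls V E v"
  shows "z \<in> V" "z \<notin> conflicted V E" "cls V E z = cls V E v"
proof -
  show zV: "z \<in> V" using z by (simp add: cls_def)
  have adj_iff: "adj E z y \<longleftrightarrow> adj E v y" if "y \<in> V" for y
    using not_conflict_adj_iff[of E v z y] v z that by (auto simp: conflicted_def cls_def)
  then show "cls V E z = cls V E v" by (auto simp: cls_def)
  show "z \<notin> conflicted V E"
  proof
    assume "z \<in> conflicted V E"
    then obtain a b where "a \<in> V" "b \<in> V" "conflict E z a b" by (auto simp: conflicted_def)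
    then have "conflict E v a b" using adj_iff by (simp add: conflict_def)
    then show False using v \<open>a \<in> V\<close> \<open>b \<in> V\<close> by (auto simp: conflicted_def)
  qed
qed

lemma cls_self: "v \<in> V \<Longrightarrow> v \<in> cls V E v"
  by (simp add: cls_def)

lemma unconflicted_adj_iff:
  assumes "v \<in> V" "v \<notin> conflicted V E" "z \<in> cls V E v" "y \<in> V"
  shows "adj E z y \<longleftrightarrow> y \<in> cls V E v"
  using cls_unconflicted[OF assms(1-3)] assms(4) by (auto simp: cls_def)

text \<open>Splitting a clique component with at least \<open>k + 2\<close> vertices or joining a vertex to it takes
  more than \<open>k\<close> edits.\<close>

lemma isolated_clique_kept:
  assumes E: "graph V E" and E': "cluster_graph V E'" and card: "card (sym_diff E E') \<le> k"
    and v: "v \<in> V" "v \<notin> conflicted V E" and large: "k = 0 \<or> k + 2 \<le> card (cls V E v)"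
    and x: "x \<in> cls V E v" and y: "y \<in> V"
  shows "adj E' x y \<longleftrightarrow> adj E x y"
proof (rule ccontr)
  assume differ: "\<not> ?thesis"
  then have xy: "x \<noteq> y" "{x, y} \<in> sym_diff E E'" using adj_differ_iff[of E x y E'] by blast+
  have fin: "finite (sym_diff E E')"
    using E cluster_graph_graph[OF E'] graph_finite_edges by blast
  have fV: "finite V" using E by (simp add: graph_def)
  have pos: "card (sym_diff E E') \<noteq> 0" using xy(2) fin by auto
  have xV: "x \<in> V" using x by (simp add: cls_def)
  \<comment> \<open>Every further vertex \<open>z\<close> of the clique is adjacent to
    \<open>x\<close> and agrees with it about \<open>y\<close> in \<open>E\<close>, so changing
    \<open>{x, y}\<close> costs an edit at \<open>z\<close> as well. Together with
    \<open>{x, y}\<close> itself this makes at least \<open>k + 1\<close> edits once the clique has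
    \<open>k + 2\<close> vertices.\<close>
  have "card (cls V E v - {x, y}) \<le> card (sym_diff E E' - {{x, y}})"
  proof (rule card_third_vertices_le[OF fin])
    fix z assume z: "z \<in> cls V E v - {x, y}"
    then have zV: "z \<in> V" by (simp add: cls_def)
    have adjs: "adj E x z" "adj E x y \<longleftrightarrow> adj E z y"
      using unconflicted_adj_iff[OF v] x z zV y by blast+
    have "\<not> conflict E' x z y" using E' xV y zV unfolding cluster_graph_iff by blast
    then have "adj E x z \<noteq> adj E' x z \<or> adj E y z \<noteq> adj E' y z"
      using not_conflict_adj_iff[of E' x z y] adjs differ adj_sym[of _ y z] by blast
    then show "z \<noteq> x \<and> z \<noteq> y \<and> ({x, z} \<in> sym_diff E E' \<or> {y, z} \<in> sym_diff E E')"
      unfolding adj_differ_iff using z by blast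
  qed
  moreover have "card (sym_diff E E' - {{x, y}}) = card (sym_diff E E') - 1"
    using xy(2) by (rule card_Diff_singleton)
  moreover have "card (cls V E v) - 2 \<le> card (cls V E v - {x, y})"
    using diff_card_le_card_Diff[of "{x, y}" "cls V E v"] xy(1) by simp
  ultimately show False using pos card large by linarith
qed

section \<open>Shrinking clique components\<close>

definition induced :: "'a set set \<Rightarrow> 'a set \<Rightarrow> 'a set set" where
  "induced E S = {e \<in> E. e \<subseteq> S}"

lemma adj_induced: "u \<in> S \<Longrightarrow> v \<in> S \<Longrightarrow> adj (induced E S) u v \<longleftrightarrow> adj E u v"
  by (simp add: adj_def induced_def)

lemma conflict_induced:
  "\<lbrakk>u \<in> S; v \<in> S; w \<in> S\<rbrakk> \<Longrightarrow> conflict (induced E S) u v w \<longleftrightarrow> conflict E u v w"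
  by (rule conflict_cong) (simp_all add: adj_induced)

lemma graph_induced: "graph V E \<Longrightarrow> S \<subseteq> V \<Longrightarrow> graph S (induced E S)"
  by (auto simp: graph_def induced_def intro: finite_subset)

lemma cluster_graph_induced:
  assumes "cluster_graph V E" "S \<subseteq> V" shows "cluster_graph S (induced E S)"
  using assms graph_induced[of V E S] conflict_induced[of _ S _ _ E]
  unfolding cluster_graph_iff by (meson subsetD)

lemma sym_diff_induced: "sym_diff (induced E S) (induced E' S) = induced (sym_diff E E') S"
  by (auto simp: induced_def)

lemma card_induced_split:
  assumes "finite A" shows "card A = card (induced A S) + card {e \<in> A. \<not> e \<subseteq> S}"
proof -
  have "card (induced A S \<union> {e \<in> A. \<not> e \<subseteq> S}) = card (induced A S) + card {e \<in> A. \<not> e \<subseteq> S}"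
    using assms by (intro card_Un_disjoint) (auto simp: induced_def)
  moreover have "induced A S \<union> {e \<in> A. \<not> e \<subseteq> S} = A" by (auto simp: induced_def)
  ultimately show ?thesis by simp
qed

text \<open>The unit of trimming. For the edge distance all vertices of a component are alike,
  because the pairs lost with a vertex are charged in advance; for the matching distance a
  representative must share the target cluster too.\<close>

fun class_of :: "distance \<Rightarrow> 'a set \<Rightarrow> 'a set set \<Rightarrow> 'a set set \<Rightarrow> 'a \<Rightarrow> 'a set" where
  "class_of Matching_Dist V E Ec v = cls V E v \<inter> cls V Ec v"
| "class_of Edge_Dist V E Ec v = cls V E v"

text \<open>For the edge distance the value \<open>3 * k\<close> serves as \<open>k + 2\<close>, except that nothing has to be
  kept of a clique component if \<open>k = 0\<close>.\<close>

fun limit :: "distance \<Rightarrow> nat \<Rightarrow> nat \<Rightarrow> nat" where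
  "limit Matching_Dist k d = k + (d + 2)"
| "limit Edge_Dist k d = k + (k + k)"

text \<open>The charge can be measured between \<open>E\<close> and \<open>Ec\<close> because every
  solution coincides with \<open>E\<close> at the pairs concerned. For the matching distance a
  removed vertex never needs to be left unmatched, so it costs nothing.\<close>

fun dropped :: "distance \<Rightarrow> 'a set set \<Rightarrow> 'a set set \<Rightarrow> 'a set \<Rightarrow> nat" where
  "dropped Matching_Dist E Ec S = 0"
| "dropped Edge_Dist E Ec S = card {e \<in> sym_diff E Ec. \<not> e \<subseteq> S}"

text \<open>Abstracts from the choice of the kept vertices. A removed vertex lies in a clique
  component; either this is a target cluster and disappears as a whole, or the class of the vertex
  keeps enough members to determine how solutions treat the component.\<close>

definition reduced ::
  "distance \<Rightarrow> 'a set \<Rightarrow> 'a set set \<Rightarrow> 'a set set \<Rightarrow> nat \<Rightarrow> nat \<Rightarrow> 'a set \<Rightarrow> bool" where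
  "reduced D V E Ec k d S \<longleftrightarrow> S \<subseteq> V \<and> conflicted V E \<subseteq> S \<and>
     (\<forall>v\<in>V - S. if cls V E v = cls V Ec v then cls V E v \<inter> S = {}
                else limit D k d \<le> card (class_of D V E Ec v \<inter> S))"

lemma class_of_subset: "class_of D V E Ec v \<subseteq> cls V E v"
  by (cases D) auto

lemma finite_cls: "finite V \<Longrightarrow> finite (cls V E v)"
  by (simp add: cls_def)

lemma limit_ge: "k' \<le> k \<Longrightarrow> k' = 0 \<or> k' + 2 \<le> limit D k d"
  by (cases D) auto

text \<open>The surviving part of a trimmed component is still large enough for
  \<open>isolated_clique_kept\<close>. Here \<open>k'\<close> stands for the budget left after the
  forced flips, while \<open>limit\<close> is computed from the original \<open>k\<close>.\<close>

lemma reduced_large: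
  assumes "finite V" "reduced D V E Ec k d S" "t \<in> V - S" "cls V E t \<noteq> cls V Ec t" "k' \<le> k"
  shows "k' = 0 \<or> k' + 2 \<le> card (cls V E t \<inter> S)"
proof -
  have "limit D k d \<le> card (class_of D V E Ec t \<inter> S)"
    using assms(2-4) unfolding reduced_def by metis
  also have "\<dots> \<le> card (cls V E t \<inter> S)"
    using class_of_subset[of D V E Ec t] finite_cls[OF assms(1)] by (intro card_mono) auto
  finally show ?thesis using limit_ge[OF assms(5), of D d] by linarith
qed

text \<open>A solution restricts to \<open>S\<close>. For the edge distance at least the charge
  \<open>dropped\<close> arises outside \<open>S\<close>, so the part inside fits into the
  difference; for the matching distance the set of agreement is cut down to
  \<open>U \<inter> S\<close>, which leaves no more vertices over.\<close>

lemma solvable_induced: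
  assumes E: "graph V E" and Ec: "cluster_graph V Ec" and red: "reduced D V E Ec k d S"
    and k: "k' \<le> k" and sol: "DC_solvable X D V E Ec k' d"
  shows "dropped D E Ec S \<le> d \<and>
    DC_solvable X D S (induced E S) (induced Ec S) k' (d - dropped D E Ec S)"
proof -
  from sol obtain E' where E': "cluster_graph V E'" "admissible X E E'"
    "card (sym_diff E E') \<le> k'" "dist_of D V E' Ec \<le> d" by (auto simp: DC_solvable_def)
  have SV: "S \<subseteq> V" using red by (simp add: reduced_def)
  have fV: "finite V" using E by (simp add: graph_def)
  have gE': "graph V E'" using cluster_graph_graph[OF E'(1)] .
  have fin: "finite (sym_diff E E')" "finite (sym_diff E' Ec)"
    using E gE' cluster_graph_graph[OF Ec] graph_finite_edges by blast+
  have cl: "cluster_graph S (induced E' S)" using cluster_graph_induced[OF E'(1) SV] .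
  have adm: "admissible X (induced E S) (induced E' S)"
    unfolding admissible_iff sym_diff_induced
  proof
    fix e assume "e \<in> induced (sym_diff E E') S"
    then have "flippable X E e" "e \<in> E \<longleftrightarrow> e \<in> induced E S"
      using E'(2) unfolding admissible_iff induced_def by blast+
    then show "flippable X (induced E S) e" using flippable_cong by blast
  qed
  have "card (sym_diff (induced E S) (induced E' S)) \<le> card (sym_diff E E')"
    unfolding sym_diff_induced by (rule card_mono[OF fin(1)]) (auto simp: induced_def)
  then have edits: "card (sym_diff (induced E S) (induced E' S)) \<le> k'" using E'(3) by linarith
  have "dropped D E Ec S \<le> d \<and> dist_of D S (induced E' S) (induced Ec S) \<le> d - dropped D E Ec S"
  proof (cases D)
    case Matching_Dist
    then have "matching_dist V E' Ec \<le> d" using E'(4) by simp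
    then obtain U where U: "U \<subseteq> V" "card (V - U) \<le> d"
      and agree: "\<And>u v. u \<in> U \<Longrightarrow> v \<in> U \<Longrightarrow> adj E' u v \<longleftrightarrow> adj Ec u v"
      unfolding matching_dist_le_iff[OF E'(1) Ec] by blast
    have "card (S - U \<inter> S) \<le> card (V - U)" using fV SV by (intro card_mono) auto
    then have "matching_dist S (induced E' S) (induced Ec S) \<le> d"
      unfolding matching_dist_le_iff[OF cl cluster_graph_induced[OF Ec SV]]
      using U(2) agree by (intro exI[of _ "U \<inter> S"]) (auto simp: adj_induced)
    then show ?thesis using Matching_Dist by simp
  next
    case Edge_Dist
    have "{e \<in> sym_diff E Ec. \<not> e \<subseteq> S} \<subseteq> {e \<in> sym_diff E' Ec. \<not> e \<subseteq> S}"
    proof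
      fix e assume e: "e \<in> {e \<in> sym_diff E Ec. \<not> e \<subseteq> S}"
      have "\<exists>a b. e = {a, b} \<and> a \<noteq> b \<and> a \<in> V \<and> b \<in> V"
        using e graph_edgeE[OF E] graph_edgeE[OF cluster_graph_graph[OF Ec]] by blast
      then obtain t y where ty: "e = {t, y}" "t \<noteq> y" "t \<in> V - S" "y \<in> V"
        using e by (auto simp: insert_commute)
      have diff: "adj E t y \<noteq> adj Ec t y" using e ty adj_differ_iff[of E t y Ec] by blast
      then have ne: "cls V E t \<noteq> cls V Ec t" using ty(4) by (auto simp: cls_def)
      have t: "t \<in> V" "t \<notin> conflicted V E" using ty(3) red by (auto simp: reduced_def)
      have "card (cls V E t \<inter> S) \<le> card (cls V E t)"
        using finite_cls[OF fV] by (intro card_mono) auto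
      then have "k' = 0 \<or> k' + 2 \<le> card (cls V E t)"
        using reduced_large[OF fV red ty(3) ne k] by linarith
      then have "adj E' t y \<longleftrightarrow> adj E t y"
        using isolated_clique_kept[OF E E'(1,3) t _ cls_self[OF t(1)] ty(4)] by blast
      then have "e \<in> sym_diff E' Ec" using diff ty(1) adj_differ_iff by metis
      then show "e \<in> {e \<in> sym_diff E' Ec. \<not> e \<subseteq> S}" using e by blast
    qed
    moreover have "finite {e \<in> sym_diff E' Ec. \<not> e \<subseteq> S}"
      by (rule finite_subset[OF _ fin(2)]) auto
    ultimately have "dropped D E Ec S \<le> card {e \<in> sym_diff E' Ec. \<not> e \<subseteq> S}"
      using Edge_Dist card_mono by simp
    moreover note card_induced_split[OF fin(2), of S]
    ultimately show ?thesis
      using E'(4) Edge_Dist by (simp add: edge_dist_def sym_diff_induced)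
  qed
  then show ?thesis unfolding DC_solvable_def using cl adm edits by blast
qed

text \<open>Removed vertices return with their adjacency in \<open>E\<close>. The result stays
  transitive because a solution on \<open>S\<close> cannot afford to split or enlarge the surviving
  part of their component; no further edit is made.\<close>

lemma solvable_extend:
  assumes E: "graph V E" and Ec: "cluster_graph V Ec" and red: "reduced D V E Ec k d S"
    and k: "k' \<le> k" and dropped: "dropped D E Ec S \<le> d"
    and sol: "DC_solvable X D S (induced E S) (induced Ec S) k' (d - dropped D E Ec S)"
  shows "DC_solvable X D V E Ec k' d"
proof -
  from sol obtain E' where E': "cluster_graph S E'" "admissible X (induced E S) E'"
    "card (sym_diff (induced E S) E') \<le> k'"
    "dist_of D S E' (induced Ec S) \<le> d - dropped D E Ec S" by (auto simp: DC_solvable_def)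
  have SV: "S \<subseteq> V" using red by (simp add: reduced_def)
  have fV: "finite V" using E by (simp add: graph_def)
  have gE': "graph S E'" using cluster_graph_graph[OF E'(1)] .
  define E'' where "E'' = E' \<union> {e \<in> E. \<not> e \<subseteq> S}"
  have adj_in: "adj E'' u v \<longleftrightarrow> adj E' u v" if "u \<in> S" "v \<in> S" for u v
    using that by (simp add: adj_def E''_def)
  have adj_out: "adj E'' u v \<longleftrightarrow> adj E u v" if "\<not> (u \<in> S \<and> v \<in> S)" for u v
    using that graph_edge_subset[OF gE', of "{u, v}"] by (auto simp: adj_def E''_def)
  have removed: "t \<in> V" "t \<notin> conflicted V E" if "t \<in> V - S" for t
    using that red by (auto simp: reduced_def)
  have kept: "adj E' x y \<longleftrightarrow> adj E x y" if t: "t \<in> V - S" and x: "x \<in> cls V E t \<inter> S" and y: "y \<in> S" for t x y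
  proof -
    have "if cls V E t = cls V Ec t then cls V E t \<inter> S = {}
        else limit D k d \<le> card (class_of D V E Ec t \<inter> S)"
      using red t unfolding reduced_def by blast
    then have ne: "cls V E t \<noteq> cls V Ec t" using x by (auto split: if_splits)
    have xt: "x \<notin> conflicted V E" "cls V E x = cls V E t"
      using cls_unconflicted[OF removed[OF t]] x by auto
    have "x \<notin> conflicted S (induced E S)"
      using xt(1) SV x conflict_induced[of x S _ _ E] unfolding conflicted_def by blast
    moreover have "cls S (induced E S) x = cls V E t \<inter> S"
      using xt(2) SV x adj_induced[of x S _ E] by (auto simp: cls_def)
    ultimately show ?thesis
      using isolated_clique_kept[OF graph_induced[OF E SV] E'(1,3), of x x y]
        reduced_large[OF fV red t ne k] x y adj_induced[of x S y E] by auto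
  qed
  \<comment> \<open>Pairs inside \<open>S\<close> are read in \<open>E'\<close>, all others in
    \<open>E\<close>. If one of the three vertices was removed, \<open>kept\<close> translates
    between the two at the surviving members of its component.\<close>
  have "adj E'' x z" if V: "x \<in> V" "y \<in> V" "z \<in> V" and adjs: "adj E'' x y" "adj E'' y z" for x y z
  proof (cases "y \<in> S")
    case False
    then have "adj E x y" "adj E y z" and y: "y \<in> V - S" using adjs adj_out V by auto
    then have xz: "x \<in> cls V E y" "z \<in> cls V E y" using V adj_sym[of E x y] by (auto simp: cls_def)
    then have "adj E x z" using unconflicted_adj_iff[OF removed[OF y]] V by blast
    then show ?thesis using adj_in adj_out kept[OF y, of x z] xz by blast
  next
    case y: True
    show ?thesis
    proof (cases "x \<in> S")
      case False
      then have x: "x \<in> V - S" using V by simp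
      have "adj E x y" using adjs(1) adj_out False by blast
      then have yx: "y \<in> cls V E x" using V by (simp add: cls_def)
      have "adj E y z"
        using adjs(2) adj_in adj_out kept[OF x, of y z] yx y by blast
      then have "z \<in> cls V E x" using unconflicted_adj_iff[OF removed[OF x] yx] V by blast
      then show ?thesis using adj_out False by (auto simp: cls_def)
    next
      case x: True
      show ?thesis
      proof (cases "z \<in> S")
        case True
        then show ?thesis
          using cluster_adj_trans[OF E'(1) x y True] adjs adj_in x y by blast
      next
        case False
        then have z: "z \<in> V - S" using V by simp
        have "adj E z y" using adjs(2) adj_out False adj_sym by metis
        then have yz: "y \<in> cls V E z" using V by (simp add: cls_def)
        have "adj E y x" using adjs(1) adj_in[OF x y] kept[OF z, of y x] yz y x adj_sym[of E' x y] by blast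
        then have "x \<in> cls V E z" using unconflicted_adj_iff[OF removed[OF z] yz] V by blast
        then have "adj E x z" by (simp add: cls_def adj_sym)
        then show ?thesis using adj_out False by blast
      qed
    qed
  qed
  moreover have "graph V E''"
    using E gE' SV unfolding graph_def E''_def by blast
  ultimately have cl: "cluster_graph V E''" by (metis cluster_graphI)
  have diff: "sym_diff E E'' = sym_diff (induced E S) E'"
    using graph_edge_subset[OF gE'] by (auto simp: E''_def induced_def)
  have adm: "admissible X E E''"
    unfolding admissible_iff diff
  proof
    fix e assume e: "e \<in> sym_diff (induced E S) E'"
    then have "flippable X (induced E S) e" using E'(2) unfolding admissible_iff by blast
    moreover have "e \<in> E \<longleftrightarrow> e \<in> induced E S"
      using e graph_edge_subset[OF gE'] by (auto simp: induced_def)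
    ultimately show "flippable X E e" using flippable_cong by blast
  qed
  have "dist_of D V E'' Ec \<le> d"
  proof (cases D)
    case Edge_Dist
    have "sym_diff E'' Ec \<subseteq> sym_diff E' (induced Ec S) \<union> {e \<in> sym_diff E Ec. \<not> e \<subseteq> S}"
      using graph_edge_subset[OF gE'] by (auto simp: E''_def induced_def)
    then have "card (sym_diff E'' Ec) \<le>
        card (sym_diff E' (induced Ec S) \<union> {e \<in> sym_diff E Ec. \<not> e \<subseteq> S})"
      using E gE' cluster_graph_graph[OF Ec] graph_finite_edges
      by (intro card_mono) (auto simp: induced_def)
    also have "\<dots> \<le> card (sym_diff E' (induced Ec S)) + card {e \<in> sym_diff E Ec. \<not> e \<subseteq> S}"
      by (rule card_Un_le)
    also have "\<dots> \<le> d"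
      using E'(4) dropped Edge_Dist by (simp add: edge_dist_def)
    finally show ?thesis using Edge_Dist by (simp add: edge_dist_def)
  next
    case Matching_Dist
    then have "matching_dist S E' (induced Ec S) \<le> d" using E'(4) by simp
    then obtain U where U: "U \<subseteq> S" "card (S - U) \<le> d"
      and agree: "\<And>u v. u \<in> U \<Longrightarrow> v \<in> U \<Longrightarrow> adj E' u v \<longleftrightarrow> adj (induced Ec S) u v"
      unfolding matching_dist_le_iff[OF E'(1) cluster_graph_induced[OF Ec SV]] by blast
    have agree': "adj E'' u v \<longleftrightarrow> adj Ec u v" if "u \<in> U" "v \<in> U" for u v
      using that U(1) agree adj_in adj_induced[of u S v Ec] by blast
    \<comment> \<open>All removed vertices count as agreeing, so the vertices left over are those of
      \<open>S - U\<close> as before.\<close>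
    let ?U = "U \<union> (V - S)"
    text \<open>A removed vertex is represented by a vertex of its class that is in the same cluster of
      both graphs: the class keeps more than \<open>d\<close> vertices, so some of them are in \<open>U\<close>.\<close>
    have rep: "(\<exists>y\<in>U. adj E'' u y \<and> adj Ec u y) \<or> (\<forall>x\<in>V. adj E'' u x \<longleftrightarrow> adj Ec u x)"
      if u: "u \<in> ?U" for u
    proof (cases "u \<in> U")
      case False
      then have t: "u \<in> V - S" using u by blast
      show ?thesis
      proof (cases "cls V E u = cls V Ec u")
        case True
        then have "adj E u x \<longleftrightarrow> adj Ec u x" if "x \<in> V" for x
          using that unfolding cls_def by blast
        then show ?thesis using adj_out t by blast
      next
        case False
        then have "k + (d + 2) \<le> card (cls V E u \<inter> cls V Ec u \<inter> S)"
          using red t Matching_Dist unfolding reduced_def by (metis class_of.simps(1) limit.simps(1))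
        then have "\<not> cls V E u \<inter> cls V Ec u \<inter> S \<subseteq> S - U"
          using U(2) card_mono[of "S - U" "cls V E u \<inter> cls V Ec u \<inter> S"] finite_subset[OF SV fV]
          by fastforce
        then obtain y where "y \<in> U" "y \<in> cls V E u" "y \<in> cls V Ec u" by blast
        then show ?thesis using adj_out t unfolding cls_def by blast
      qed
    next
      case True
      then show ?thesis by (intro disjI1 bexI[of _ u]) simp_all
    qed
    have "adj E'' u v \<longleftrightarrow> adj Ec u v" if uv: "u \<in> ?U" "v \<in> ?U" for u v
    proof -
      have V: "u \<in> V" "v \<in> V" using uv U(1) SV by auto
      \<comment> \<open>If the two graphs give one of the vertices the same neighbours, nothing is
        left to show. Otherwise both have representatives in \<open>U\<close>, and adjacency is
        transported along them in either cluster graph.\<close>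
      show ?thesis
      proof (cases "(\<forall>x\<in>V. adj E'' u x \<longleftrightarrow> adj Ec u x) \<or> (\<forall>x\<in>V. adj E'' v x \<longleftrightarrow> adj Ec v x)")
        case True
        then show ?thesis using V adj_sym[of E'' u v] adj_sym[of Ec u v] by blast
      next
        case False
        then obtain y z where yz: "y \<in> U" "adj E'' u y" "adj Ec u y"
          "z \<in> U" "adj E'' v z" "adj Ec v z" using rep uv by meson
        then have yzV: "y \<in> V" "z \<in> V" using U(1) SV by auto
        have "adj E'' u v \<longleftrightarrow> adj E'' y z"
          using cluster_adj_cong[OF cl V(1) yzV(1) V(2) yz(2)]
            cluster_adj_cong[OF cl V(2) yzV(2) yzV(1) yz(5)] adj_sym[of E''] by metis
        moreover have "adj Ec u v \<longleftrightarrow> adj Ec y z"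
          using cluster_adj_cong[OF Ec V(1) yzV(1) V(2) yz(3)]
            cluster_adj_cong[OF Ec V(2) yzV(2) yzV(1) yz(6)] adj_sym[of Ec] by metis
        ultimately show ?thesis using agree' yz by blast
      qed
    qed
    moreover have "V - ?U = S - U" using SV by blast
    ultimately have "matching_dist V E'' Ec \<le> d"
      unfolding matching_dist_le_iff[OF cl Ec]
      using U SV by (intro exI[of _ ?U]) auto
    then show ?thesis using Matching_Dist by simp
  qed
  then show ?thesis unfolding DC_solvable_def using cl adm E'(3) diff by metis
qed

text \<open>A conflict-free component avoiding \<open>Z\<close> was not edited and shows no
  difference to the target, so it is a target cluster. An edit contributes its two ends, a unit of
  distance either two ends or one unmatched vertex with a companion, whence
  \<open>2 * (k + d)\<close>.\<close>

lemma hitting_set: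
  assumes E: "graph V E" and Ec: "cluster_graph V Ec" and E': "cluster_graph V E'"
    and edits: "card (sym_diff E E') \<le> k" and dist: "dist_of D V E' Ec \<le> d"
  shows "\<exists>Z\<subseteq>V. card Z \<le> 2 * (k + d) \<and>
    (\<forall>v\<in>V - conflicted V E. cls V E v \<noteq> cls V Ec v \<longrightarrow> cls V E v \<inter> Z \<noteq> {})"
proof -
  have fV: "finite V" using E by (simp add: graph_def)
  have gr: "graph V E'" "graph V Ec" using cluster_graph_graph E' Ec by auto
  have ends: "card (\<Union> (sym_diff A B)) \<le> 2 * card (sym_diff A B) \<and> \<Union> (sym_diff A B) \<subseteq> V"
    if "graph V A" "graph V B" for A B
  proof -
    have "card (\<Union> (sym_diff A B)) \<le> (\<Sum>e\<in>sym_diff A B. card e)"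
      using that graph_finite_edges by (intro card_Union_le_sum_card) 
    also have "\<dots> = (\<Sum>e\<in>sym_diff A B. 2)"
      using that by (intro sum.cong) (auto simp: graph_def)
    finally show ?thesis using that graph_edge_subset by fastforce
  qed
  let ?X = "\<Union> (sym_diff E E')"
  have agree: "adj E' x y \<longleftrightarrow> adj E x y" if "x \<notin> ?X" for x y
    using that adj_differ_iff[of E' x y E] by blast
  obtain Y where Y: "Y \<subseteq> V" "card Y \<le> 2 * d" and hit: "\<And>v. \<lbrakk>v \<in> V - conflicted V E; cls V E v \<inter> ?X = {};
      cls V E v \<inter> Y = {}\<rbrakk> \<Longrightarrow> cls V E v = cls V Ec v"
  proof (cases D)
    case Edge_Dist
    let ?Y = "\<Union> (sym_diff E' Ec)"
    have "card ?Y \<le> 2 * d" "?Y \<subseteq> V"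
      using ends[OF gr] dist Edge_Dist by (auto simp: edge_dist_def)
    moreover have "cls V E v = cls V Ec v"
      if "v \<in> V - conflicted V E" "cls V E v \<inter> ?X = {}" "cls V E v \<inter> ?Y = {}" for v
    proof -
      have "v \<notin> ?X" "v \<notin> ?Y" using that cls_self[of v V E] by blast+
      then have "adj E v y \<longleftrightarrow> adj Ec v y" for y
        using agree adj_differ_iff[of E' v y Ec] by blast
      then show ?thesis by (simp add: cls_def)
    qed
    ultimately show ?thesis using that by blast
  next
    case Matching_Dist
    then have "matching_dist V E' Ec \<le> d" using dist by simp
    then obtain U where U: "U \<subseteq> V" "card (V - U) \<le> d"
      and same: "\<And>u v. u \<in> U \<Longrightarrow> v \<in> U \<Longrightarrow> adj E' u v \<longleftrightarrow> adj Ec u v"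
      unfolding matching_dist_le_iff[OF E' Ec] by blast
    \<comment> \<open>A component may lie within \<open>U\<close> and yet be a proper part of a
      target cluster whose other vertices are outside \<open>U\<close>. For such an outside vertex
      \<open>y\<close> the companion \<open>g y\<close> lies in \<open>U\<close> and in the same
      target cluster, hence in that component, and hits it. Where no companion exists
      \<open>SOME\<close> is arbitrary; the intersection with \<open>V\<close> below discards stray
      values.\<close>
    define g where "g y = (SOME x. x \<in> U \<and> adj Ec y x)" for y
    let ?Y = "(V - U) \<union> (g ` (V - U) \<inter> V)"
    have "card ?Y \<le> card (V - U) + card (g ` (V - U) \<inter> V)" by (rule card_Un_le)
    also have "card (g ` (V - U) \<inter> V) \<le> card (g ` (V - U))"
      using fV by (intro card_mono) auto
    also have "\<dots> \<le> card (V - U)" using fV by (intro card_image_le) auto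
    finally have "card ?Y \<le> 2 * d" using U(2) by linarith
    moreover have "cls V E v = cls V Ec v"
      if v: "v \<in> V - conflicted V E" "cls V E v \<inter> ?X = {}" "cls V E v \<inter> ?Y = {}" for v
    proof -
      have clsU: "cls V E v \<subseteq> U" using v(3) by (auto simp: cls_def)
      have vU: "v \<in> U" using clsU cls_self[of v V E] v(1) by blast
      have agv: "adj E' v y \<longleftrightarrow> adj E v y" for y
        using agree[of v y] v(1,2) cls_self[of v V E] by blast
      show ?thesis
      proof (intro set_eqI iffI)
        fix x assume x: "x \<in> cls V E v"
        then have "adj Ec v x" using agv same[OF vU] clsU by (auto simp: cls_def)
        then show "x \<in> cls V Ec v" using x by (simp add: cls_def)
      next
        fix x assume "x \<in> cls V Ec v"
        then have x: "x \<in> V" "adj Ec v x" by (auto simp: cls_def)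
        show "x \<in> cls V E v"
        proof (cases "x \<in> U")
          case True
          then show ?thesis using x agv same[OF vU True] by (simp add: cls_def)
        next
          case False
          have "v \<in> U \<and> adj Ec x v" using vU x(2) adj_sym[of Ec v x] by blast
          then have g: "g x \<in> U" "adj Ec x (g x)" unfolding g_def by (metis (mono_tags, lifting) someI)+
          have gV: "g x \<in> V" using g(1) U(1) by blast
          have "adj Ec v (g x)"
            using cluster_adj_trans[OF Ec _ x(1) gV x(2) g(2)] vU U(1) by blast
          then have "g x \<in> cls V E v" using same[OF vU g(1)] agv gV by (simp add: cls_def)
          moreover have "g x \<in> ?Y" using False x(1) gV by blast
          ultimately show ?thesis using v(3) by blast
        qed
      qed
    qed
    ultimately show ?thesis using that[of ?Y] by blast
  qed
  have "card ?X \<le> 2 * k"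
    by (rule order_trans[OF conjunct1[OF ends[OF E gr(1)]] mult_le_mono2[OF edits]])
  then have "card (?X \<union> Y) \<le> 2 * (k + d)"
    unfolding distrib_left using Y(2) by (rule order_trans[OF card_Un_le add_mono])
  moreover have "?X \<union> Y \<subseteq> V" using ends[OF E gr(1)] Y(1) by blast
  ultimately show ?thesis using hit by (intro exI[of _ "?X \<union> Y"]) blast
qed

section \<open>Size of the kernel of a yes-instance\<close>

fun size_factor :: "distance \<Rightarrow> nat \<Rightarrow> nat \<Rightarrow> nat" where
  "size_factor Matching_Dist k d = k + d"
| "size_factor Edge_Dist k d = k"

text \<open>\<open>hitting_set\<close> bounds the number of components and \<open>small\<close> the
  size of a class. For the matching distance a component may consist of many classes, but a large
  one is a cluster of \<open>E'\<close>, so its vertices in \<open>U\<close> share one target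
  cluster and all but \<open>d\<close> of its vertices lie in a single class.\<close>

lemma kernel_size_le:
  assumes E: "graph V E" and Ec: "cluster_graph V Ec" and SV: "S \<subseteq> V"
    and E': "cluster_graph V E'" "card (sym_diff E E') \<le> k" "dist_of D V E' Ec \<le> d"
    and conf: "card (conflicted V E) \<le> 4 * k * k"
    and ne: "\<And>v. v \<in> S - conflicted V E \<Longrightarrow> cls V E v \<noteq> cls V Ec v"
    and small: "\<And>v. v \<in> V - conflicted V E \<Longrightarrow> card (class_of D V E Ec v \<inter> S) \<le> limit D k d"
  shows "card S \<le> 16 * (size_factor D k d * (k + d))"
proof -
  have fV: "finite V" using E by (simp add: graph_def)
  obtain Z where Z: "Z \<subseteq> V" "card Z \<le> 2 * (k + d)"
    and hit: "\<And>v. v \<in> V - conflicted V E \<Longrightarrow> cls V E v \<noteq> cls V Ec v \<Longrightarrow> cls V E v \<inter> Z \<noteq> {}"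
    using hitting_set[OF E Ec E'] by blast
  \<comment> \<open>For the matching distance: \<open>d\<close> unmatched vertices and one class of
    at most \<open>k + d + 2\<close>, which also covers components with fewer than
    \<open>k + 2\<close> vertices. For the edge distance the class is the whole component.\<close>
  define m where "m = (case D of Matching_Dist \<Rightarrow> k + 2 * d + 2 | Edge_Dist \<Rightarrow> 3 * k)"
  have card_cls: "card (cls V E z \<inter> S) \<le> m" if z: "z \<in> V - conflicted V E" for z
  proof (cases D)
    case Edge_Dist
    then show ?thesis using small[OF z] by (simp add: m_def)
  next
    case Matching_Dist
    then have m: "m = k + 2 * d + 2" by (simp add: m_def)
    have zV: "z \<in> V" "z \<notin> conflicted V E" using z by auto
    have mono: "card (cls V E z \<inter> S) \<le> card (cls V E z)"
      using finite_cls[OF fV] by (intro card_mono) auto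
    show ?thesis
    proof (cases "k + 2 \<le> card (cls V E z)")
      case True
      then have agree: "adj E' x y \<longleftrightarrow> adj E x y" if "x \<in> cls V E z" "y \<in> V" for x y
        using isolated_clique_kept[OF E E'(1,2) zV] that by blast
      have "matching_dist V E' Ec \<le> d" using E'(3) Matching_Dist by simp
      then obtain U where U: "U \<subseteq> V" "card (V - U) \<le> d"
        and same: "\<And>u v. u \<in> U \<Longrightarrow> v \<in> U \<Longrightarrow> adj E' u v \<longleftrightarrow> adj Ec u v"
        unfolding matching_dist_le_iff[OF E'(1) Ec] by blast
      show ?thesis
      proof (cases "cls V E z \<inter> U = {}")
        case True
        then have "card (cls V E z) \<le> card (V - U)"
          using fV by (intro card_mono) (auto simp: cls_def)
        then show ?thesis using mono U(2) m by linarith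
      next
        case False
        then obtain u where u: "u \<in> cls V E z" "u \<in> U" by blast
        have cu: "u \<in> V" "u \<notin> conflicted V E" "cls V E u = cls V E z"
          using cls_unconflicted[OF zV u(1)] by auto
        have "cls V E z \<inter> S \<subseteq> (V - U) \<union> (cls V E u \<inter> cls V Ec u \<inter> S)"
        proof
          fix x assume x: "x \<in> cls V E z \<inter> S"
          then have xV: "x \<in> V" "adj E u x" using cu(3) by (auto simp: cls_def)
          show "x \<in> (V - U) \<union> (cls V E u \<inter> cls V Ec u \<inter> S)"
          proof (cases "x \<in> U")
            case True
            then have "adj Ec u x" using same[OF u(2)] agree[OF u(1) xV(1)] xV(2) by blast
            then show ?thesis using x xV by (auto simp: cls_def)
          qed (use xV in auto)
        qed
        then have "card (cls V E z \<inter> S) \<le> card ((V - U) \<union> (cls V E u \<inter> cls V Ec u \<inter> S))"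
          using fV finite_subset[OF SV fV] by (intro card_mono) auto
        also have "\<dots> \<le> card (V - U) + card (cls V E u \<inter> cls V Ec u \<inter> S)" by (rule card_Un_le)
        also have "\<dots> \<le> m" using U(2) small[of u] cu Matching_Dist m by simp
        finally show ?thesis .
      qed
    qed (use mono m in linarith)
  qed
  \<comment> \<open>Conflicted vertices are counted separately. A vertex of \<open>Z\<close> that
    hits a conflict-free component is itself conflict-free, so it survives in
    \<open>?Z\<close>.\<close>
  let ?Z = "Z - conflicted V E"
  have "S \<subseteq> conflicted V E \<union> (\<Union>z\<in>?Z. cls V E z \<inter> S)"
  proof
    fix v assume v: "v \<in> S"
    show "v \<in> conflicted V E \<union> (\<Union>z\<in>?Z. cls V E z \<inter> S)"
    proof (cases "v \<in> conflicted V E")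
      case False
      have vV: "v \<in> V" using v SV by blast
      then obtain z where z: "z \<in> cls V E v" "z \<in> Z" using hit[of v] ne[of v] v False by blast
      then have "z \<in> ?Z" "v \<in> cls V E z"
        using cls_unconflicted[OF vV False z(1)] cls_self[OF vV] by auto
      then show ?thesis using v by blast
    qed simp
  qed
  then have "card S \<le> card (conflicted V E \<union> (\<Union>z\<in>?Z. cls V E z \<inter> S))"
    using fV finite_subset[OF Z(1) fV] finite_subset[OF SV fV]
    by (intro card_mono) (auto simp: conflicted_def)
  also have "\<dots> \<le> card (conflicted V E) + card (\<Union>z\<in>?Z. cls V E z \<inter> S)" by (rule card_Un_le)
  also have "card (\<Union>z\<in>?Z. cls V E z \<inter> S) \<le> (\<Sum>z\<in>?Z. card (cls V E z \<inter> S))"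
    using finite_subset[OF Z(1) fV] by (intro card_UN_le) auto
  also have "\<dots> \<le> card ?Z * m"
    using sum_bounded_above[of ?Z "\<lambda>z. card (cls V E z \<inter> S)" m] card_cls Z(1) by auto
  also have "\<dots> \<le> 2 * (k + d) * m"
    using Z card_mono[of Z ?Z] finite_subset[OF Z(1) fV] by (intro mult_right_mono) auto
  finally have le: "card S \<le> 4 * k * k + 2 * (k + d) * m" using conf by linarith
  show ?thesis
  proof (cases D)
    case Edge_Dist
    then show ?thesis using le by (simp add: m_def algebra_simps)
  next
    case Matching_Dist
    define s where "s = k + d"
    \<comment> \<open>The total is at most \<open>4 * (s * s) + 4 * (s * s) + 4 * s\<close>, and
      over the natural numbers the linear term is absorbed by a square.\<close>
    have "k * k \<le> s * s" by (intro mult_mono) (auto simp: s_def)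
    moreover have "2 * s * m \<le> 2 * s * (2 * s + 2)"
      using Matching_Dist by (intro mult_left_mono) (auto simp: m_def s_def)
    moreover have "2 * s * (2 * s + 2) = 4 * (s * s) + 4 * s" by (simp add: algebra_simps)
    moreover have "s \<le> s * s" by (cases s) auto
    ultimately have "card S \<le> 16 * (s * s)"
      using le unfolding s_def[symmetric] mult.assoc[of 4 k k] by linarith
    then show ?thesis using Matching_Dist by (simp add: s_def)
  qed
qed

section \<open>Choosing the kept vertices by rank\<close>

lemma low_rank_card:
  fixes A :: "'a :: linorder set" and m :: nat
  assumes "finite A"
  defines "B \<equiv> {x \<in> A. card {y \<in> A. y < x} < m}"
  shows "card B \<le> m" "\<lbrakk>v \<in> A; v \<notin> B\<rbrakk> \<Longrightarrow> m \<le> card B"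
proof -
  define r where "r x = card {y \<in> A. y < x}" for x
  have less: "r x < r y" if "x \<in> A" "x < y" for x y
    unfolding r_def using that assms(1) by (intro psubset_card_mono) auto
  have B: "B = {x \<in> A. r x < m}" by (simp add: B_def r_def)
  have "inj_on r B"
  proof (rule inj_onI)
    fix x y assume xy: "x \<in> B" "y \<in> B" "r x = r y"
    then have "x \<in> A" "y \<in> A" by (auto simp: B)
    then have "\<not> x < y" "\<not> y < x" using less[of x y] less[of y x] xy(3) by auto
    then show "x = y" by simp
  qed
  moreover have "r ` B \<subseteq> {..<m}" by (auto simp: B)
  ultimately show "card B \<le> m" using card_inj_on_le[of r B "{..<m}"] by simp
  assume v: "v \<in> A" "v \<notin> B"
  have fin: "finite (A - B)" "A - B \<noteq> {}" using assms(1) v by auto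
  \<comment> \<open>All elements below the least omitted \<open>w\<close> belong to
    \<open>B\<close>, and there are at least \<open>m\<close> of them because \<open>w\<close> was
    omitted.\<close>
  define w where "w = Min (A - B)"
  have w: "w \<in> A - B" unfolding w_def by (rule Min_in[OF fin])
  have "y \<in> B" if "y \<in> A" "y < w" for y
    using that Min_le[OF fin(1), of y] unfolding w_def by fastforce
  then have "{y \<in> A. y < w} \<subseteq> B" by blast
  then have "r w \<le> card B" unfolding r_def using assms(1) by (intro card_mono) (auto simp: B)
  moreover have "m \<le> r w" using w by (auto simp: B)
  ultimately show "m \<le> card B" by simp
qed

text \<open>The order of the natural numbers singles out the first \<open>limit D k d\<close>
  members of a class, and a rank is a plain count for the program.\<close>

definition kernel_set ::
  "distance \<Rightarrow> nat set \<Rightarrow> nat set set \<Rightarrow> nat set set \<Rightarrow> nat \<Rightarrow> nat \<Rightarrow> nat set" where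
  "kernel_set D V E Ec k d = {v \<in> V. v \<in> conflicted V E \<or>
     cls V E v \<noteq> cls V Ec v \<and> card {u \<in> class_of D V E Ec v. u < v} < limit D k d}"

lemma class_ofD: "u \<in> class_of D V E Ec v \<Longrightarrow> u \<in> cls V E v"
  by (cases D) auto

lemma class_of_eq:
  assumes Ec: "cluster_graph V Ec" and v: "v \<in> V" "v \<notin> conflicted V E"
    and u: "u \<in> class_of D V E Ec v"
  shows "class_of D V E Ec u = class_of D V E Ec v"
proof -
  have uV: "u \<in> V" using cls_unconflicted(1)[OF v class_ofD[OF u]] .
  have "cls V E u = cls V E v" using cls_unconflicted(3)[OF v class_ofD[OF u]] .
  moreover have "cls V Ec u = cls V Ec v" if "u \<in> cls V Ec v"
    using that cluster_cls_eq_iff[OF Ec v(1) uV] by (simp add: cls_def)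
  ultimately show ?thesis using u by (cases D) auto
qed

text \<open>All members of a class have the same class and compare alike with the target, so
  membership in \<open>S\<close> within a class is having low rank there, and
  \<open>low_rank_card\<close> gives both the upper and the lower count.\<close>

lemma
  fixes V :: "nat set" and D :: distance and k d :: nat
  assumes E: "graph V E" and Ec: "cluster_graph V Ec"
  defines "S \<equiv> kernel_set D V E Ec k d"
  shows reduced_kernel_set: "reduced D V E Ec k d S"
    and kernel_set_small: "v \<in> V - conflicted V E \<Longrightarrow> card (class_of D V E Ec v \<inter> S) \<le> limit D k d"
proof -
  have fV: "finite V" using E by (simp add: graph_def)
  let ?L = "\<lambda>v. {x \<in> class_of D V E Ec v. card {y \<in> class_of D V E Ec v. y < x} < limit D k d}"
  have fin: "finite (class_of D V E Ec v)" for v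
    by (rule finite_subset[OF class_of_subset finite_cls[OF fV]])
  have mem: "x \<in> S \<longleftrightarrow> x \<in> ?L v"
    if v: "v \<in> V" "v \<notin> conflicted V E" "cls V E v \<noteq> cls V Ec v" and x: "x \<in> class_of D V E Ec v" for v x
  proof -
    have x': "x \<in> V" "x \<notin> conflicted V E" "cls V E x = cls V E v"
      using cls_unconflicted[OF v(1,2) class_ofD[OF x]] .
    have "cls V Ec x \<noteq> cls V E x"
    proof
      assume eq: "cls V Ec x = cls V E x"
      then have "v \<in> cls V Ec x" using x'(3) cls_self[OF v(1)] by simp
      then have "cls V Ec x = cls V Ec v"
        using cluster_cls_eq_iff[OF Ec x'(1) v(1)] by (simp add: cls_def)
      then show False using eq x'(3) v(3) by simp
    qed
    then show ?thesis
      using x x' class_of_eq[OF Ec v(1,2) x] by (simp add: S_def kernel_set_def eq_commute)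
  qed
  show "reduced D V E Ec k d S"
    unfolding reduced_def
  proof (intro conjI ballI)
    show "S \<subseteq> V" "conflicted V E \<subseteq> S" by (auto simp: S_def kernel_set_def conflicted_def)
    fix v assume v: "v \<in> V - S"
    then have v': "v \<in> V" "v \<notin> conflicted V E" by (auto simp: S_def kernel_set_def)
    show "if cls V E v = cls V Ec v then cls V E v \<inter> S = {}
        else limit D k d \<le> card (class_of D V E Ec v \<inter> S)"
    proof (cases "cls V E v = cls V Ec v")
      case True
      have "x \<notin> S" if x: "x \<in> cls V E v" for x
      proof -
        have x': "x \<in> V" "x \<notin> conflicted V E" "cls V E x = cls V E v"
          using cls_unconflicted[OF v' x] .
        have "x \<in> cls V Ec v" using x True by simp
        then have "cls V Ec v = cls V Ec x"
          using cluster_cls_eq_iff[OF Ec v'(1) x'(1)] by (simp add: cls_def)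
        then show ?thesis using x' True by (simp add: S_def kernel_set_def)
      qed
      then show ?thesis using True by auto
    next
      case False
      have "v \<in> class_of D V E Ec v" using v'(1) by (cases D) (auto simp: cls_self)
      then have "limit D k d \<le> card (?L v)"
        using low_rank_card(2)[OF fin] mem[OF v' False] v by blast
      also have "?L v = class_of D V E Ec v \<inter> S" using mem[OF v' False] by blast
      finally show ?thesis using False by simp
    qed
  qed
  show "card (class_of D V E Ec v \<inter> S) \<le> limit D k d" if v: "v \<in> V - conflicted V E"
  proof (cases "cls V E v = cls V Ec v")
    case True
    have "x \<notin> S" if x: "x \<in> class_of D V E Ec v" for x
    proof -
      have x': "x \<in> V" "x \<notin> conflicted V E" "cls V E x = cls V E v"
        using cls_unconflicted[of v V E, OF _ _ class_ofD[OF x]] v by blast+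
      have "x \<in> cls V Ec v" using class_ofD[OF x] True by simp
      then have "cls V Ec v = cls V Ec x"
        using v x'(1) cluster_cls_eq_iff[OF Ec, of v x] by (simp add: cls_def)
      then show ?thesis using x' True by (simp add: S_def kernel_set_def)
    qed
    then have "class_of D V E Ec v \<inter> S = {}" by blast
    then show ?thesis by simp
  next
    case False
    have "class_of D V E Ec v \<inter> S = ?L v" using mem[of v] v False by blast
    then show ?thesis using low_rank_card(1)[OF fin] by simp
  qed
qed

lemma kernel_set_ne:
  "v \<in> kernel_set D V E Ec k d - conflicted V E \<Longrightarrow> cls V E v \<noteq> cls V Ec v"
  by (auto simp: kernel_set_def)

text \<open>The size bound is a property of yes-instances, not of the construction, so it appears
  among the tested conditions. It may be proved with the full \<open>k\<close>, since the flips only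
  remove pairs from the edit set of a solution.\<close>

theorem kernel_correct:
  fixes V :: "nat set" and X :: variant and D :: distance and k d :: nat
  assumes E: "graph V E" and Ec: "cluster_graph V Ec"
  defines "F \<equiv> heavy X V E k"
  defines "E1 \<equiv> sym_diff E F"
  defines "S \<equiv> kernel_set D V E1 Ec k d"
  shows "DC_solvable X D V E Ec k d \<longleftrightarrow>
    card F \<le> k \<and> dropped D E1 Ec S \<le> d \<and> card S \<le> 16 * (size_factor D k d * (k + d)) \<and>
    DC_solvable X D S (induced E1 S) (induced Ec S) (k - card F) (d - dropped D E1 Ec S)"
proof -
  have gE1: "graph V E1" unfolding E1_def F_def by (rule graph_sym_diff_heavy[OF E])
  have red: "reduced D V E1 Ec k d S" unfolding S_def by (rule reduced_kernel_set[OF gE1 Ec])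
  have size: "card S \<le> 16 * (size_factor D k d * (k + d))" if sol: "DC_solvable X D V E Ec k d"
  proof -
    obtain E' where E': "cluster_graph V E'" "admissible X E E'"
      "card (sym_diff E E') \<le> k" "dist_of D V E' Ec \<le> d" using sol by (auto simp: DC_solvable_def)
    have sub: "F \<subseteq> sym_diff E E'" unfolding F_def using heavy_subset_edits[OF E'(1) E E'(2,3)] .
    have fin: "finite (sym_diff E E')"
      using E cluster_graph_graph[OF E'(1)] graph_finite_edges by blast
    have "sym_diff E1 E' \<subseteq> sym_diff E E'" using sub by (auto simp: E1_def)
    then have "card (sym_diff E1 E') \<le> k" using card_mono[OF fin] E'(3) order_trans by blast
    moreover have "card (conflicted V E1) \<le> 4 * k * k"
      unfolding E1_def F_def by (rule card_conflicted_le[OF E E'(1-3)])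
    ultimately show ?thesis
      using gE1 Ec E'(1,4) kernel_set_ne kernel_set_small[OF gE1 Ec] red
      unfolding S_def by (intro kernel_size_le[of V E1 Ec _ E']) (auto simp: reduced_def)
  qed
  have "DC_solvable X D V E Ec k d \<longleftrightarrow> card F \<le> k \<and> DC_solvable X D V E1 Ec (k - card F) d"
    unfolding E1_def F_def by (rule DC_solvable_flip_heavy[OF E])
  then show ?thesis
    using size solvable_induced[OF gE1 Ec red] solvable_extend[OF gE1 Ec red]
    by (meson diff_le_self)
qed

section \<open>Renaming the vertices\<close>

lemma adj_image:
  assumes g: "inj_on g V" and E: "graph V E" and uv: "u \<in> V" "v \<in> V"
  shows "adj ((`) g ` E) (g u) (g v) \<longleftrightarrow> adj E u v"
proof -
  have "{g u, g v} \<in> (`) g ` E \<longleftrightarrow> {u, v} \<in> E"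
  proof
    assume "{g u, g v} \<in> (`) g ` E"
    then obtain e where e: "e \<in> E" "g ` {u, v} = g ` e" by auto
    then have "e = {u, v}" using inj_on_image_eq_iff[OF g, of e "{u, v}"] graph_edge_subset[OF E] uv by blast
    then show "{u, v} \<in> E" using e(1) by simp
  next
    assume "{u, v} \<in> E" then show "{g u, g v} \<in> (`) g ` E" by (auto intro: rev_image_eqI)
  qed
  then show ?thesis using inj_onD[OF g] uv by (auto simp: adj_def)
qed

lemma graph_image:
  assumes "inj_on g V" "graph V E" shows "graph (g ` V) ((`) g ` E)"
  using assms by (auto simp: graph_def card_image inj_on_subset)

lemma cluster_graph_image:
  assumes g: "inj_on g V" and E: "cluster_graph V E" shows "cluster_graph (g ` V) ((`) g ` E)"
proof (rule cluster_graphI)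
  have gE: "graph V E" using cluster_graph_graph[OF E] .
  show "graph (g ` V) ((`) g ` E)" by (rule graph_image[OF g gE])
  fix u v w assume uvw: "u \<in> g ` V" "v \<in> g ` V" "w \<in> g ` V"
    and adjs: "adj ((`) g ` E) u v" "adj ((`) g ` E) v w"
  obtain x y z where xyz: "u = g x" "v = g y" "w = g z" "x \<in> V" "y \<in> V" "z \<in> V" using uvw by blast
  then show "adj ((`) g ` E) u w"
    using cluster_adj_trans[OF E xyz(4-6)] adjs by (simp add: adj_image[OF g gE])
qed

lemma DC_solvable_image:
  assumes g: "inj_on g V" and E: "graph V E" and Ec: "cluster_graph V Ec"
    and sol: "DC_solvable X D V E Ec k d"
  shows "DC_solvable X D (g ` V) ((`) g ` E) ((`) g ` Ec) k d"
proof -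
  obtain E' where E': "cluster_graph V E'" "admissible X E E'"
    "card (sym_diff E E') \<le> k" "dist_of D V E' Ec \<le> d" using sol by (auto simp: DC_solvable_def)
  have gr: "graph V E'" "graph V Ec" using cluster_graph_graph E'(1) Ec by auto
  have Pow: "A \<subseteq> Pow V" if "graph V A" for A using that graph_edge_subset by blast
  have inj: "inj_on ((`) g) (Pow V)" by (rule inj_on_image_Pow[OF g])
  have diff: "sym_diff ((`) g ` A) ((`) g ` B) = (`) g ` sym_diff A B"
    if "graph V A" "graph V B" for A B
  proof -
    have "A - B \<subseteq> Pow V" "B - A \<subseteq> Pow V" using Pow[OF that(1)] Pow[OF that(2)] by blast+
    then show ?thesis
      using inj_on_image_set_diff[OF inj _ Pow[OF that(2)]]
        inj_on_image_set_diff[OF inj _ Pow[OF that(1)]] by (simp add: image_Un)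
  qed
  have card: "card ((`) g ` sym_diff A B) = card (sym_diff A B)"
    if "graph V A" "graph V B" for A B
    using Pow[OF that(1)] Pow[OF that(2)] by (intro card_image inj_on_subset[OF inj]) auto
  have mem: "g ` e \<in> (`) g ` A \<longleftrightarrow> e \<in> A" if "graph V A" "e \<subseteq> V" for A e
    using inj_on_image_mem_iff[OF inj, of e A] Pow that by blast
  have cl: "cluster_graph (g ` V) ((`) g ` E')" "cluster_graph (g ` V) ((`) g ` Ec)"
    using cluster_graph_image[OF g] E'(1) Ec by auto
  have "admissible X ((`) g ` E) ((`) g ` E')"
    unfolding admissible_iff diff[OF E gr(1)]
  proof
    fix f assume "f \<in> (`) g ` sym_diff E E'"
    then obtain e where e: "f = g ` e" "e \<in> sym_diff E E'" by blast
    then have "e \<subseteq> V" using graph_edge_subset[OF E] graph_edge_subset[OF gr(1)] by blast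
    then have "f \<in> (`) g ` E \<longleftrightarrow> e \<in> E" using mem[OF E] e(1) by simp
    moreover have "flippable X E e" using E'(2) e(2) unfolding admissible_iff by blast
    ultimately show "flippable X ((`) g ` E) f" by (cases X) auto
  qed
  moreover have "card (sym_diff ((`) g ` E) ((`) g ` E')) \<le> k"
    using E'(3) unfolding diff[OF E gr(1)] card[OF E gr(1)] .
  moreover have "dist_of D (g ` V) ((`) g ` E') ((`) g ` Ec) \<le> d"
  proof (cases D)
    case Edge_Dist
    then show ?thesis using E'(4) by (simp add: edge_dist_def diff[OF gr] card[OF gr])
  next
    case Matching_Dist
    then have "matching_dist V E' Ec \<le> d" using E'(4) by simp
    then obtain U where U: "U \<subseteq> V" "card (V - U) \<le> d"
      and agree: "\<And>u v. u \<in> U \<Longrightarrow> v \<in> U \<Longrightarrow> adj E' u v \<longleftrightarrow> adj Ec u v"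
      unfolding matching_dist_le_iff[OF E'(1) Ec] by blast
    have "g ` V - g ` U = g ` (V - U)" using inj_on_image_set_diff[OF g, of V U] U(1) by auto
    moreover have "card (g ` (V - U)) = card (V - U)" using g by (intro card_image inj_on_subset[OF g]) auto
    moreover have "adj ((`) g ` E') u v \<longleftrightarrow> adj ((`) g ` Ec) u v" if uv: "u \<in> g ` U" "v \<in> g ` U" for u v
    proof -
      obtain x y where "u = g x" "v = g y" "x \<in> U" "y \<in> U" using uv by blast
      then show ?thesis
        using agree[of x y] U(1) adj_image[OF g gr(1), of x y] adj_image[OF g gr(2), of x y] by blast
    qed
    ultimately have "matching_dist (g ` V) ((`) g ` E') ((`) g ` Ec) \<le> d"
      unfolding matching_dist_le_iff[OF cl] using U by (intro exI[of _ "g ` U"]) auto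
    then show ?thesis using Matching_Dist by simp
  qed
  ultimately show ?thesis unfolding DC_solvable_def using cl(1) by blast
qed

text \<open>The converse is the forward implication for the inverse renaming, which undoes the image
  on vertices and on edge sets.\<close>

lemma DC_solvable_image_iff:
  assumes g: "inj_on g V" and E: "graph V E" and Ec: "cluster_graph V Ec"
  shows "DC_solvable X D (g ` V) ((`) g ` E) ((`) g ` Ec) k d \<longleftrightarrow> DC_solvable X D V E Ec k d"
proof
  let ?h = "the_inv_into V g"
  assume sol: "DC_solvable X D (g ` V) ((`) g ` E) ((`) g ` Ec) k d"
  have h: "inj_on ?h (g ` V)" by (rule inj_on_the_inv_into[OF g])
  have id: "?h ` g ` A = A" if "A \<subseteq> V" for A
    using that the_inv_into_f_f[OF g] by (force simp: image_image)
  have "(`) ?h ` (`) g ` A = A" if "graph V A" for A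
  proof -
    have "(`) ?h ` (`) g ` A = (\<lambda>e. e) ` A"
      unfolding image_image using id graph_edge_subset[OF that] by (intro image_cong) (auto simp: image_image)
    then show ?thesis by simp
  qed
  then show "DC_solvable X D V E Ec k d"
    using DC_solvable_image[OF h graph_image[OF g E] cluster_graph_image[OF g Ec] sol]
      E cluster_graph_graph[OF Ec] id[of V] by simp
qed (rule DC_solvable_image[OF g E Ec])

section \<open>Loop programs\<close>

text \<open>A purely syntactic worst case in which each loop takes at most \<open>N\<close> rounds;
  \<open>N + 1\<close> instead of \<open>N\<close> pays for the last, failing test. That a run
  respects it is proved together with its result, through \<open>runs\<close>.\<close>

primrec step_bound :: "nat \<Rightarrow> prog \<Rightarrow> nat" where
  "step_bound N Skip = 1"
| "step_bound N (Assign x e) = 1 + exp_cost e"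
| "step_bound N (Store a e f) = 1 + exp_cost e + exp_cost f"
| "step_bound N (Seq p q) = step_bound N p + step_bound N q"
| "step_bound N (Cond b p q) = test_cost b + step_bound N p + step_bound N q"
| "step_bound N (While b p) = (N + 1) * (test_cost b + step_bound N p)"

primrec loop_depth :: "prog \<Rightarrow> nat" where
  "loop_depth Skip = 0"
| "loop_depth (Assign x e) = 0"
| "loop_depth (Store a e f) = 0"
| "loop_depth (Seq p q) = max (loop_depth p) (loop_depth q)"
| "loop_depth (Cond b p q) = max (loop_depth p) (loop_depth q)"
| "loop_depth (While b p) = Suc (loop_depth p)"

text \<open>The constant depends on the program only and the exponent is its loop nesting, so cubic
  time reduces to inspecting the nesting depth and keeping \<open>N\<close> linear in the number of
  vertices.\<close>

lemma step_bound_le_power: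
  "\<exists>c. \<forall>N. step_bound N p \<le> c * (N + 1) ^ loop_depth p"
proof -
  have raise: "a \<le> c * (N + 1) ^ j" if "a \<le> c * (N + 1) ^ i" "i \<le> j" for a c N i j :: nat
    by (rule order_trans[OF that(1) mult_le_mono2[OF power_increasing[OF that(2)]]]) simp
  show ?thesis
  proof (induction p)
    case (Seq p q)
    then obtain c c' where c: "\<And>N. step_bound N p \<le> c * (N + 1) ^ loop_depth p"
      "\<And>N. step_bound N q \<le> c' * (N + 1) ^ loop_depth q" by blast
    have "step_bound N (Seq p q) \<le> (c + c') * (N + 1) ^ loop_depth (Seq p q)" for N
      using raise[OF c(1)[of N], of "loop_depth (Seq p q)"] raise[OF c(2)[of N], of "loop_depth (Seq p q)"]
      by (simp add: add_mult_distrib)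
    then show ?case by blast
  next
    case (Cond b p q)
    then obtain c c' where c: "\<And>N. step_bound N p \<le> c * (N + 1) ^ loop_depth p"
      "\<And>N. step_bound N q \<le> c' * (N + 1) ^ loop_depth q" by blast
    have "step_bound N (Cond b p q) \<le> (test_cost b + c + c') * (N + 1) ^ loop_depth (Cond b p q)" for N
      using raise[OF c(1)[of N], of "loop_depth (Cond b p q)"]
        raise[OF c(2)[of N], of "loop_depth (Cond b p q)"]
        raise[of "test_cost b" "test_cost b" N 0 "loop_depth (Cond b p q)"]
      unfolding step_bound.simps add_mult_distrib loop_depth.simps
      unfolding power_0 mult_1_right by linarith
    then show ?case by blast
  next
    case (While b p)
    then obtain c where c: "\<And>N. step_bound N p \<le> c * (N + 1) ^ loop_depth p" by blast
    have "step_bound N (While b p) \<le> (test_cost b + c) * (N + 1) ^ loop_depth (While b p)" for N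
    proof -
      have "test_cost b + step_bound N p \<le> (test_cost b + c) * (N + 1) ^ loop_depth p"
        using c[of N] raise[of "test_cost b" "test_cost b" N 0 "loop_depth p"]
        unfolding add_mult_distrib power_0 mult_1_right by linarith
      then have "(N + 1) * (test_cost b + step_bound N p)
          \<le> (N + 1) * ((test_cost b + c) * (N + 1) ^ loop_depth p)"
        by (rule mult_left_mono) simp
      then show ?thesis by (simp only: step_bound.simps loop_depth.simps power_Suc mult_ac)
    qed
    then show ?case by blast
  qed (auto intro: exI[of _ "_ :: nat"])
qed

definition runs :: "nat \<Rightarrow> prog \<Rightarrow> store \<Rightarrow> store \<Rightarrow> bool" where
  "runs N p s s' \<longleftrightarrow> (\<exists>t. exec p s t s' \<and> t \<le> step_bound N p)"

definition set_reg :: "string \<Rightarrow> nat \<Rightarrow> store \<Rightarrow> store" where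
  "set_reg x v s = s\<lparr>reg := (reg s)(x := v)\<rparr>"

definition set_arr :: "string \<Rightarrow> nat \<Rightarrow> nat \<Rightarrow> store \<Rightarrow> store" where
  "set_arr a i v s = s\<lparr>arr := (arr s)(a := (arr s a)(i := v))\<rparr>"

lemma set_simps [simp]:
  "reg (set_reg x v s) = (reg s)(x := v)" "arr (set_reg x v s) = arr s"
  "reg (set_arr a i v s) = reg s" "arr (set_arr a i v s) = (arr s)(a := (arr s a)(i := v))"
  by (simp_all add: set_reg_def set_arr_def)

lemma set_reg_same [simp]: "set_reg x v (set_reg x w s) = set_reg x v s"
  by (simp add: set_reg_def)

lemma set_reg_commute: "x \<noteq> y \<Longrightarrow> set_reg x v (set_reg y w s) = set_reg y w (set_reg x v s)"
  by (simp add: set_reg_def fun_upd_twist)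

lemma runs_Assign: "runs N (Assign x e) s (set_reg x (exp_val e s) s)"
  unfolding runs_def set_reg_def using exec.Assign by fastforce

lemma runs_Store: "runs N (Store a e f) s (set_arr a (exp_val e s) (exp_val f s) s)"
  unfolding runs_def set_arr_def using exec.Store by fastforce

lemma runs_Seq: "runs N p s s' \<Longrightarrow> runs N q s' s'' \<Longrightarrow> runs N (Seq p q) s s''"
  unfolding runs_def using exec.Seq by (fastforce intro: add_mono)

lemma runs_Cond:
  assumes "test_val b s \<Longrightarrow> runs N p s s'" "\<not> test_val b s \<Longrightarrow> runs N q s s'"
  shows "runs N (Cond b p q) s s'"
proof (cases "test_val b s")
  case True
  then obtain t where "exec p s t s'" "t \<le> step_bound N p" using assms by (auto simp: runs_def)
  then show ?thesis unfolding runs_def using exec.CondTrue[of b s p t s' q] True by fastforce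
next
  case False
  then obtain t where "exec q s t s'" "t \<le> step_bound N q" using assms by (auto simp: runs_def)
  then show ?thesis unfolding runs_def using exec.CondFalse[of b s q t s' p] False by fastforce
qed

definition For :: "string \<Rightarrow> exp \<Rightarrow> prog \<Rightarrow> prog" where
  "For x b p = Seq (Assign x (Const 0))
     (While (Less (Reg x) b) (Seq p (Assign x (Plus (Reg x) (Const 1)))))"

lemma loop_depth_For [simp]: "loop_depth (For x b p) = Suc (loop_depth p)"
  by (simp add: For_def)

text \<open>The invariant \<open>I i\<close> describes the store at the head of round
  \<open>i\<close>, with the counter already equal to \<open>i\<close>; this is why it is
  re-established after the increment. As \<open>b\<close> is evaluated anew at each test, the
  invariant must preserve its value.\<close>

lemma runs_For:
  assumes init: "I 0 (set_reg x 0 s)"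
    and step: "\<And>i s. \<lbrakk>i < m; I i s; reg s x = i\<rbrakk> \<Longrightarrow>
      \<exists>s'. runs N p s s' \<and> reg s' x = i \<and> I (Suc i) (set_reg x (Suc i) s')"
    and bound: "\<And>i s. \<lbrakk>I i s; i \<le> m\<rbrakk> \<Longrightarrow> exp_val b s = m" and mN: "m \<le> N"
  shows "\<exists>s'. runs N (For x b p) s s' \<and> reg s' x = m \<and> I m s'"
proof -
  let ?body = "Seq p (Assign x (Plus (Reg x) (Const 1)))" and ?t = "Less (Reg x) b"
  let ?c = "test_cost ?t + step_bound N ?body"
  have *: "\<exists>t s'. exec (While ?t ?body) s t s' \<and> t \<le> j * ?c + test_cost ?t \<and> reg s' x = m \<and> I m s'"
    if "I i s" "reg s x = i" "i + j = m" for i j s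
    using that
  proof (induction j arbitrary: i s)
    case 0
    then have "\<not> test_val ?t s" using bound[of i s] by simp
    then show ?case using exec.WhileFalse[of ?t s ?body] 0 by fastforce
  next
    case (Suc j)
    then have i: "i < m" by simp
    obtain s1 where s1: "runs N p s s1" "reg s1 x = i" "I (Suc i) (set_reg x (Suc i) s1)"
      using step[OF i Suc.prems(1,2)] by blast
    have "runs N ?body s (set_reg x (Suc i) s1)"
      using runs_Seq[OF s1(1) runs_Assign[of N x "Plus (Reg x) (Const 1)"]] s1(2) by simp
    then obtain t where t: "exec ?body s t (set_reg x (Suc i) s1)" "t \<le> step_bound N ?body"
      by (auto simp only: runs_def)
    obtain u s' where u: "exec (While ?t ?body) (set_reg x (Suc i) s1) u s'"
      "u \<le> j * ?c + test_cost ?t" "reg s' x = m" "I m s'"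
      using Suc.IH[OF s1(3)] Suc.prems(3) by auto
    have "test_val ?t s" using bound[OF Suc.prems(1)] i Suc.prems(2) by simp
    then have "exec (While ?t ?body) s (test_cost ?t + t + u) s'"
      using t(1) u(1) by (rule exec.WhileTrue)
    moreover have "test_cost ?t + t + u \<le> Suc j * ?c + test_cost ?t"
      using t(2) u(2) unfolding mult_Suc by linarith
    ultimately show ?case using u(3,4) by blast
  qed
  obtain t s' where t: "exec (While ?t ?body) (set_reg x 0 s) t s'"
    "t \<le> m * ?c + test_cost ?t" "reg s' x = m" "I m s'"
    using *[OF init, of m] by auto
  have "m * ?c + test_cost ?t \<le> N * ?c + ?c" using mN by (intro add_mono mult_right_mono) auto
  then have "runs N (While ?t ?body) (set_reg x 0 s) s'"
    unfolding runs_def using t(1,2) by (intro exI[of _ t]) (auto simp: algebra_simps)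
  moreover have "runs N (Assign x (Const 0)) s (set_reg x 0 s)"
    using runs_Assign[of N x "Const 0" s] by simp
  ultimately show ?thesis using runs_Seq t(3,4) unfolding For_def by blast
qed

section \<open>Frame conditions\<close>

primrec regs_of :: "exp \<Rightarrow> string set" where
  "regs_of (Const c) = {}"
| "regs_of (Reg x) = {x}"
| "regs_of (Read a e) = regs_of e"
| "regs_of (Plus e f) = regs_of e \<union> regs_of f"
| "regs_of (Minus e f) = regs_of e \<union> regs_of f"

primrec arrs_of :: "exp \<Rightarrow> string set" where
  "arrs_of (Const c) = {}"
| "arrs_of (Reg x) = {}"
| "arrs_of (Read a e) = insert a (arrs_of e)"
| "arrs_of (Plus e f) = arrs_of e \<union> arrs_of f"
| "arrs_of (Minus e f) = arrs_of e \<union> arrs_of f"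

definition agree_except :: "string set \<Rightarrow> string set \<Rightarrow> store \<Rightarrow> store \<Rightarrow> bool" where
  "agree_except X Y s s' \<longleftrightarrow>
     (\<forall>x. x \<notin> X \<longrightarrow> reg s' x = reg s x) \<and> (\<forall>a. a \<notin> Y \<longrightarrow> arr s' a = arr s a)"

lemma agree_refl: "agree_except X Y s s"
  by (simp add: agree_except_def)

lemma agree_reg: "agree_except X Y s s' \<Longrightarrow> x \<notin> X \<Longrightarrow> reg s' x = reg s x"
  by (simp add: agree_except_def)

lemma agree_arr: "agree_except X Y s s' \<Longrightarrow> a \<notin> Y \<Longrightarrow> arr s' a = arr s a"
  by (simp add: agree_except_def)

lemma agree_set_reg: "agree_except X Y s s' \<Longrightarrow> x \<in> X \<Longrightarrow> agree_except X Y s (set_reg x v s')"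
  by (auto simp: agree_except_def)

lemma agree_set_arr: "agree_except X Y s s' \<Longrightarrow> a \<in> Y \<Longrightarrow> agree_except X Y s (set_arr a i v s')"
  by (auto simp: agree_except_def)

lemma exp_val_cong:
  assumes "\<And>x. x \<in> regs_of e \<Longrightarrow> reg s' x = reg s x" "\<And>a. a \<in> arrs_of e \<Longrightarrow> arr s' a = arr s a"
  shows "exp_val e s' = exp_val e s"
  using assms by (induction e) auto

lemma exp_val_agree:
  assumes "agree_except X Y s s'" "regs_of e \<inter> X = {}" "arrs_of e \<inter> Y = {}"
  shows "exp_val e s' = exp_val e s"
  using assms by (intro exp_val_cong) (auto simp: agree_except_def)

text \<open>Summing an expression that ignores the counter multiplies, which the machine cannot do
  in one step; row offsets and the size bound are obtained in this way.\<close>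

definition Sum :: "string \<Rightarrow> string \<Rightarrow> exp \<Rightarrow> exp \<Rightarrow> prog" where
  "Sum x c b e = Seq (Assign c (Const 0)) (For x b (Assign c (Plus (Reg c) e)))"

lemma loop_depth_Sum [simp]: "loop_depth (Sum x c b e) = 1"
  by (simp add: Sum_def)

lemma runs_Sum:
  assumes "x \<noteq> c" "c \<notin> regs_of e" "x \<notin> regs_of b" "c \<notin> regs_of b" and m: "exp_val b s = m" "m \<le> N"
  shows "runs N (Sum x c b e) s (set_reg c (\<Sum>i<m. exp_val e (set_reg x i s)) (set_reg x m s))"
proof -
  define v where "v i = (\<Sum>j<i. exp_val e (set_reg x j s))" for i
  let ?I = "\<lambda>i \<sigma>. \<sigma> = set_reg c (v i) (set_reg x i s)"
  have "\<exists>s'. runs N (For x b (Assign c (Plus (Reg c) e))) (set_reg c 0 s) s' \<and> reg s' x = m \<and> ?I m s'"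
  proof (rule runs_For)
    show "?I 0 (set_reg x 0 (set_reg c 0 s))"
      using assms(1) by (simp add: v_def set_reg_commute)
    fix i \<sigma> assume I: "?I i \<sigma>"
    then show "exp_val b \<sigma> = m"
      using assms(1-4) m(1) by (subst m(1)[symmetric], intro exp_val_cong) auto
    assume "i < m"
    have "exp_val e \<sigma> = exp_val e (set_reg x i s)"
      unfolding I using assms(2) by (intro exp_val_cong) auto
    then have val: "exp_val (Plus (Reg c) e) \<sigma> = v (Suc i)"
      using I assms(1) by (simp add: v_def)
    have "set_reg x (Suc i) (set_reg c (v (Suc i)) \<sigma>) = set_reg c (v (Suc i)) (set_reg x (Suc i) s)"
      unfolding I using assms(1) by (simp add: set_reg_commute[of x c])
    then show "\<exists>s'. runs N (Assign c (Plus (Reg c) e)) \<sigma> s' \<and> reg s' x = i \<and> ?I (Suc i) (set_reg x (Suc i) s')"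
      using runs_Assign[of N c "Plus (Reg c) e" \<sigma>] I assms(1) unfolding val
      by (intro exI[of _ "set_reg c (v (Suc i)) \<sigma>"]) simp
  qed (fact m(2))
  then have "runs N (For x b (Assign c (Plus (Reg c) e))) (set_reg c 0 s) (set_reg c (v m) (set_reg x m s))"
    by (elim exE conjE) simp
  moreover have "runs N (Assign c (Const 0)) s (set_reg c 0 s)"
    using runs_Assign[of N c "Const 0" s] by simp
  ultimately show ?thesis unfolding Sum_def v_def using runs_Seq by blast
qed

text \<open>The entry \<open>e'\<close> may use, in register \<open>c\<close>, the sum of \<open>e\<close> over \<open>w\<close>. Register \<open>i\<close> holds
  the offset of the current row.\<close>

definition Fill :: "exp \<Rightarrow> string \<Rightarrow> exp \<Rightarrow> exp \<Rightarrow> prog" where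
  "Fill b a e e' = For ''u'' b (Seq (Sum ''v'' ''i'' b (Reg ''u'')) (For ''v'' b
     (Seq (Sum ''w'' ''c'' b e) (Store a (Plus (Reg ''i'') (Reg ''v'')) e'))))"

abbreviation scratch :: "string set" where
  "scratch \<equiv> {''u'', ''v'', ''w'', ''c'', ''i''}"

lemma loop_depth_Fill [simp]: "loop_depth (Fill b a e e') = 3"
  by (simp add: Fill_def)

text \<open>Neither expression reads the array being written or a scratch register other than those
  set for the current entry, so every entry can be evaluated in the initial store
  \<open>s\<close>.\<close>

lemma runs_Fill:
  assumes b: "regs_of b \<inter> scratch = {}" "a \<notin> arrs_of b"
    and e: "''c'' \<notin> regs_of e" "''i'' \<notin> regs_of e" "a \<notin> arrs_of e"
    and e': "''w'' \<notin> regs_of e'" "''i'' \<notin> regs_of e'" "a \<notin> arrs_of e'"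
    and m: "exp_val b s = m" "m \<le> N"
  defines "entry \<equiv> \<lambda>u v. exp_val e' (set_reg ''c''
      (\<Sum>w<m. exp_val e (set_reg ''w'' w (set_reg ''v'' v (set_reg ''u'' u s))))
      (set_reg ''v'' v (set_reg ''u'' u s)))"
  shows "\<exists>s'. runs N (Fill b a e e') s s' \<and> agree_except scratch {a} s s' \<and>
    (\<forall>u<m. \<forall>v<m. arr s' a (u * m + v) = entry u v)"
proof -
  \<comment> \<open>In row-major order the first \<open>v\<close> entries of row \<open>u\<close>
    together with all earlier rows form an initial segment, so one predicate serves as invariant of
    both loops.\<close>
  define filled where "filled q \<sigma> \<longleftrightarrow> agree_except scratch {a} s \<sigma> \<and>
    (\<forall>p<q. arr \<sigma> a p = entry (p div m) (p mod m))" for q \<sigma>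
  have filled_b: "exp_val b \<sigma> = m" if "filled q \<sigma>" for q \<sigma>
    using that exp_val_agree[of scratch "{a}" s \<sigma> b] b m(1) unfolding filled_def by auto
  have filled_reg: "filled q (set_reg x v \<sigma>)" if "filled q \<sigma>" "x \<in> scratch" for q x v \<sigma>
    using that unfolding filled_def using agree_set_reg[of scratch "{a}" s \<sigma> x v] by simp
  let ?inner = "Seq (Sum ''w'' ''c'' b e) (Store a (Plus (Reg ''i'') (Reg ''v'')) e')"
  have inner: "\<exists>\<sigma>'. runs N ?inner \<sigma> \<sigma>' \<and> reg \<sigma>' ''v'' = v \<and> reg \<sigma>' ''u'' = u \<and>
      reg \<sigma>' ''i'' = u * m \<and> filled (u * m + Suc v) \<sigma>'"
    if v: "v < m" and \<sigma>: "filled (u * m + v) \<sigma>" "reg \<sigma> ''u'' = u" "reg \<sigma> ''i'' = u * m"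
      "reg \<sigma> ''v'' = v" for u v \<sigma>
  proof -
    have ag: "agree_except scratch {a} s \<sigma>" using \<sigma>(1) by (simp add: filled_def)
    let ?c = "\<Sum>w<m. exp_val e (set_reg ''w'' w \<sigma>)"
    let ?\<tau> = "set_reg ''c'' ?c (set_reg ''w'' m \<sigma>)"
    have r1: "runs N (Sum ''w'' ''c'' b e) \<sigma> ?\<tau>"
      using b(1) e(1) by (intro runs_Sum filled_b[OF \<sigma>(1)] m(2)) auto
    have ev: "exp_val e (set_reg ''w'' w \<sigma>) =
        exp_val e (set_reg ''w'' w (set_reg ''v'' v (set_reg ''u'' u s)))" for w
    proof (intro exp_val_cong)
      fix x assume "x \<in> regs_of e"
      then have "x \<in> {''u'', ''v'', ''w''} \<or> x \<notin> scratch" using e by auto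
      then show "reg (set_reg ''w'' w \<sigma>) x = reg (set_reg ''w'' w (set_reg ''v'' v (set_reg ''u'' u s))) x"
        using agree_reg[OF ag, of x] \<sigma>(2,4) by auto
    qed (use agree_arr[OF ag] e(3) in \<open>metis set_simps(2) singletonD\<close>)
    have val: "exp_val e' ?\<tau> = entry u v"
      unfolding entry_def ev
    proof (intro exp_val_cong)
      fix x assume "x \<in> regs_of e'"
      then have "x \<in> {''u'', ''v'', ''c''} \<or> x \<notin> scratch" using e' by auto
      then show "reg (set_reg ''c'' y (set_reg ''w'' m \<sigma>)) x =
          reg (set_reg ''c'' y (set_reg ''v'' v (set_reg ''u'' u s))) x" for y
        using agree_reg[OF ag, of x] \<sigma>(2,4) by auto
    qed (use agree_arr[OF ag] e'(3) in \<open>metis set_simps(2) singletonD\<close>)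
    let ?\<sigma>' = "set_arr a (u * m + v) (entry u v) ?\<tau>"
    have r2: "runs N (Store a (Plus (Reg ''i'') (Reg ''v'')) e') ?\<tau> ?\<sigma>'"
      using runs_Store[of N a "Plus (Reg ''i'') (Reg ''v'')" e' ?\<tau>] \<sigma>(3,4) unfolding val by simp
    have "agree_except scratch {a} s ?\<sigma>'"
      by (intro agree_set_arr agree_set_reg ag) auto
    then have "filled (u * m + Suc v) ?\<sigma>'"
      using \<sigma>(1) v unfolding filled_def by (auto simp: less_Suc_eq)
    then show ?thesis using runs_Seq[OF r1 r2] \<sigma>(2-4) by (intro exI[of _ ?\<sigma>']) simp
  qed
  let ?row = "Seq (Sum ''v'' ''i'' b (Reg ''u'')) (For ''v'' b ?inner)"
  have row: "\<exists>\<sigma>'. runs N ?row \<sigma> \<sigma>' \<and> reg \<sigma>' ''u'' = u \<and> filled (Suc u * m) \<sigma>'"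
    if \<sigma>: "filled (u * m) \<sigma>" "reg \<sigma> ''u'' = u" for u \<sigma>
  proof -
    let ?\<tau> = "set_reg ''i'' (u * m) (set_reg ''v'' m \<sigma>)"
    have r1: "runs N (Sum ''v'' ''i'' b (Reg ''u'')) \<sigma> ?\<tau>"
      using runs_Sum[of "''v''" "''i''" "Reg ''u''" b \<sigma> m N] b(1) filled_b[OF \<sigma>(1)] m(2) \<sigma>(2)
      by (auto simp: mult.commute)
    let ?I = "\<lambda>v \<sigma>. filled (u * m + v) \<sigma> \<and> reg \<sigma> ''u'' = u \<and> reg \<sigma> ''i'' = u * m"
    have "\<exists>\<sigma>'. runs N (For ''v'' b ?inner) ?\<tau> \<sigma>' \<and> reg \<sigma>' ''v'' = m \<and> ?I m \<sigma>'"
    proof (rule runs_For[where I = ?I])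
      show "?I 0 (set_reg ''v'' 0 ?\<tau>)" using \<sigma> by (auto intro!: filled_reg)
      fix v \<sigma> assume I: "?I v \<sigma>"
      then show "exp_val b \<sigma> = m" using filled_b by blast
      assume "v < m" "reg \<sigma> ''v'' = v"
      then obtain \<sigma>' where "runs N ?inner \<sigma> \<sigma>'" "reg \<sigma>' ''v'' = v" "reg \<sigma>' ''u'' = u"
        "reg \<sigma>' ''i'' = u * m" "filled (u * m + Suc v) \<sigma>'" using inner I by blast
      then show "\<exists>\<sigma>'. runs N ?inner \<sigma> \<sigma>' \<and> reg \<sigma>' ''v'' = v \<and> ?I (Suc v) (set_reg ''v'' (Suc v) \<sigma>')"
        by (intro exI[of _ \<sigma>']) (auto intro!: filled_reg)
    qed (fact m(2))
    then obtain \<sigma>' where r2: "runs N (For ''v'' b ?inner) ?\<tau> \<sigma>'" and "?I m \<sigma>'" by blast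
    then show ?thesis using runs_Seq[OF r1 r2] by (intro exI[of _ \<sigma>']) (simp add: add.commute)
  qed
  have "\<exists>\<sigma>'. runs N (For ''u'' b ?row) s \<sigma>' \<and> reg \<sigma>' ''u'' = m \<and> filled (m * m) \<sigma>'"
  proof (rule runs_For[where I = "\<lambda>u. filled (u * m)"])
    show "filled (0 * m) (set_reg ''u'' 0 s)"
      by (intro filled_reg) (auto simp: filled_def agree_refl)
    fix u \<sigma> assume I: "filled (u * m) \<sigma>"
    then show "exp_val b \<sigma> = m" using filled_b by blast
    assume "reg \<sigma> ''u'' = u"
    then obtain \<sigma>' where "runs N ?row \<sigma> \<sigma>'" "reg \<sigma>' ''u'' = u" "filled (Suc u * m) \<sigma>'"
      using row I by blast
    then show "\<exists>\<sigma>'. runs N ?row \<sigma> \<sigma>' \<and> reg \<sigma>' ''u'' = u \<and> filled (Suc u * m) (set_reg ''u'' (Suc u) \<sigma>')"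
      by (intro exI[of _ \<sigma>']) (auto intro!: filled_reg)
  qed (fact m(2))
  then obtain s' where s': "runs N (Fill b a e e') s s'" "filled (m * m) s'"
    unfolding Fill_def by blast
  have "arr s' a (u * m + v) = entry u v" if "u < m" "v < m" for u v
  proof -
    have "u * m + v < Suc u * m" using that by simp
    also have "\<dots> \<le> m * m" using that by (intro mult_right_mono) auto
    finally show ?thesis using s'(2) that unfolding filled_def by simp
  qed
  then show ?thesis using s' unfolding filled_def by blast
qed

definition Sum2 :: "string \<Rightarrow> exp \<Rightarrow> exp \<Rightarrow> prog" where
  "Sum2 f b e = Seq (Assign f (Const 0))
     (For ''u'' b (Seq (Sum ''v'' ''c'' b e) (Assign f (Plus (Reg f) (Reg ''c'')))))"

lemma loop_depth_Sum2 [simp]: "loop_depth (Sum2 f b e) = 2"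
  by (simp add: Sum2_def)

lemma runs_Sum2:
  assumes b: "regs_of b \<inter> scratch = {}" "f \<notin> regs_of b" and f: "f \<notin> scratch"
    and e: "regs_of e \<inter> {''c'', ''w'', ''i'', f} = {}"
    and m: "exp_val b s = m" "m \<le> N"
  shows "\<exists>s'. runs N (Sum2 f b e) s s' \<and> agree_except (insert f scratch) {} s s' \<and>
    reg s' f = (\<Sum>u<m. \<Sum>v<m. exp_val e (set_reg ''v'' v (set_reg ''u'' u s)))"
proof -
  define g where "g u = (\<Sum>v<m. exp_val e (set_reg ''v'' v (set_reg ''u'' u s)))" for u
  let ?I = "\<lambda>u \<sigma>. agree_except (insert f scratch) {} s \<sigma> \<and> reg \<sigma> f = (\<Sum>u<u. g u)"
  let ?body = "Seq (Sum ''v'' ''c'' b e) (Assign f (Plus (Reg f) (Reg ''c'')))"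
  have I_b: "exp_val b \<sigma> = m" if "?I u \<sigma>" for u \<sigma>
    using that exp_val_agree[of "insert f scratch" "{}" s \<sigma> b] b m(1) by auto
  have "\<exists>\<sigma>. runs N (For ''u'' b ?body) (set_reg f 0 s) \<sigma> \<and> reg \<sigma> ''u'' = m \<and> ?I m \<sigma>"
  proof (rule runs_For[where I = ?I])
    show "?I 0 (set_reg ''u'' 0 (set_reg f 0 s))"
      using f by (auto intro!: agree_set_reg agree_refl)
    fix u \<sigma> assume I: "?I u \<sigma>"
    show bm: "exp_val b \<sigma> = m" using I_b[OF I] .
    assume u: "reg \<sigma> ''u'' = u"
    let ?\<tau> = "set_reg ''c'' (\<Sum>v<m. exp_val e (set_reg ''v'' v \<sigma>)) (set_reg ''v'' m \<sigma>)"
    have r1: "runs N (Sum ''v'' ''c'' b e) \<sigma> ?\<tau>"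
      using b e by (intro runs_Sum bm m(2)) auto
    have "exp_val e (set_reg ''v'' v \<sigma>) = exp_val e (set_reg ''v'' v (set_reg ''u'' u s))" for v
    proof (intro exp_val_cong)
      fix x assume "x \<in> regs_of e"
      then have "x \<in> {''u'', ''v''} \<or> x \<notin> insert f scratch" using e by auto
      then show "reg (set_reg ''v'' v \<sigma>) x = reg (set_reg ''v'' v (set_reg ''u'' u s)) x"
        using agree_reg[OF conjunct1[OF I], of x] u by auto
    qed (use agree_arr[OF conjunct1[OF I]] in auto)
    then have sum: "(\<Sum>v<m. exp_val e (set_reg ''v'' v \<sigma>)) = g u"
      unfolding g_def by simp
    have r2: "runs N (Assign f (Plus (Reg f) (Reg ''c''))) ?\<tau> (set_reg f (\<Sum>u<Suc u. g u) ?\<tau>)"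
      using runs_Assign[of N f "Plus (Reg f) (Reg ''c'')" ?\<tau>] I f unfolding sum by simp
    show "\<exists>\<sigma>'. runs N ?body \<sigma> \<sigma>' \<and> reg \<sigma>' ''u'' = u \<and> ?I (Suc u) (set_reg ''u'' (Suc u) \<sigma>')"
      using runs_Seq[OF r1 r2] u f I
      by (intro exI[of _ "set_reg f (\<Sum>u<Suc u. g u) ?\<tau>"]) (auto intro!: agree_set_reg)
  qed (fact m(2))
  moreover have "runs N (Assign f (Const 0)) s (set_reg f 0 s)"
    using runs_Assign[of N f "Const 0" s] by simp
  ultimately show ?thesis unfolding Sum2_def g_def using runs_Seq by blast
qed

section \<open>The kernelization program\<close>

text \<open>Truth values are 0 and 1.\<close>

definition less_exp :: "exp \<Rightarrow> exp \<Rightarrow> exp" where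
  "less_exp x y = Minus (Const 1) (Minus (Const 1) (Minus y x))"

text \<open>Comparisons are expressions rather than tests, so that they can be summed and stored.
  One of the two truncated differences is always 0, and their sum vanishes exactly for equal
  values.\<close>

definition eq_exp :: "exp \<Rightarrow> exp \<Rightarrow> exp" where
  "eq_exp x y = Minus (Const 1) (Plus (Minus x y) (Minus y x))"

definition not_exp :: "exp \<Rightarrow> exp" where
  "not_exp x = Minus (Const 1) x"

definition or_exp :: "exp \<Rightarrow> exp \<Rightarrow> exp" where
  "or_exp x y = less_exp (Const 0) (Plus x y)"

definition and_exp :: "exp \<Rightarrow> exp \<Rightarrow> exp" where
  "and_exp x y = not_exp (or_exp (not_exp x) (not_exp y))"

definition le_exp :: "exp \<Rightarrow> exp \<Rightarrow> exp" where
  "le_exp x y = not_exp (Minus x y)"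

lemma exp_val_bool [simp]:
  "exp_val (less_exp x y) s = of_bool (exp_val x s < exp_val y s)"
  "exp_val (eq_exp x y) s = of_bool (exp_val x s = exp_val y s)"
  "exp_val (not_exp x) s = of_bool (exp_val x s = 0)"
  "exp_val (or_exp x y) s = of_bool (0 < exp_val x s \<or> 0 < exp_val y s)"
  "exp_val (and_exp x y) s = of_bool (0 < exp_val x s \<and> 0 < exp_val y s)"
  "exp_val (le_exp x y) s = of_bool (exp_val x s \<le> exp_val y s)"
  by (auto simp: less_exp_def eq_exp_def not_exp_def or_exp_def and_exp_def le_exp_def)

lemma regs_of_bool [simp]:
  "regs_of (less_exp x y) = regs_of x \<union> regs_of y"
  "regs_of (eq_exp x y) = regs_of x \<union> regs_of y"
  "regs_of (not_exp x) = regs_of x"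
  "regs_of (or_exp x y) = regs_of x \<union> regs_of y"
  "regs_of (and_exp x y) = regs_of x \<union> regs_of y"
  "regs_of (le_exp x y) = regs_of x \<union> regs_of y"
  by (auto simp: less_exp_def eq_exp_def not_exp_def or_exp_def and_exp_def le_exp_def)

lemma arrs_of_bool [simp]:
  "arrs_of (less_exp x y) = arrs_of x \<union> arrs_of y"
  "arrs_of (eq_exp x y) = arrs_of x \<union> arrs_of y"
  "arrs_of (not_exp x) = arrs_of x"
  "arrs_of (or_exp x y) = arrs_of x \<union> arrs_of y"
  "arrs_of (and_exp x y) = arrs_of x \<union> arrs_of y"
  "arrs_of (le_exp x y) = arrs_of x \<union> arrs_of y"
  by (auto simp: less_exp_def eq_exp_def not_exp_def or_exp_def and_exp_def le_exp_def)

text \<open>Array \<open>r\<close> holds the row offsets \<open>u * n\<close>, so a matrix entry is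
  accessed in constant time without multiplication.\<close>

definition entry :: "string \<Rightarrow> exp \<Rightarrow> exp \<Rightarrow> exp" where
  "entry a x y = Read a (Plus (Read ''r'' x) y)"

lemma entry_simps [simp]:
  "exp_val (entry a x y) s = arr s a (arr s ''r'' (exp_val x s) + exp_val y s)"
  "regs_of (entry a x y) = regs_of x \<union> regs_of y"
  "arrs_of (entry a x y) = {a, ''r''} \<union> arrs_of x \<union> arrs_of y"
  by (auto simp: entry_def)

abbreviation "Ru \<equiv> Reg ''u''"
abbreviation "Rv \<equiv> Reg ''v''"
abbreviation "Rw \<equiv> Reg ''w''"

definition row_table :: prog where
  "row_table = For ''u'' (Reg ''n'')
     (Seq (Sum ''v'' ''c'' (Reg ''n'') Ru) (Store ''r'' Ru (Reg ''c'')))"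

definition reflexive_copy :: "string \<Rightarrow> string \<Rightarrow> prog" where
  "reflexive_copy a b = Fill (Reg ''n'') b (Const 0) (or_exp (eq_exp Ru Rv) (entry a Ru Rv))"

definition conflict_exp :: "string \<Rightarrow> exp" where
  "conflict_exp a = eq_exp (Plus (Plus (entry a Ru Rv) (entry a Ru Rw)) (entry a Rv Rw)) (Const 2)"

fun flippable_exp :: "variant \<Rightarrow> exp" where
  "flippable_exp Editing = Const 1"
| "flippable_exp Deletion = entry ''A'' Ru Rv"
| "flippable_exp Completion = not_exp (entry ''A'' Ru Rv)"

text \<open>Negated equality acts as exclusive or and toggles the entry of a heavy pair. Diagonal
  entries survive because a repeated vertex is in no conflict.\<close>

definition flip_heavy :: "variant \<Rightarrow> prog" where
  "flip_heavy X = Fill (Reg ''n'') ''H'' (conflict_exp ''A'')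
     (not_exp (eq_exp (entry ''A'' Ru Rv)
       (and_exp (less_exp (Reg ''k'') (Reg ''c'')) (flippable_exp X))))"

definition mark_conflicts :: prog where
  "mark_conflicts = Fill (Reg ''n'') ''T'' (conflict_exp ''H'') (less_exp (Const 0) (Reg ''c''))"

fun class_exp :: "distance \<Rightarrow> exp" where
  "class_exp Matching_Dist = and_exp (entry ''H'' Ru Rv) (entry ''C'' Ru Rv)"
| "class_exp Edge_Dist = entry ''H'' Ru Rv"

fun limit_exp :: "distance \<Rightarrow> exp" where
  "limit_exp Matching_Dist = Plus (Reg ''k'') (Plus (Reg ''d'') (Const 2))"
| "limit_exp Edge_Dist = Plus (Reg ''k'') (Plus (Reg ''k'') (Reg ''k''))"

text \<open>Registers \<open>w\<close>, \<open>c\<close> and \<open>i\<close> decide whether \<open>u\<close> is in a conflict, whether its two clusters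
  differ, and its rank in its class. \<open>Z\<close> is the indicator of the kernel set, and \<open>L\<close> enumerates it.\<close>

definition select :: "distance \<Rightarrow> prog" where
  "select D = Seq (Assign ''m'' (Const 0)) (For ''u'' (Reg ''n'')
     (Seq (Sum ''v'' ''w'' (Reg ''n'') (entry ''T'' Ru Rv))
     (Seq (Sum ''v'' ''c'' (Reg ''n'') (not_exp (eq_exp (entry ''H'' Ru Rv) (entry ''C'' Ru Rv))))
     (Seq (Sum ''v'' ''i'' (Reg ''n'') (and_exp (less_exp Rv Ru) (class_exp D)))
     (Seq (Store ''Z'' Ru (or_exp Rw (and_exp (Reg ''c'') (less_exp (Reg ''i'') (limit_exp D)))))
     (Seq (Store ''L'' (Reg ''m'') Ru)
       (Assign ''m'' (Plus (Reg ''m'') (Read ''Z'' Ru)))))))))"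

definition count_flips :: prog where
  "count_flips = Sum2 ''f'' (Reg ''n'')
     (and_exp (less_exp Ru Rv) (not_exp (eq_exp (entry ''A'' Ru Rv) (entry ''H'' Ru Rv))))"

fun count_dropped :: "distance \<Rightarrow> prog" where
  "count_dropped Matching_Dist = Assign ''D'' (Const 0)"
| "count_dropped Edge_Dist = Sum2 ''D'' (Reg ''n'')
     (and_exp (less_exp Ru Rv) (and_exp (not_exp (eq_exp (entry ''H'' Ru Rv) (entry ''C'' Ru Rv)))
       (not_exp (and_exp (Read ''Z'' Ru) (Read ''Z'' Rv)))))"

fun factor_exp :: "distance \<Rightarrow> exp" where
  "factor_exp Matching_Dist = Plus (Reg ''k'') (Reg ''d'')"
| "factor_exp Edge_Dist = Reg ''k''"

definition double :: "exp \<Rightarrow> exp" where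
  "double e = Plus e e"

text \<open>The number of rounds is cut off at \<open>n\<close> to stay within the time bound, as \<open>k\<close> and \<open>d\<close> may
  be arbitrarily large.\<close>

definition size_bound :: "distance \<Rightarrow> prog" where
  "size_bound D = Sum ''v'' ''b'' (Minus (Reg ''n'') (Minus (Reg ''n'') (factor_exp D)))
     (double (double (double (double (Plus (Reg ''k'') (Reg ''d''))))))"

definition verdict :: prog where
  "verdict = Seq
     (Assign ''o'' (and_exp (le_exp (Reg ''f'') (Reg ''k''))
       (and_exp (le_exp (Reg ''D'') (Reg ''d'')) (le_exp (Reg ''m'') (Reg ''b'')))))
     (Cond (Equal (Reg ''o'') (Const 1))
       (Seq (Assign ''k'' (Minus (Reg ''k'') (Reg ''f'')))
            (Assign ''d'' (Minus (Reg ''d'') (Reg ''D''))))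
       (Seq (Assign ''m'' (Const 2)) (Seq (Assign ''k'' (Const 0)) (Assign ''d'' (Const 0)))))"

text \<open>If the flag \<open>o\<close> is 0, then the output is the no-instance whose graphs on two vertices are
  an edge and the empty graph.\<close>

definition write_output :: prog where
  "write_output = Seq
     (Fill (Reg ''m'') ''G'' (Const 0) (and_exp (not_exp (eq_exp Ru Rv))
       (or_exp (not_exp (Reg ''o'')) (entry ''H'' (Read ''L'' Ru) (Read ''L'' Rv)))))
     (Seq (Fill (Reg ''m'') ''Gc'' (Const 0) (and_exp (not_exp (eq_exp Ru Rv))
       (and_exp (Reg ''o'') (entry ''C'' (Read ''L'' Ru) (Read ''L'' Rv)))))
     (Assign ''n'' (Reg ''m'')))"

text \<open>\<open>A\<close> and \<open>C\<close> are the adjacency matrices of the two input graphs with ones on the diagonal,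
  and \<open>H\<close> is \<open>A\<close> after the forced flips.\<close>

definition kernel :: "variant \<Rightarrow> distance \<Rightarrow> prog" where
  "kernel X D =
     Seq row_table (Seq (reflexive_copy ''G'' ''A'') (Seq (reflexive_copy ''Gc'' ''C'')
    (Seq (flip_heavy X) (Seq mark_conflicts (Seq (select D) (Seq count_flips
    (Seq (count_dropped D) (Seq (size_bound D) (Seq verdict write_output)))))))))"

lemma loop_depth_kernel: "loop_depth (kernel X D) = 3"
  by (cases D) (simp_all add: kernel_def row_table_def reflexive_copy_def flip_heavy_def
      mark_conflicts_def select_def count_flips_def size_bound_def verdict_def write_output_def)

section \<open>Correctness of the program stages\<close>

lemma sum_of_bool_card: "(\<Sum>i<n. of_bool (P i)) = card {i \<in> {..<n}. P i}" for n :: nat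
proof -
  have "{i \<in> {..<n}. P i} = {..<n} \<inter> {i. P i}" by blast
  then show ?thesis by (simp add: sum_of_bool_eq)
qed

text \<open>Sorting a pair is a bijection from two-element sets to increasing pairs, so each set is
  counted once.\<close>

lemma sum_pairs_card:
  fixes n :: nat
  assumes F: "\<And>e. e \<in> F \<Longrightarrow> e \<subseteq> {..<n} \<and> card e = 2"
  shows "(\<Sum>u<n. \<Sum>v<n. of_bool (u < v \<and> {u, v} \<in> F)) = card F"
proof -
  let ?P = "Sigma {..<n} (\<lambda>u. {v \<in> {..<n}. u < v \<and> {u, v} \<in> F})"
  have "(\<Sum>u<n. \<Sum>v<n. of_bool (u < v \<and> {u, v} \<in> F)) = card ?P"
    unfolding sum_of_bool_card by (rule card_SigmaI[symmetric]) auto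
  also have "bij_betw (\<lambda>(u, v). {u, v}) ?P F"
    unfolding bij_betw_def
  proof
    show "inj_on (\<lambda>(u, v). {u, v}) ?P"
      by (auto simp: inj_on_def doubleton_eq_iff)
    show "(\<lambda>(u, v). {u, v}) ` ?P = F"
    proof (intro set_eqI iffI)
      fix e assume e: "e \<in> F"
      then obtain a b where "e = {a, b}" "a \<noteq> b" using F[OF e] by (auto simp: card_2_iff)
      then have ab: "e = {min a b, max a b}" "min a b < max a b" by (auto simp: min_def max_def)
      then have "(min a b, max a b) \<in> ?P" using e F[OF e] by auto
      then show "e \<in> (\<lambda>(u, v). {u, v}) ` ?P" using ab(1) by (intro image_eqI) auto
    qed auto
  qed
  then have "card ?P = card F" by (rule bij_betw_same_card)
  finally show ?thesis .
qed

lemma runs_row_table: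
  assumes n: "reg s ''n'' = n" "n \<le> N"
  shows "\<exists>s'. runs N row_table s s' \<and> agree_except scratch {''r''} s s' \<and>
    (\<forall>u<n. arr s' ''r'' u = u * n)"
proof -
  let ?I = "\<lambda>i \<sigma>. agree_except scratch {''r''} s \<sigma> \<and> (\<forall>u<i. arr \<sigma> ''r'' u = u * n)"
  have "\<exists>s'. runs N row_table s s' \<and> reg s' ''u'' = n \<and> ?I n s'"
    unfolding row_table_def
  proof (rule runs_For[where I = ?I])
    show "?I 0 (set_reg ''u'' 0 s)" by (auto intro: agree_set_reg agree_refl)
    fix i \<sigma> assume I: "?I i \<sigma>"
    have n': "reg \<sigma> ''n'' = n" using agree_reg[OF conjunct1[OF I], of "''n''"] n(1) by simp
    then show "exp_val (Reg ''n'') \<sigma> = n" by simp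
    assume i: "reg \<sigma> ''u'' = i" "i < n"
    let ?\<tau> = "set_reg ''c'' (i * n) (set_reg ''v'' n \<sigma>)"
    have r1: "runs N (Sum ''v'' ''c'' (Reg ''n'') Ru) \<sigma> ?\<tau>"
      using runs_Sum[of "''v''" "''c''" Ru "Reg ''n''" \<sigma> n N] n' n(2) i by (simp add: mult.commute)
    have r2: "runs N (Store ''r'' Ru (Reg ''c'')) ?\<tau> (set_arr ''r'' i (i * n) ?\<tau>)"
      using runs_Store[of N "''r''" Ru "Reg ''c''" ?\<tau>] i by simp
    show "\<exists>s'. runs N (Seq (Sum ''v'' ''c'' (Reg ''n'') Ru) (Store ''r'' Ru (Reg ''c''))) \<sigma> s' \<and>
        reg s' ''u'' = i \<and> ?I (Suc i) (set_reg ''u'' (Suc i) s')"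
      using I i by (intro exI[of _ "set_arr ''r'' i (i * n) ?\<tau>"] conjI runs_Seq[OF r1 r2]
          agree_set_reg agree_set_arr) (auto simp: less_Suc_eq)
  qed (fact n(2))
  then show ?thesis by blast
qed

definition ready :: "nat \<Rightarrow> nat \<Rightarrow> nat \<Rightarrow> store \<Rightarrow> bool" where
  "ready n k d s \<longleftrightarrow> reg s ''n'' = n \<and> reg s ''k'' = k \<and> reg s ''d'' = d \<and>
     (\<forall>u<n. arr s ''r'' u = u * n)"

definition matrix :: "nat \<Rightarrow> string \<Rightarrow> (nat \<Rightarrow> nat \<Rightarrow> bool) \<Rightarrow> store \<Rightarrow> bool" where
  "matrix n a P s \<longleftrightarrow> (\<forall>u<n. \<forall>v<n. arr s a (u * n + v) = of_bool (P u v))"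

lemma ready_agree:
  assumes "agree_except X Y s s'" "X \<inter> {''n'', ''k'', ''d''} = {}" "''r'' \<notin> Y" "ready n k d s"
  shows "ready n k d s'"
  using assms by (auto simp: ready_def agree_except_def)

lemma matrix_agree:
  "agree_except X Y s s' \<Longrightarrow> a \<notin> Y \<Longrightarrow> matrix n a P s \<Longrightarrow> matrix n a P s'"
  by (simp add: matrix_def agree_except_def)

lemma runs_matrix:
  assumes s: "ready n k d s" and n: "n \<le> N" and a: "a \<noteq> ''r''"
    and e: "''c'' \<notin> regs_of e" "''i'' \<notin> regs_of e" "a \<notin> arrs_of e"
    and e': "''w'' \<notin> regs_of e'" "''i'' \<notin> regs_of e'" "a \<notin> arrs_of e'"
    and val: "\<And>u v. \<lbrakk>u < n; v < n\<rbrakk> \<Longrightarrow> exp_val e' (set_reg ''c''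
      (\<Sum>w<n. exp_val e (set_reg ''w'' w (set_reg ''v'' v (set_reg ''u'' u s))))
      (set_reg ''v'' v (set_reg ''u'' u s))) = of_bool (P u v)"
  shows "\<exists>s'. runs N (Fill (Reg ''n'') a e e') s s' \<and> agree_except scratch {a} s s' \<and>
    ready n k d s' \<and> matrix n a P s'"
proof -
  have n': "exp_val (Reg ''n'') s = n" using s by (simp add: ready_def)
  obtain s' where s': "runs N (Fill (Reg ''n'') a e e') s s'" "agree_except scratch {a} s s'"
    "\<forall>u<n. \<forall>v<n. arr s' a (u * n + v) = exp_val e' (set_reg ''c''
      (\<Sum>w<n. exp_val e (set_reg ''w'' w (set_reg ''v'' v (set_reg ''u'' u s))))
      (set_reg ''v'' v (set_reg ''u'' u s)))"
    using runs_Fill[OF _ _ e e' n' n] by auto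
  moreover have "ready n k d s'" using ready_agree[OF s'(2) _ _ s] a by simp
  ultimately show ?thesis using val unfolding matrix_def by (intro exI[of _ s']) simp
qed

lemma runs_reflexive_copy:
  assumes s: "ready n k d s" and n: "n \<le> N" and b: "b \<noteq> ''r''" "b \<noteq> a"
    and a: "\<And>i. i < n * n \<Longrightarrow> arr s a i = adj_entry n E i"
  shows "\<exists>s'. runs N (reflexive_copy a b) s s' \<and> agree_except scratch {b} s s' \<and>
    ready n k d s' \<and> matrix n b (adj E) s'"
  unfolding reflexive_copy_def
proof (rule runs_matrix[OF s n b(1)])
  fix u v assume uv: "u < n" "v < n"
  have "u * n + v < Suc u * n" using uv by simp
  also have "\<dots> \<le> n * n" using uv by (intro mult_right_mono) auto
  finally have "arr s a (u * n + v) = of_bool ({u, v} \<in> E)"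
    using a uv by (simp add: adj_entry_def)
  then show "exp_val (or_exp (eq_exp Ru Rv) (entry a Ru Rv)) (set_reg ''c''
      (\<Sum>w<n. exp_val (Const 0) (set_reg ''w'' w (set_reg ''v'' v (set_reg ''u'' u s))))
      (set_reg ''v'' v (set_reg ''u'' u s))) = of_bool (adj E u v)"
    using s uv by (simp add: ready_def adj_def)
qed (use b in auto)

lemma sum_conflict_exp:
  assumes "ready n k d s" "matrix n a (adj E) s" "u < n" "v < n"
  shows "(\<Sum>w<n. exp_val (conflict_exp a) (set_reg ''w'' w (set_reg ''v'' v (set_reg ''u'' u s)))) =
    card {w \<in> {..<n}. conflict E u v w}"
  unfolding sum_of_bool_card[symmetric]
  using assms by (intro sum.cong) (simp_all add: conflict_exp_def ready_def matrix_def conflict_def)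

lemma no_conflict_refl: "{w \<in> V. conflict E v v w} = {}"
  using conflict_distinct(1)[of E v v] by blast

text \<open>\<open>heavy\<close> consists of unordered pairs of distinct vertices; symmetry of
  \<open>conflict\<close> and the absence of conflicts on the diagonal make the formula valid for
  all \<open>u\<close> and \<open>v\<close> that the loops visit.\<close>

lemma adj_flip_heavy_iff:
  assumes uv: "u \<in> V" "v \<in> V"
  shows "adj (sym_diff E (heavy X V E k)) u v \<longleftrightarrow>
    adj E u v \<noteq> (k < card {w \<in> V. conflict E u v w} \<and> flippable X E {u, v})"
proof (cases "u = v")
  case True
  have "\<not> k < card {w \<in> V. conflict E v v w}"
    unfolding no_conflict_refl by simp
  then show ?thesis unfolding True by simp
next
  case False
  have "{u, v} \<in> heavy X V E k \<longleftrightarrow> k < card {w \<in> V. conflict E u v w} \<and> flippable X E {u, v}"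
  proof
    assume "{u, v} \<in> heavy X V E k"
    then obtain u' v' where *: "{u, v} = {u', v'}" "flippable X E {u', v'}"
      "k < card {w \<in> V. conflict E u' v' w}" by (auto simp: heavy_def)
    then consider "u' = u" "v' = v" | "u' = v" "v' = u" by (auto simp: doubleton_eq_iff)
    then have "k < card {w \<in> V. conflict E u v w}"
      using *(3) conflict_perm(1)[of E v u] by cases auto
    then show "k < card {w \<in> V. conflict E u v w} \<and> flippable X E {u, v}" using * by simp
  qed (use uv False in \<open>auto simp: heavy_def\<close>)
  then show ?thesis using False by (auto simp: adj_def)
qed

lemma runs_flip_heavy:
  assumes s: "ready n k d s" "matrix n ''A'' (adj E) s" and n: "n \<le> N"
  shows "\<exists>s'. runs N (flip_heavy X) s s' \<and> agree_except scratch {''H''} s s' \<and>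
    ready n k d s' \<and> matrix n ''H'' (adj (sym_diff E (heavy X {..<n} E k))) s'"
  unfolding flip_heavy_def
proof (rule runs_matrix[OF s(1) n])
  fix u v assume uv: "u < n" "v < n"
  let ?c = "card {w \<in> {..<n}. conflict E u v w}"
  let ?t = "set_reg ''c'' ?c (set_reg ''v'' v (set_reg ''u'' u s))"
  have A: "exp_val (entry ''A'' Ru Rv) ?t = of_bool (adj E u v)"
    using s uv by (simp add: ready_def matrix_def)
  \<comment> \<open>On the diagonal \<open>flippable_exp\<close> reads the entry 1 that stands for
    reflexivity, not for an edge; the conflict count 0 masks the discrepancy.\<close>
  have flip: "k < ?c \<and> 0 < exp_val (flippable_exp X) ?t \<longleftrightarrow> k < ?c \<and> flippable X E {u, v}"
  proof (cases "u = v")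
    case True
    have "\<not> k < card {w \<in> {..<n}. conflict E v v w}"
    unfolding no_conflict_refl by simp
    then show ?thesis unfolding True by blast
  next
    case False
    then show ?thesis using A by (cases X) (simp_all add: adj_def del: entry_simps)
  qed
  show "exp_val (not_exp (eq_exp (entry ''A'' Ru Rv)
      (and_exp (less_exp (Reg ''k'') (Reg ''c'')) (flippable_exp X)))) (set_reg ''c''
      (\<Sum>w<n. exp_val (conflict_exp ''A'') (set_reg ''w'' w (set_reg ''v'' v (set_reg ''u'' u s))))
      (set_reg ''v'' v (set_reg ''u'' u s))) =
      of_bool (adj (sym_diff E (heavy X {..<n} E k)) u v)"
    unfolding sum_conflict_exp[OF s uv] exp_val_bool A
    using s(1) flip adj_flip_heavy_iff[of u "{..<n}" v E X k] uv
    by (simp add: ready_def del: entry_simps)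
qed (cases X; simp add: conflict_exp_def)+

lemma runs_mark_conflicts:
  assumes s: "ready n k d s" "matrix n ''H'' (adj E) s" and n: "n \<le> N"
  shows "\<exists>s'. runs N mark_conflicts s s' \<and> agree_except scratch {''T''} s s' \<and>
    ready n k d s' \<and> matrix n ''T'' (\<lambda>u v. \<exists>w<n. conflict E u v w) s'"
  unfolding mark_conflicts_def
proof (rule runs_matrix[OF s(1) n])
  fix u v assume uv: "u < n" "v < n"
  show "exp_val (less_exp (Const 0) (Reg ''c'')) (set_reg ''c''
      (\<Sum>w<n. exp_val (conflict_exp ''H'') (set_reg ''w'' w (set_reg ''v'' v (set_reg ''u'' u s))))
      (set_reg ''v'' v (set_reg ''u'' u s))) = of_bool (\<exists>w<n. conflict E u v w)"
    unfolding sum_conflict_exp[OF s uv] by (auto simp: card_gt_0_iff)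
qed (simp_all add: conflict_exp_def)

text \<open>Every vertex is written to the next free slot of \<open>L\<close>, but \<open>m\<close>
  advances only if the vertex was selected, so the slot of a rejected vertex remains free.\<close>

lemma runs_select:
  fixes n k d :: nat and D :: distance
  assumes s: "ready n k d s" "matrix n ''T'' (\<lambda>u v. \<exists>w<n. conflict E u v w) s"
      "matrix n ''H'' (adj E) s" "matrix n ''C'' (adj Ec) s"
    and n: "n \<le> N"
  defines "S \<equiv> kernel_set D {..<n} E Ec k d"
  shows "\<exists>s'. runs N (select D) s s' \<and> agree_except (insert ''m'' scratch) {''Z'', ''L''} s s' \<and>
    (\<forall>u<n. arr s' ''Z'' u = of_bool (u \<in> S)) \<and>
    reg s' ''m'' = card S \<and> bij_betw (arr s' ''L'') {..<card S} S"
proof -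
  let ?X = "insert ''m'' scratch" and ?Y = "{''Z'', ''L''}"
  let ?S = "\<lambda>i. S \<inter> {..<i}"
  let ?I = "\<lambda>i \<sigma>. agree_except ?X ?Y s \<sigma> \<and> (\<forall>u<i. arr \<sigma> ''Z'' u = of_bool (u \<in> S)) \<and>
    reg \<sigma> ''m'' = card (?S i) \<and> bij_betw (arr \<sigma> ''L'') {..<card (?S i)} (?S i)"
  let ?e1 = "entry ''T'' Ru Rv" and ?e2 = "not_exp (eq_exp (entry ''H'' Ru Rv) (entry ''C'' Ru Rv))"
    and ?e3 = "and_exp (less_exp Rv Ru) (class_exp D)"
  let ?sel = "or_exp Rw (and_exp (Reg ''c'') (less_exp (Reg ''i'') (limit_exp D)))"
  let ?body = "Seq (Sum ''v'' ''w'' (Reg ''n'') ?e1) (Seq (Sum ''v'' ''c'' (Reg ''n'') ?e2)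
     (Seq (Sum ''v'' ''i'' (Reg ''n'') ?e3) (Seq (Store ''Z'' Ru ?sel)
     (Seq (Store ''L'' (Reg ''m'') Ru) (Assign ''m'' (Plus (Reg ''m'') (Read ''Z'' Ru)))))))"
  have body: "\<exists>\<sigma>'. runs N ?body \<sigma> \<sigma>' \<and> reg \<sigma>' ''u'' = u \<and> ?I (Suc u) \<sigma>'"
    if u: "u < n" and I: "?I u \<sigma>" and reg_u: "reg \<sigma> ''u'' = u" for u \<sigma>
  proof -
    have ag: "agree_except ?X ?Y s \<sigma>" using I by blast
    have rd: "ready n k d \<sigma>" by (rule ready_agree[OF ag _ _ s(1)]) simp_all
    have mats: "matrix n ''T'' (\<lambda>u v. \<exists>w<n. conflict E u v w) \<sigma>"
      "matrix n ''H'' (adj E) \<sigma>" "matrix n ''C'' (adj Ec) \<sigma>"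
      by (rule matrix_agree[OF ag _ s(2)] matrix_agree[OF ag _ s(3)] matrix_agree[OF ag _ s(4)]; simp)+
    have regs: "reg \<sigma> ''n'' = n" "reg \<sigma> ''k'' = k" "reg \<sigma> ''d'' = d" using rd by (auto simp: ready_def)
    define p where "p = (\<Sum>v<n. exp_val ?e1 (set_reg ''v'' v \<sigma>))"
    define \<sigma>1 where "\<sigma>1 = set_reg ''w'' p (set_reg ''v'' n \<sigma>)"
    define q where "q = (\<Sum>v<n. exp_val ?e2 (set_reg ''v'' v \<sigma>1))"
    define \<sigma>2 where "\<sigma>2 = set_reg ''c'' q (set_reg ''v'' n \<sigma>1)"
    define r where "r = (\<Sum>v<n. exp_val ?e3 (set_reg ''v'' v \<sigma>2))"
    define \<sigma>3 where "\<sigma>3 = set_reg ''i'' r (set_reg ''v'' n \<sigma>2)"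
    define z where "z = exp_val ?sel \<sigma>3"
    define \<sigma>4 where "\<sigma>4 = set_arr ''Z'' u z \<sigma>3"
    define \<sigma>5 where "\<sigma>5 = set_arr ''L'' (reg \<sigma> ''m'') u \<sigma>4"
    define \<sigma>6 where "\<sigma>6 = set_reg ''m'' (reg \<sigma> ''m'' + z) \<sigma>5"
    have u': "reg \<sigma>1 ''u'' = u" "reg \<sigma>2 ''u'' = u" "reg \<sigma>3 ''u'' = u" "reg \<sigma>4 ''u'' = u" "reg \<sigma>5 ''u'' = u"
      "reg \<sigma>4 ''m'' = reg \<sigma> ''m''" "reg \<sigma>5 ''m'' = reg \<sigma> ''m''" "arr \<sigma>5 ''Z'' u = z"
      "reg \<sigma>1 ''n'' = n" "reg \<sigma>2 ''n'' = n"
      using reg_u regs by (simp_all add: \<sigma>1_def \<sigma>2_def \<sigma>3_def \<sigma>4_def \<sigma>5_def)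
    have r1: "runs N (Sum ''v'' ''w'' (Reg ''n'') ?e1) \<sigma> \<sigma>1"
      unfolding \<sigma>1_def p_def by (rule runs_Sum) (use regs n in simp_all)
    have r2: "runs N (Sum ''v'' ''c'' (Reg ''n'') ?e2) \<sigma>1 \<sigma>2"
      unfolding \<sigma>2_def q_def by (rule runs_Sum) (use u' n in simp_all)
    have r3: "runs N (Sum ''v'' ''i'' (Reg ''n'') ?e3) \<sigma>2 \<sigma>3"
      unfolding \<sigma>3_def r_def by (rule runs_Sum) (use u' n in \<open>cases D; simp\<close>)+
    have r4: "runs N (Store ''Z'' Ru ?sel) \<sigma>3 \<sigma>4"
      using runs_Store[of N "''Z''" Ru ?sel \<sigma>3] u' unfolding \<sigma>4_def z_def by simp
    have r5: "runs N (Store ''L'' (Reg ''m'') Ru) \<sigma>4 \<sigma>5"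
      using runs_Store[of N "''L''" "Reg ''m''" Ru \<sigma>4] u' unfolding \<sigma>5_def by simp
    have r6: "runs N (Assign ''m'' (Plus (Reg ''m'') (Read ''Z'' Ru))) \<sigma>5 \<sigma>6"
      using runs_Assign[of N "''m''" "Plus (Reg ''m'') (Read ''Z'' Ru)" \<sigma>5] u' unfolding \<sigma>6_def by simp
    have run: "runs N ?body \<sigma> \<sigma>6"
      by (intro runs_Seq[OF r1] runs_Seq[OF r2] runs_Seq[OF r3] runs_Seq[OF r4] runs_Seq[OF r5] r6)
    \<comment> \<open>The three sums are counts; for the first two only positivity matters, and the
      third is the rank of \<open>u\<close> in its class.\<close>
    have p: "p = (\<Sum>v<n. of_bool (\<exists>w<n. conflict E u v w))"
      unfolding p_def using rd mats u reg_u
      by (intro sum.cong) (simp_all add: ready_def matrix_def)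
    then have p0: "0 < p \<longleftrightarrow> u \<in> conflicted {..<n} E"
      unfolding sum_of_bool_card using u by (auto simp: conflicted_def card_gt_0_iff)
    have q: "q = (\<Sum>v<n. of_bool (adj E u v \<noteq> adj Ec u v))"
      unfolding q_def \<sigma>1_def using rd mats u reg_u
      by (intro sum.cong) (simp_all add: ready_def matrix_def)
    then have q0: "0 < q \<longleftrightarrow> cls {..<n} E u \<noteq> cls {..<n} Ec u"
      unfolding sum_of_bool_card by (auto simp: cls_def card_gt_0_iff)
    have r: "r = (\<Sum>v<n. of_bool (v < u \<and> v \<in> class_of D {..<n} E Ec u))"
      unfolding r_def \<sigma>2_def \<sigma>1_def using rd mats u reg_u
      by (intro sum.cong) (cases D; simp add: ready_def matrix_def cls_def)+
    have "{v \<in> {..<n}. v < u \<and> v \<in> class_of D {..<n} E Ec u} = {v \<in> class_of D {..<n} E Ec u. v < u}"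
      using u by auto
    then have r: "r = card {v \<in> class_of D {..<n} E Ec u. v < u}"
      using r unfolding sum_of_bool_card by simp
    have "reg \<sigma>3 ''w'' = p" "reg \<sigma>3 ''c'' = q" "reg \<sigma>3 ''i'' = r" "exp_val (limit_exp D) \<sigma>3 = limit D k d"
      using regs by (simp_all add: \<sigma>1_def \<sigma>2_def \<sigma>3_def) (cases D; simp)
    then have z: "z = of_bool (u \<in> S)"
      unfolding z_def S_def kernel_set_def using p0 q0 r u by simp
    have "agree_except ?X ?Y s \<sigma>6"
      unfolding \<sigma>1_def \<sigma>2_def \<sigma>3_def \<sigma>4_def \<sigma>5_def \<sigma>6_def
      by (intro agree_set_reg agree_set_arr ag) simp_all
    moreover have "\<forall>u'<Suc u. arr \<sigma>6 ''Z'' u' = of_bool (u' \<in> S)"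
      using I z by (auto simp: \<sigma>1_def \<sigma>2_def \<sigma>3_def \<sigma>4_def \<sigma>5_def \<sigma>6_def less_Suc_eq)
    moreover have "reg \<sigma>6 ''m'' = card (?S (Suc u)) \<and>
        bij_betw (arr \<sigma>6 ''L'') {..<card (?S (Suc u))} (?S (Suc u))"
    proof -
      let ?m = "card (?S u)"
      have m: "reg \<sigma> ''m'' = ?m" and bij: "bij_betw (arr \<sigma> ''L'') {..<?m} (?S u)" using I by auto
      have L: "arr \<sigma>6 ''L'' = (arr \<sigma> ''L'')(?m := u)"
        using m by (simp add: \<sigma>1_def \<sigma>2_def \<sigma>3_def \<sigma>4_def \<sigma>5_def \<sigma>6_def)
      have bij': "bij_betw (arr \<sigma>6 ''L'') {..<?m} (?S u)"
        using bij by (subst bij_betw_cong[of _ _ "arr \<sigma> ''L''"]) (auto simp: L)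
      have m6: "reg \<sigma>6 ''m'' = ?m + z" using m by (simp add: \<sigma>6_def)
      show ?thesis
      proof (cases "u \<in> S")
        case True
        have S: "?S (Suc u) = insert u (?S u)" using True by (auto simp: less_Suc_eq)
        then have card: "card (?S (Suc u)) = Suc ?m" by simp
        have "bij_betw (arr \<sigma>6 ''L'') (insert ?m {..<?m}) (insert u (?S u))"
          using bij' notIn_Un_bij_betw[of ?m "{..<?m}" "arr \<sigma>6 ''L''" "?S u"] by (simp add: L)
        then show ?thesis using m6 z True unfolding S card[unfolded S] by (simp add: lessThan_Suc)
      next
        case False
        have "?S (Suc u) = ?S u" using False by (auto simp: less_Suc_eq)
        then show ?thesis using m6 z False bij' by simp
      qed
    qed
    moreover have "reg \<sigma>6 ''u'' = u" using u' by (simp add: \<sigma>6_def)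
    ultimately show ?thesis using run by (intro exI[of _ \<sigma>6]) simp
  qed
  have "\<exists>s'. runs N (For ''u'' (Reg ''n'') ?body) (set_reg ''m'' 0 s) s' \<and> reg s' ''u'' = n \<and> ?I n s'"
  proof (rule runs_For[where I = ?I])
    show "?I 0 (set_reg ''u'' 0 (set_reg ''m'' 0 s))"
      by (auto intro!: agree_set_reg agree_refl simp: bij_betw_def)
    fix u \<sigma> assume I: "?I u \<sigma>"
    show "exp_val (Reg ''n'') \<sigma> = n"
      using agree_reg[OF conjunct1[OF I], of "''n''"] s(1) by (simp add: ready_def)
    assume "u < n" "reg \<sigma> ''u'' = u"
    then obtain \<sigma>' where "runs N ?body \<sigma> \<sigma>'" "reg \<sigma>' ''u'' = u" "?I (Suc u) \<sigma>'"
      using body I by blast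
    then show "\<exists>s'. runs N ?body \<sigma> s' \<and> reg s' ''u'' = u \<and> ?I (Suc u) (set_reg ''u'' (Suc u) s')"
      by (intro exI[of _ \<sigma>']) (simp add: agree_set_reg)
  qed (fact n)
  then obtain s' where s': "runs N (For ''u'' (Reg ''n'') ?body) (set_reg ''m'' 0 s) s'" "?I n s'" by blast
  have "runs N (Assign ''m'' (Const 0)) s (set_reg ''m'' 0 s)"
    using runs_Assign[of N "''m''" "Const 0" s] by simp
  then have "runs N (select D) s s'" unfolding select_def using s'(1) by (rule runs_Seq)
  moreover have "?S n = S" by (auto simp: S_def kernel_set_def)
  ultimately show ?thesis using s'(2) by (intro exI[of _ s']) simp
qed

lemma runs_count_flips:
  assumes s: "ready n k d s" "matrix n ''A'' (adj E) s" "matrix n ''H'' (adj (sym_diff E F)) s"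
    and n: "n \<le> N" and F: "\<And>e. e \<in> F \<Longrightarrow> e \<subseteq> {..<n} \<and> card e = 2"
  shows "\<exists>s'. runs N count_flips s s' \<and> agree_except (insert ''f'' scratch) {} s s' \<and>
    reg s' ''f'' = card F"
proof -
  let ?e = "and_exp (less_exp Ru Rv) (not_exp (eq_exp (entry ''A'' Ru Rv) (entry ''H'' Ru Rv)))"
  have "exp_val ?e (set_reg ''v'' v (set_reg ''u'' u s)) = of_bool (u < v \<and> {u, v} \<in> F)"
    if "u < n" "v < n" for u v
    using s that by (auto simp: ready_def matrix_def adj_def)
  then have "(\<Sum>u<n. \<Sum>v<n. exp_val ?e (set_reg ''v'' v (set_reg ''u'' u s))) =
      (\<Sum>u<n. \<Sum>v<n. of_bool (u < v \<and> {u, v} \<in> F))"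
    by (intro sum.cong) (auto simp del: exp_val_bool)
  also have "\<dots> = card F" using F by (rule sum_pairs_card)
  finally show ?thesis
    using runs_Sum2[of "Reg ''n''" "''f''" ?e s n N] s(1) n
    unfolding count_flips_def by (simp add: ready_def)
qed

lemma runs_count_dropped:
  assumes s: "ready n k d s" "matrix n ''H'' (adj E) s" "matrix n ''C'' (adj Ec) s"
      "\<forall>u<n. arr s ''Z'' u = of_bool (u \<in> S)"
    and n: "n \<le> N" and E: "graph {..<n} E" "graph {..<n} Ec"
  shows "\<exists>s'. runs N (count_dropped D) s s' \<and> agree_except (insert ''D'' scratch) {} s s' \<and>
    reg s' ''D'' = dropped D E Ec S"
proof (cases D)
  case Matching_Dist
  have "runs N (Assign ''D'' (Const 0)) s (set_reg ''D'' 0 s)"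
    using runs_Assign[of N "''D''" "Const 0" s] by simp
  then show ?thesis using Matching_Dist
    by (intro exI[of _ "set_reg ''D'' 0 s"]) (simp add: agree_set_reg agree_refl)
next
  case Edge_Dist
  let ?F = "{e \<in> sym_diff E Ec. \<not> e \<subseteq> S}"
  let ?e = "and_exp (less_exp Ru Rv) (and_exp (not_exp (eq_exp (entry ''H'' Ru Rv) (entry ''C'' Ru Rv)))
       (not_exp (and_exp (Read ''Z'' Ru) (Read ''Z'' Rv))))"
  have "exp_val ?e (set_reg ''v'' v (set_reg ''u'' u s)) = of_bool (u < v \<and> {u, v} \<in> ?F)"
    if "u < n" "v < n" for u v
    using s that by (auto simp: ready_def matrix_def adj_def)
  then have "(\<Sum>u<n. \<Sum>v<n. exp_val ?e (set_reg ''v'' v (set_reg ''u'' u s))) =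
      (\<Sum>u<n. \<Sum>v<n. of_bool (u < v \<and> {u, v} \<in> ?F))"
    by (intro sum.cong) (auto simp del: exp_val_bool)
  also have "\<dots> = card ?F" using E by (intro sum_pairs_card) (auto simp: graph_def)
  finally show ?thesis
    using runs_Sum2[of "Reg ''n''" "''D''" ?e s n N] s(1) n Edge_Dist
    by (simp add: ready_def)
qed

lemma runs_size_bound:
  assumes s: "ready n k d s" and n: "n \<le> N"
  shows "\<exists>s'. runs N (size_bound D) s s' \<and> agree_except (insert ''b'' scratch) {} s s' \<and>
    reg s' ''b'' = 16 * (min n (size_factor D k d) * (k + d))"
proof -
  let ?b = "Minus (Reg ''n'') (Minus (Reg ''n'') (factor_exp D))"
  let ?e = "double (double (double (double (Plus (Reg ''k'') (Reg ''d'')))))"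
  let ?m = "min n (size_factor D k d)"
  let ?s' = "set_reg ''b'' (\<Sum>v<?m. exp_val ?e (set_reg ''v'' v s)) (set_reg ''v'' ?m s)"
  have fac: "exp_val (factor_exp D) s = size_factor D k d"
    using s by (cases D) (simp_all add: ready_def)
  have "runs N (size_bound D) s ?s'"
    unfolding size_bound_def
  proof (rule runs_Sum)
    show "exp_val ?b s = ?m" using s fac by (simp add: ready_def min_def)
    show "?m \<le> N" using n by simp
  qed (cases D; simp add: double_def)+
  moreover have "(\<Sum>v<?m. exp_val ?e (set_reg ''v'' v s)) = 16 * (?m * (k + d))"
    using s by (simp add: double_def ready_def)
  ultimately show ?thesis
    by (intro exI[of _ ?s']) (simp add: agree_set_reg agree_refl)
qed

lemma runs_verdict:
  "\<exists>s'. runs N verdict s s' \<and> agree_except {''o'', ''k'', ''d'', ''m''} {} s s' \<and>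
    (if reg s ''f'' \<le> reg s ''k'' \<and> reg s ''D'' \<le> reg s ''d'' \<and> reg s ''m'' \<le> reg s ''b''
     then reg s' ''o'' = 1 \<and> reg s' ''k'' = reg s ''k'' - reg s ''f'' \<and>
       reg s' ''d'' = reg s ''d'' - reg s ''D'' \<and> reg s' ''m'' = reg s ''m''
     else reg s' ''o'' = 0 \<and> reg s' ''k'' = 0 \<and> reg s' ''d'' = 0 \<and> reg s' ''m'' = 2)"
proof -
  define ok where "ok \<longleftrightarrow> reg s ''f'' \<le> reg s ''k'' \<and> reg s ''D'' \<le> reg s ''d'' \<and> reg s ''m'' \<le> reg s ''b''"
  let ?e = "and_exp (le_exp (Reg ''f'') (Reg ''k''))
    (and_exp (le_exp (Reg ''D'') (Reg ''d'')) (le_exp (Reg ''m'') (Reg ''b'')))"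
  let ?s1 = "set_reg ''o'' (of_bool ok) s"
  have r1: "runs N (Assign ''o'' ?e) s ?s1"
    using runs_Assign[of N "''o''" ?e s] by (simp add: ok_def)
  let ?yes = "set_reg ''d'' (reg s ''d'' - reg s ''D'') (set_reg ''k'' (reg s ''k'' - reg s ''f'') ?s1)"
  let ?no = "set_reg ''d'' 0 (set_reg ''k'' 0 (set_reg ''m'' 2 ?s1))"
  have yes: "runs N (Seq (Assign ''k'' (Minus (Reg ''k'') (Reg ''f'')))
      (Assign ''d'' (Minus (Reg ''d'') (Reg ''D'')))) ?s1 ?yes"
    using runs_Seq[OF runs_Assign[of N "''k''" "Minus (Reg ''k'') (Reg ''f'')" ?s1]
        runs_Assign[of N "''d''" "Minus (Reg ''d'') (Reg ''D'')"]] by simp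
  have no: "runs N (Seq (Assign ''m'' (Const 2)) (Seq (Assign ''k'' (Const 0)) (Assign ''d'' (Const 0)))) ?s1 ?no"
    using runs_Seq[OF runs_Assign[of N "''m''" "Const 2" ?s1]
        runs_Seq[OF runs_Assign[of N "''k''" "Const 0"] runs_Assign[of N "''d''" "Const 0"]]] by simp
  have r2: "runs N (Cond (Equal (Reg ''o'') (Const 1))
       (Seq (Assign ''k'' (Minus (Reg ''k'') (Reg ''f'')))
            (Assign ''d'' (Minus (Reg ''d'') (Reg ''D''))))
       (Seq (Assign ''m'' (Const 2)) (Seq (Assign ''k'' (Const 0)) (Assign ''d'' (Const 0)))))
      ?s1 (if ok then ?yes else ?no)"
  proof (cases ok)
    case True
    then show ?thesis using yes by (intro runs_Cond) simp_all
  next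
    case False
    then show ?thesis using no by (intro runs_Cond) simp_all
  qed
  have "runs N verdict s (if ok then ?yes else ?no)"
    unfolding verdict_def by (rule runs_Seq[OF r1 r2])
  moreover have "agree_except {''o'', ''k'', ''d'', ''m''} {} s (if ok then ?yes else ?no)"
    by (simp add: agree_set_reg agree_refl)
  ultimately show ?thesis
    by (intro exI[of _ "if ok then ?yes else ?no"]) (simp add: ok_def)
qed

lemma runs_write_output:
  assumes m: "reg s ''m'' = m" "m \<le> N"
  shows "\<exists>s'. runs N write_output s s' \<and> reg s' ''n'' = m \<and> reg s' ''k'' = reg s ''k'' \<and>
    reg s' ''d'' = reg s ''d'' \<and>
    (\<forall>u<m. \<forall>v<m. arr s' ''G'' (u * m + v) = of_bool (u \<noteq> v \<and>
       (reg s ''o'' = 0 \<or> 0 < arr s ''H'' (arr s ''r'' (arr s ''L'' u) + arr s ''L'' v)))) \<and>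
    (\<forall>u<m. \<forall>v<m. arr s' ''Gc'' (u * m + v) = of_bool (u \<noteq> v \<and>
       0 < reg s ''o'' \<and> 0 < arr s ''C'' (arr s ''r'' (arr s ''L'' u) + arr s ''L'' v)))"
proof -
  let ?g = "and_exp (not_exp (eq_exp Ru Rv))
       (or_exp (not_exp (Reg ''o'')) (entry ''H'' (Read ''L'' Ru) (Read ''L'' Rv)))"
  let ?gc = "and_exp (not_exp (eq_exp Ru Rv))
       (and_exp (Reg ''o'') (entry ''C'' (Read ''L'' Ru) (Read ''L'' Rv)))"
  have m': "exp_val (Reg ''m'') s = m" using m(1) by simp
  obtain s1 where s1: "runs N (Fill (Reg ''m'') ''G'' (Const 0) ?g) s s1"
    "agree_except scratch {''G''} s s1"
    "\<forall>u<m. \<forall>v<m. arr s1 ''G'' (u * m + v) = exp_val ?g (set_reg ''c''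
      (\<Sum>w<m. exp_val (Const 0) (set_reg ''w'' w (set_reg ''v'' v (set_reg ''u'' u s))))
      (set_reg ''v'' v (set_reg ''u'' u s)))"
    using runs_Fill[OF _ _ _ _ _ _ _ _ m' m(2), of "''G''" "Const 0" ?g] by auto
  have m1: "exp_val (Reg ''m'') s1 = m" using m(1) agree_reg[OF s1(2), of "''m''"] by simp
  obtain s2 where s2: "runs N (Fill (Reg ''m'') ''Gc'' (Const 0) ?gc) s1 s2"
    "agree_except scratch {''Gc''} s1 s2"
    "\<forall>u<m. \<forall>v<m. arr s2 ''Gc'' (u * m + v) = exp_val ?gc (set_reg ''c''
      (\<Sum>w<m. exp_val (Const 0) (set_reg ''w'' w (set_reg ''v'' v (set_reg ''u'' u s1))))
      (set_reg ''v'' v (set_reg ''u'' u s1)))"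
    using runs_Fill[OF _ _ _ _ _ _ _ _ m1 m(2), of "''Gc''" "Const 0" ?gc] by auto
  have regs: "reg s1 x = reg s x" "reg s2 x = reg s x" if "x \<notin> scratch" for x
    using that agree_reg[OF s1(2)] agree_reg[OF s2(2)] by simp_all
  have arrs: "arr s1 a = arr s a" if "a \<noteq> ''G''" for a
    using that agree_arr[OF s1(2)] by simp
  have G: "arr s2 ''G'' = arr s1 ''G''" using agree_arr[OF s2(2)] by simp
  let ?s3 = "set_reg ''n'' m s2"
  have r3: "runs N (Assign ''n'' (Reg ''m'')) s2 ?s3"
    using runs_Assign[of N "''n''" "Reg ''m''" s2] regs(2)[of "''m''"] m(1) by simp
  have "runs N write_output s ?s3"
    unfolding write_output_def by (intro runs_Seq[OF s1(1)] runs_Seq[OF s2(1)] r3)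
  then show ?thesis
    using s1(3) s2(3) by (intro exI[of _ ?s3]) (simp add: regs arrs G)
qed

section \<open>The instance in the final store\<close>

lemma representsI:
  assumes "reg s ''n'' = num J" "reg s ''k'' = budget J" "reg s ''d'' = bound J"
    and "\<And>u v. \<lbrakk>u < num J; v < num J\<rbrakk> \<Longrightarrow> arr s ''G'' (u * num J + v) = of_bool ({u, v} \<in> edges J)"
    and "\<And>u v. \<lbrakk>u < num J; v < num J\<rbrakk> \<Longrightarrow> arr s ''Gc'' (u * num J + v) = of_bool ({u, v} \<in> cedges J)"
  shows "represents s J"
  unfolding represents_def
proof (intro conjI allI impI)
  fix i assume i: "i < num J * num J"
  then have "i div num J < num J" "i mod num J < num J"
    by (auto simp: less_mult_imp_div_less intro!: mod_less_divisor gr0I)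
  then show "arr s ''G'' i = adj_entry (num J) (edges J) i" "arr s ''Gc'' i = adj_entry (num J) (cedges J) i"
    using assms(4,5)[of "i div num J" "i mod num J"] by (simp_all add: adj_entry_def)
qed (use assms in auto)

definition no_inst :: dc_inst where
  "no_inst = \<lparr>num = 2, edges = {{0, 1}}, cedges = {}, budget = 0, bound = 0\<rparr>"

lemma valid_no_inst: "valid_inst no_inst"
proof -
  have "cluster_graph {..<2 :: nat} {}"
    by (rule cluster_graphI) (auto simp: graph_def adj_def)
  then show ?thesis by (auto simp: valid_inst_def no_inst_def graph_def)
qed

text \<open>Without budget the edge must stay, and both distances tell an edge from two isolated
  vertices.\<close>

lemma not_yes_no_inst: "\<not> yes_inst X D no_inst"
proof
  assume "yes_inst X D no_inst"
  then obtain E' where E': "cluster_graph {..<2 :: nat} E'" "card (sym_diff {{0, 1}} E') = 0"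
    "dist_of D {..<2} E' {} = 0"
    by (auto simp: yes_inst_def no_inst_def DC_solvable_def)
  have "finite (sym_diff {{0, 1}} E')"
    using graph_finite_edges[OF cluster_graph_graph[OF E'(1)]] by simp
  then have eq: "E' = {{0, 1}}" using E'(2) by auto
  have cl: "cluster_graph {..<2 :: nat} {}"
    using valid_no_inst by (simp add: valid_inst_def no_inst_def)
  show False
  proof (cases D)
    case Edge_Dist
    then show False using E'(3) by (simp add: eq edge_dist_def)
  next
    case Matching_Dist
    then have "matching_dist {..<2} E' {} \<le> 0" using E'(3) by simp
    then obtain W where W: "W \<subseteq> {..<2}" "card ({..<2} - W) \<le> 0"
      and agree: "\<And>u v. u \<in> W \<Longrightarrow> v \<in> W \<Longrightarrow> adj E' u v \<longleftrightarrow> adj {} u v"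
      unfolding matching_dist_le_iff[OF E'(1) cl] by blast
    then have "0 \<in> W" "1 \<in> W" by auto
    then show False using agree[of 0 1] by (simp add: eq adj_def)
  qed
qed

text \<open>The loops are bounded by \<open>num I + 2\<close> because the constant no-instance has
  two vertices, possibly more than the input; the same 2 enters the size bound.\<close>

lemma kernel_correct_run:
  assumes valid: "valid_inst I"
  shows "\<exists>s' J. runs (num I + 2) (kernel X D) (input_store I) s' \<and> represents s' J \<and> valid_inst J \<and>
    (yes_inst X D J \<longleftrightarrow> yes_inst X D I) \<and>
    num J \<le> 16 * (size_factor D (budget I) (bound I) * (budget I + bound I)) + 2"
proof -
  define n k d E Ec where "n = num I" and "k = budget I" and "d = bound I"
    and "E = edges I" and "Ec = cedges I"
  note I_defs = n_def k_def d_def E_def Ec_def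
  let ?V = "{..<n}" and ?N = "n + 2"
  have n: "n \<le> ?N" by simp
  have E: "graph ?V E" and Ec: "cluster_graph ?V Ec"
    using valid by (simp_all add: valid_inst_def I_defs)
  define F where "F = heavy X ?V E k"
  define E1 where "E1 = sym_diff E F"
  define S where "S = kernel_set D ?V E1 Ec k d"
  have gE1: "graph ?V E1" unfolding E1_def F_def by (rule graph_sym_diff_heavy[OF E])
  have SV: "S \<subseteq> ?V" by (auto simp: S_def kernel_set_def)
  have F_pairs: "e \<subseteq> ?V \<and> card e = 2" if "e \<in> F" for e
    using that by (auto simp: F_def heavy_def)
  let ?s0 = "input_store I"
  have s0: "reg ?s0 ''n'' = n" "reg ?s0 ''k'' = k" "reg ?s0 ''d'' = d"
    "\<And>i. i < n * n \<Longrightarrow> arr ?s0 ''G'' i = adj_entry n E i"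
    "\<And>i. i < n * n \<Longrightarrow> arr ?s0 ''Gc'' i = adj_entry n Ec i"
    by (simp_all add: input_store_def I_defs)
  obtain s1 where s1: "runs ?N row_table ?s0 s1" "agree_except scratch {''r''} ?s0 s1"
    "\<forall>u<n. arr s1 ''r'' u = u * n" using runs_row_table[OF s0(1) n] by blast
  have ready1: "ready n k d s1"
    using s1(3) agree_reg[OF s1(2)] s0 by (simp add: ready_def)
  have "arr s1 ''G'' i = adj_entry n E i" if "i < n * n" for i
    using that agree_arr[OF s1(2), of "''G''"] s0(4) by simp
  then obtain s2 where s2: "runs ?N (reflexive_copy ''G'' ''A'') s1 s2"
    "agree_except scratch {''A''} s1 s2" "ready n k d s2" "matrix n ''A'' (adj E) s2"
    using runs_reflexive_copy[OF ready1 n, of "''A''" "''G''" E] by auto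
  have "arr s2 ''Gc'' i = adj_entry n Ec i" if "i < n * n" for i
    using that agree_arr[OF s1(2), of "''Gc''"] agree_arr[OF s2(2), of "''Gc''"] s0(5) by simp
  then obtain s3 where s3: "runs ?N (reflexive_copy ''Gc'' ''C'') s2 s3"
    "agree_except scratch {''C''} s2 s3" "ready n k d s3" "matrix n ''C'' (adj Ec) s3"
    using runs_reflexive_copy[OF s2(3) n, of "''C''" "''Gc''" Ec] by auto
  have A3: "matrix n ''A'' (adj E) s3" by (rule matrix_agree[OF s3(2) _ s2(4)]) simp
  obtain s4 where s4: "runs ?N (flip_heavy X) s3 s4" "agree_except scratch {''H''} s3 s4"
    "ready n k d s4" "matrix n ''H'' (adj E1) s4"
    using runs_flip_heavy[OF s3(3) A3 n] unfolding E1_def F_def by blast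
  obtain s5 where s5: "runs ?N mark_conflicts s4 s5" "agree_except scratch {''T''} s4 s5"
    "ready n k d s5" "matrix n ''T'' (\<lambda>u v. \<exists>w<n. conflict E1 u v w) s5"
    using runs_mark_conflicts[OF s4(3,4) n] by blast
  have A5: "matrix n ''A'' (adj E) s5"
    by (rule matrix_agree[OF s5(2) _ matrix_agree[OF s4(2) _ A3]]) simp_all
  have H5: "matrix n ''H'' (adj E1) s5" by (rule matrix_agree[OF s5(2) _ s4(4)]) simp
  have C5: "matrix n ''C'' (adj Ec) s5"
    by (rule matrix_agree[OF s5(2) _ matrix_agree[OF s4(2) _ s3(4)]]) simp_all
  obtain s6 where s6: "runs ?N (select D) s5 s6"
    "agree_except (insert ''m'' scratch) {''Z'', ''L''} s5 s6"
    "\<forall>u<n. arr s6 ''Z'' u = of_bool (u \<in> S)" "reg s6 ''m'' = card S"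
    "bij_betw (arr s6 ''L'') {..<card S} S"
    using runs_select[OF s5(3,4) H5 C5 n] unfolding S_def by blast
  have ready6: "ready n k d s6" by (rule ready_agree[OF s6(2) _ _ s5(3)]) simp_all
  have A6: "matrix n ''A'' (adj E) s6" by (rule matrix_agree[OF s6(2) _ A5]) simp
  have H6: "matrix n ''H'' (adj E1) s6" by (rule matrix_agree[OF s6(2) _ H5]) simp
  have C6: "matrix n ''C'' (adj Ec) s6" by (rule matrix_agree[OF s6(2) _ C5]) simp
  obtain s7 where s7: "runs ?N count_flips s6 s7" "agree_except (insert ''f'' scratch) {} s6 s7"
    "reg s7 ''f'' = card F"
    using runs_count_flips[OF ready6 A6 H6[unfolded E1_def] n F_pairs] by blast
  have ready7: "ready n k d s7" by (rule ready_agree[OF s7(2) _ _ ready6]) simp_all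
  have H7: "matrix n ''H'' (adj E1) s7" by (rule matrix_agree[OF s7(2) _ H6]) simp
  have C7: "matrix n ''C'' (adj Ec) s7" by (rule matrix_agree[OF s7(2) _ C6]) simp
  have Z7: "\<forall>u<n. arr s7 ''Z'' u = of_bool (u \<in> S)"
    using s6(3) agree_arr[OF s7(2)] by simp
  obtain s8 where s8: "runs ?N (count_dropped D) s7 s8"
    "agree_except (insert ''D'' scratch) {} s7 s8" "reg s8 ''D'' = dropped D E1 Ec S"
    using runs_count_dropped[OF ready7 H7 C7 Z7 n gE1 cluster_graph_graph[OF Ec]] by blast
  have ready8: "ready n k d s8" by (rule ready_agree[OF s8(2) _ _ ready7]) simp_all
  obtain s9 where s9: "runs ?N (size_bound D) s8 s9"
    "agree_except (insert ''b'' scratch) {} s8 s9"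
    "reg s9 ''b'' = 16 * (min n (size_factor D k d) * (k + d))"
    using runs_size_bound[OF ready8 n] by blast
  have ready9: "ready n k d s9" by (rule ready_agree[OF s9(2) _ _ ready8]) simp_all
  have arr9: "arr s9 = arr s6"
    using agree_arr[OF s7(2)] agree_arr[OF s8(2)] agree_arr[OF s9(2)] by (intro ext) simp
  have regs9: "reg s9 ''f'' = card F" "reg s9 ''D'' = dropped D E1 Ec S" "reg s9 ''m'' = card S"
    using s7(3) s8(3) s6(4) agree_reg[OF s7(2)] agree_reg[OF s8(2)] agree_reg[OF s9(2)] by simp_all
  obtain s10 where s10: "runs ?N verdict s9 s10" "agree_except {''o'', ''k'', ''d'', ''m''} {} s9 s10"
    "if reg s9 ''f'' \<le> reg s9 ''k'' \<and> reg s9 ''D'' \<le> reg s9 ''d'' \<and> reg s9 ''m'' \<le> reg s9 ''b''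
     then reg s10 ''o'' = 1 \<and> reg s10 ''k'' = reg s9 ''k'' - reg s9 ''f'' \<and>
       reg s10 ''d'' = reg s9 ''d'' - reg s9 ''D'' \<and> reg s10 ''m'' = reg s9 ''m''
     else reg s10 ''o'' = 0 \<and> reg s10 ''k'' = 0 \<and> reg s10 ''d'' = 0 \<and> reg s10 ''m'' = 2"
    using runs_verdict by blast
  have arr10: "arr s10 = arr s6"
    using agree_arr[OF s10(2)] arr9 by (intro ext) simp
  define m where "m = reg s10 ''m''"
  have card_S: "card S \<le> n" using card_mono[OF _ SV] by simp
  have mN: "m \<le> ?N" using s10(3) regs9(3) card_S unfolding m_def by (auto split: if_splits)
  obtain s' where s': "runs ?N write_output s10 s'" "reg s' ''n'' = m" "reg s' ''k'' = reg s10 ''k''"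
    "reg s' ''d'' = reg s10 ''d''"
    "\<And>u v. \<lbrakk>u < m; v < m\<rbrakk> \<Longrightarrow> arr s' ''G'' (u * m + v) = of_bool (u \<noteq> v \<and>
       (reg s10 ''o'' = 0 \<or> 0 < arr s6 ''H'' (arr s6 ''r'' (arr s6 ''L'' u) + arr s6 ''L'' v)))"
    "\<And>u v. \<lbrakk>u < m; v < m\<rbrakk> \<Longrightarrow> arr s' ''Gc'' (u * m + v) = of_bool (u \<noteq> v \<and>
       0 < reg s10 ''o'' \<and> 0 < arr s6 ''C'' (arr s6 ''r'' (arr s6 ''L'' u) + arr s6 ''L'' v))"
    using runs_write_output[OF m_def[symmetric] mN] unfolding arr10 by blast
  have run: "runs ?N (kernel X D) ?s0 s'"
    unfolding kernel_def
    by (intro runs_Seq[OF s1(1)] runs_Seq[OF s2(1)] runs_Seq[OF s3(1)] runs_Seq[OF s4(1)]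
        runs_Seq[OF s5(1)] runs_Seq[OF s6(1)] runs_Seq[OF s7(1)] runs_Seq[OF s8(1)]
        runs_Seq[OF s9(1)] runs_Seq[OF s10(1)] s'(1))
  let ?ok = "card F \<le> k \<and> dropped D E1 Ec S \<le> d \<and> card S \<le> 16 * (size_factor D k d * (k + d))"
  \<comment> \<open>Cutting off at \<open>n\<close> does not affect the verdict: a factor above
    \<open>n\<close> makes \<open>k + d\<close> positive, and then \<open>n * (k + d)\<close> is
    already at least \<open>n\<close>, which is at least \<open>card S\<close>.\<close>
  have size_iff: "card S \<le> 16 * (min n (size_factor D k d) * (k + d)) \<longleftrightarrow>
      card S \<le> 16 * (size_factor D k d * (k + d))"
  proof (cases "size_factor D k d \<le> n")
    case False
    then have "k + d \<noteq> 0" by (cases D) auto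
    then have "n * 1 \<le> n * (k + d)" by (intro mult_le_mono2) linarith
    moreover have "n * (k + d) \<le> size_factor D k d * (k + d)" using False by (intro mult_right_mono) auto
    moreover have "min n (size_factor D k d) = n" using False by simp
    ultimately show ?thesis using card_S by (simp only: mult_1_right) linarith
  qed simp
  have regs9': "reg s9 ''k'' = k" "reg s9 ''d'' = d" using ready9 by (simp_all add: ready_def)
  note verdict = s10(3)[unfolded regs9 regs9' s9(3) size_iff]
  have yes_I: "yes_inst X D I \<longleftrightarrow> ?ok \<and>
      DC_solvable X D S (induced E1 S) (induced Ec S) (k - card F) (d - dropped D E1 Ec S)"
    using kernel_correct[OF E Ec, of X D k d]
    unfolding F_def[symmetric] E1_def[symmetric] S_def[symmetric]
    by (simp add: yes_inst_def I_defs)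
  show ?thesis
  proof (cases ?ok)
    case False
    then have v: "reg s10 ''o'' = 0" "reg s10 ''k'' = 0" "reg s10 ''d'' = 0" "m = 2"
      using verdict unfolding m_def by (auto split: if_splits)
    have "represents s' no_inst"
    proof (rule representsI)
      fix u v :: nat assume uv: "u < num no_inst" "v < num no_inst"
      have "u \<noteq> v \<longleftrightarrow> {u, v} = {0, 1}" using uv by (auto simp: no_inst_def doubleton_eq_iff)
      then show "arr s' ''G'' (u * num no_inst + v) = of_bool ({u, v} \<in> edges no_inst)"
        using s'(5)[of u v] uv v by (simp add: no_inst_def)
      show "arr s' ''Gc'' (u * num no_inst + v) = of_bool ({u, v} \<in> cedges no_inst)"
        using s'(6)[of u v] uv v by (simp add: no_inst_def)
    qed (use s' v in \<open>simp_all add: no_inst_def\<close>)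
    moreover have "\<not> yes_inst X D I" using yes_I False by blast
    ultimately show ?thesis
      using run valid_no_inst not_yes_no_inst[of X D]
      by (intro exI[of _ s'] exI[of _ no_inst]) (simp add: n_def no_inst_def)
  next
    case True
    then have v: "reg s10 ''o'' = 1" "reg s10 ''k'' = k - card F"
      "reg s10 ''d'' = d - dropped D E1 Ec S" "m = card S"
      using verdict unfolding m_def by (auto split: if_splits)
    let ?l = "arr s6 ''L''"
    have bij: "bij_betw ?l {..<m} S" using s6(5) v(4) by simp
    \<comment> \<open>\<open>h\<close> numbers the kept vertices by their position in
      \<open>L\<close>; the output matrices, read through \<open>L\<close>, are those of the images
      of the induced graphs under \<open>h\<close>.\<close>
    define h where "h = the_inv_into {..<m} ?l"
    have hbij: "bij_betw h S {..<m}" unfolding h_def by (rule bij_betw_the_inv_into[OF bij])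
    have h: "inj_on h S" "h ` S = {..<m}" using hbij by (auto simp: bij_betw_def)
    have hl: "h (?l i) = i" if "i < m" for i
      unfolding h_def using the_inv_into_f_f[of ?l "{..<m}" i] bij that by (simp add: bij_betw_def)
    have lS: "?l i \<in> S" if "i < m" for i using bij that by (auto simp: bij_betw_def)
    have gS: "graph S (induced E1 S)" by (rule graph_induced[OF gE1 SV])
    have cS: "cluster_graph S (induced Ec S)" by (rule cluster_graph_induced[OF Ec SV])
    define J where "J = \<lparr>num = m, edges = (`) h ` induced E1 S, cedges = (`) h ` induced Ec S,
      budget = k - card F, bound = d - dropped D E1 Ec S\<rparr>"
    have valid_J: "valid_inst J"
      using graph_image[OF h(1) gS] cluster_graph_image[OF h(1) cS] unfolding h(2)
      by (simp add: valid_inst_def J_def)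
    have mem: "{u, v} \<in> (`) h ` induced B S \<longleftrightarrow> u \<noteq> v \<and> adj B (?l u) (?l v)"
      if uv: "u < m" "v < m" and B: "graph ?V B" for u v B
    proof -
      have gB: "graph S (induced B S)" by (rule graph_induced[OF B SV])
      have "adj ((`) h ` induced B S) u v \<longleftrightarrow> adj B (?l u) (?l v)"
        using adj_image[OF h(1) gB lS[OF uv(1)] lS[OF uv(2)]] hl uv
          adj_induced[OF lS[OF uv(1)] lS[OF uv(2)], of B] by simp
      moreover have "u \<noteq> v" if "{u, v} \<in> (`) h ` induced B S"
      proof -
        have "card {u, v} = 2" using that graph_image[OF h(1) gB] unfolding graph_def by blast
        then show ?thesis by auto
      qed
      ultimately show ?thesis by (auto simp: adj_def)
    qed
    have look: "arr s6 a (arr s6 ''r'' (?l u) + ?l v) = of_bool (P (?l u) (?l v))"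
      if "matrix n a P s6" "u < m" "v < m" for a P u v
    proof -
      have "?l u < n" "?l v < n" using lS that SV by auto
      then show ?thesis using that(1) ready6 by (simp add: matrix_def ready_def)
    qed
    have "represents s' J"
    proof (rule representsI)
      fix u v assume "u < num J" "v < num J"
      then have uv: "u < m" "v < m" by (simp_all add: J_def)
      show "arr s' ''G'' (u * num J + v) = of_bool ({u, v} \<in> edges J)"
        using s'(5)[OF uv] look[OF H6 uv] mem[OF uv gE1] v(1) by (simp add: J_def)
      show "arr s' ''Gc'' (u * num J + v) = of_bool ({u, v} \<in> cedges J)"
        using s'(6)[OF uv] look[OF C6 uv] mem[OF uv cluster_graph_graph[OF Ec]] v(1)
        by (simp add: J_def)
    qed (use s' v in \<open>simp_all add: J_def\<close>)
    moreover have "yes_inst X D J \<longleftrightarrow> yes_inst X D I"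
      unfolding yes_I using True DC_solvable_image_iff[OF h(1) gS cS] unfolding h(2)
      by (simp add: yes_inst_def J_def)
    moreover have "num J \<le> 16 * (size_factor D k d * (k + d)) + 2"
      using True v(4) by (simp add: J_def)
    ultimately show ?thesis
      using run valid_J by (intro exI[of _ s'] exI[of _ J]) (simp add: I_defs)
  qed
qed

text \<open>The factor 2 makes room for \<open>(k + d) * (k + d) \<le> 2 * (k^2 + d^2)\<close>. It
  turns 16 into 32, and the two vertices of the no-instance fit into the additive constant.\<close>

lemma has_cubic_time_kernelI:
  assumes f: "\<And>k d. size_factor D k d * (k + d) \<le> 2 * f k d"
  shows "has_cubic_time_kernel X D f"
proof -
  obtain c where c: "\<And>N. step_bound N (kernel X D) \<le> c * (N + 1) ^ 3"
    using step_bound_le_power[of "kernel X D"] unfolding loop_depth_kernel by blast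
  have "kernelization (kernel X D) X D (\<lambda>k d. 32 * (f k d + 1)) (\<lambda>n. 64 * c * (n ^ 3 + 1))"
    unfolding kernelization_def
  proof (intro allI impI)
    fix I assume valid: "valid_inst I"
    let ?n = "num I" and ?k = "budget I" and ?d = "bound I"
    obtain s' J where J: "runs (?n + 2) (kernel X D) (input_store I) s'" "represents s' J"
      "valid_inst J" "yes_inst X D J \<longleftrightarrow> yes_inst X D I"
      "num J \<le> 16 * (size_factor D ?k ?d * (?k + ?d)) + 2"
      using kernel_correct_run[OF valid] by blast
    obtain t where t: "exec (kernel X D) (input_store I) t s'" "t \<le> step_bound (?n + 2) (kernel X D)"
      using J(1) by (auto simp: runs_def)
    \<comment> \<open>For positive \<open>?n\<close> the base \<open>?n + 3\<close> is at most
      \<open>4 * ?n\<close>, whose cube is \<open>64 * ?n ^ 3\<close>; the additive constant covers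
      \<open>?n = 0\<close>, where the left side is 27.\<close>
    have "(?n + 3) ^ 3 \<le> 64 * (?n ^ 3 + 1)"
    proof (cases "?n = 0")
      case False
      then have "(?n + 3) ^ 3 \<le> (4 * ?n) ^ 3" by (intro power_mono) auto
      then show ?thesis by (simp add: power_mult_distrib)
    qed simp
    then have "c * (?n + 3) ^ 3 \<le> c * (64 * (?n ^ 3 + 1))" by (rule mult_le_mono2)
    moreover have "t \<le> c * (?n + 3) ^ 3" using t(2) c[of "?n + 2"] by (simp add: numeral_3_eq_3)
    ultimately have "t \<le> 64 * c * (?n ^ 3 + 1)" by (simp add: algebra_simps)
    moreover have "num J \<le> 32 * (f ?k ?d + 1)"
      using order_trans[OF J(5) add_right_mono[OF mult_le_mono2[OF f]]] by simp
    ultimately show "\<exists>t s' I'. exec (kernel X D) (input_store I) t s' \<and> t \<le> 64 * c * (?n ^ 3 + 1) \<and>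
        represents s' I' \<and> valid_inst I' \<and> (yes_inst X D I' \<longleftrightarrow> yes_inst X D I) \<and>
        num I' \<le> 32 * (f ?k ?d + 1)"
      using t(1) J(2-4) by blast
  qed
  then show ?thesis unfolding has_cubic_time_kernel_def by blast
qed

theorem theorem16:
  shows "has_cubic_time_kernel Editing Matching_Dist (\<lambda>k d. k^2 + d^2) \<and>
         has_cubic_time_kernel Deletion Matching_Dist (\<lambda>k d. k^2 + d^2) \<and>
         has_cubic_time_kernel Completion Matching_Dist (\<lambda>k d. k^2 + d^2) \<and>
         has_cubic_time_kernel Editing Edge_Dist (\<lambda>k d. k^2 + k * d) \<and>
         has_cubic_time_kernel Deletion Edge_Dist (\<lambda>k d. k^2 + k * d) \<and>
         has_cubic_time_kernel Completion Edge_Dist (\<lambda>k d. k^2 + k * d)"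
proof -
  have "(k + d) * (k + d) \<le> 2 * (k^2 + d^2)" for k d :: nat
  proof -
    \<comment> \<open>Integers, because the square of \<open>k - d\<close> is needed without
      truncation.\<close>
    have "2 * int k * int d \<le> (int k)^2 + (int d)^2"
      using zero_le_power2[of "int k - int d"] by (simp add: power2_diff)
    then have "int ((k + d) * (k + d)) \<le> int (2 * (k^2 + d^2))"
      by (simp add: power2_eq_square algebra_simps)
    then show ?thesis by (simp only: of_nat_le_iff)
  qed
  then show ?thesis
    by (intro conjI has_cubic_time_kernelI) (simp_all add: power2_eq_square algebra_simps)
qed

end
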